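(* In the Wyner-Ziv problem with a helper described in the context, where $Y-X-Z$ is a Markov chain, the operational achievable region equals the single-letter region: $\mathcal R^O_{Y-X-Z}(D)=\mathcal R_{Y-X-Z}(D)$.
   Context: Let $\mathcal X,\mathcal Y,\mathcal Z,\hat{\mathcal X}$ be finite alphabets, $d:\mathcal X\times\hat{\mathcal X}\to[0,\infty)$ a distortion measure, and $(X_i,Y_i,Z_i)$ i.i.d. with distribution $p(x,y,z)=p(x,y)p(z|x)$ (Markov chain $Y-X-Z$). A helper observing $Y^n$ sends a message $T_1=f_1(Y^n)\in\{1,\dots,2^{nR_1}\}$ to both the encoder and the decoder; the encoder observing $X^n$ sends $T=f(X^n,T_1)\in\{1,\dots,2^{nR}\}$ to the decoder; the decoder observes side information $Z^n$ and outputs $\hat X^n=g(T,T_1,Z^n)\in\hat{\mathcal X}^n$. A pair $(R,R_1)$ is achievable at distortion $D$ if for every $\epsilon>0$ and all sufficiently large $n$ there exist such $f_1,f,g$ with $\mathbb E\big[\frac1n\sum_{i=1}^n d(X_i,\hat X_i)\big]\le D+\epsilon$; $\mathcal R^O_{Y-X-Z}(D)$ is the closure of the set of achievable pairs. $\mathcal R_{Y-X-Z}(D)$ is the set of all pairs $(R,R_1)$ with $R_1\ge I(U;Y|Z)$ and $R\ge I(X;W|U,Z)$ for some finite-alphabet auxiliary random variables $U,W$ with joint distribution $p(x,y,z,u,w)=p(x,y)p(z|x)p(u|y)p(w|x,u)$ and a deterministic function $\hat X(U,W,Z)$ with $\mathbb E\, d(X,\hat X(U,W,Z))\le D$. *)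

theory Defs
  imports "HOL-Probability.Probability"
begin

definition cond_mutual_info ::
  "'o pmf \<Rightarrow> ('o \<Rightarrow> 'a) \<Rightarrow> ('o \<Rightarrow> 'b) \<Rightarrow> ('o \<Rightarrow> 'c) \<Rightarrow> real" where
  "cond_mutual_info J A B C =
     (let Pabc = map_pmf (\<lambda>w. (A w, B w, C w)) J;
          Pac  = map_pmf (\<lambda>w. (A w, C w)) J;
          Pbc  = map_pmf (\<lambda>w. (B w, C w)) J;
          Pc   = map_pmf C J
      in \<Sum>(a,b,c)\<in>set_pmf Pabc.
            pmf Pabc (a,b,c) *
            log 2 (pmf Pabc (a,b,c) * pmf Pc c / (pmf Pac (a,c) * pmf Pbc (b,c))))"

definition src_pmf :: "('x \<times> 'y) pmf \<Rightarrow> ('x \<Rightarrow> 'z pmf) \<Rightarrow> ('x \<times> 'y \<times> 'z) pmf" where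
  "src_pmf pxy pzx = do { (x,y) \<leftarrow> pxy; z \<leftarrow> pzx x; return_pmf (x,y,z) }"

definition src_block :: "('x \<times> 'y) pmf \<Rightarrow> ('x \<Rightarrow> 'z pmf) \<Rightarrow> nat \<Rightarrow> (nat \<Rightarrow> 'x \<times> 'y \<times> 'z) pmf" where
  "src_block pxy pzx n = Pi_pmf {..<n} undefined (\<lambda>_. src_pmf pxy pzx)"

definition num_msgs :: "nat \<Rightarrow> real \<Rightarrow> nat" where
  "num_msgs n R = nat \<lfloor>2 powr (real n * R)\<rfloor>"

definition code_distortion ::
  "('x \<times> 'y) pmf \<Rightarrow> ('x \<Rightarrow> 'z pmf) \<Rightarrow> ('x \<Rightarrow> 'xh \<Rightarrow> real) \<Rightarrow> nat \<Rightarrow>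
   ((nat \<Rightarrow> 'y) \<Rightarrow> nat) \<Rightarrow> ((nat \<Rightarrow> 'x) \<Rightarrow> nat \<Rightarrow> nat) \<Rightarrow>
   (nat \<Rightarrow> nat \<Rightarrow> (nat \<Rightarrow> 'z) \<Rightarrow> (nat \<Rightarrow> 'xh)) \<Rightarrow> real" where
  "code_distortion pxy pzx d n f1 f g =
     measure_pmf.expectation (src_block pxy pzx n)
       (\<lambda>s. let xs = (\<lambda>i. fst (s i)); ys = (\<lambda>i. fst (snd (s i))); zs = (\<lambda>i. snd (snd (s i)));
               t1 = f1 ys; t = f xs t1; xh = g t t1 zs
           in (1 / real n) * (\<Sum>i<n. d (xs i) (xh i)))"

definition achievable ::
  "('x \<times> 'y) pmf \<Rightarrow> ('x \<Rightarrow> 'z pmf) \<Rightarrow> ('x \<Rightarrow> 'xh \<Rightarrow> real) \<Rightarrow> real \<Rightarrow> real \<Rightarrow> real \<Rightarrow> bool" where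
  "achievable pxy pzx d D R R1 \<longleftrightarrow>
     (\<forall>\<epsilon>>0. \<exists>N. \<forall>n\<ge>N. \<exists>f1 f g.
        (\<forall>ys. f1 ys \<in> {1..num_msgs n R1}) \<and>
        (\<forall>xs t1. f xs t1 \<in> {1..num_msgs n R}) \<and>
        code_distortion pxy pzx d n f1 f g \<le> D + \<epsilon>)"

definition operational_region ::
  "('x \<times> 'y) pmf \<Rightarrow> ('x \<Rightarrow> 'z pmf) \<Rightarrow> ('x \<Rightarrow> 'xh \<Rightarrow> real) \<Rightarrow> real \<Rightarrow> (real \<times> real) set" where
  "operational_region pxy pzx d D = closure {(R, R1). achievable pxy pzx d D R R1}"

text \<open>Joint distribution p(x,y) p(z|x) p(u|y) p(w|x,u); auxiliary alphabets embedded in nat.\<close>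
definition aux_joint ::
  "('x \<times> 'y) pmf \<Rightarrow> ('x \<Rightarrow> 'z pmf) \<Rightarrow> ('y \<Rightarrow> nat pmf) \<Rightarrow> ('x \<Rightarrow> nat \<Rightarrow> nat pmf)
   \<Rightarrow> ('x \<times> 'y \<times> 'z \<times> nat \<times> nat) pmf" where
  "aux_joint pxy pzx pu pw =
     do { (x,y) \<leftarrow> pxy; z \<leftarrow> pzx x; u \<leftarrow> pu y; w \<leftarrow> pw x u; return_pmf (x,y,z,u,w) }"

definition single_letter_region ::
  "('x \<times> 'y) pmf \<Rightarrow> ('x \<Rightarrow> 'z pmf) \<Rightarrow> ('x \<Rightarrow> 'xh \<Rightarrow> real) \<Rightarrow> real \<Rightarrow> (real \<times> real) set" where
  "single_letter_region pxy pzx d D =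
     {(R, R1). \<exists>(pu :: 'y \<Rightarrow> nat pmf) (pw :: 'x \<Rightarrow> nat \<Rightarrow> nat pmf) (xhat :: nat \<Rightarrow> nat \<Rightarrow> 'z \<Rightarrow> 'xh).
        finite (\<Union>y. set_pmf (pu y)) \<and> finite (\<Union>x. \<Union>u. set_pmf (pw x u)) \<and>
        (let J = aux_joint pxy pzx pu pw;
             X = (\<lambda>(x,y,z,u,w). x); Y = (\<lambda>(x,y,z,u,w). y); Z = (\<lambda>(x,y,z,u,w). z);
             U = (\<lambda>(x,y,z,u,w). u); W = (\<lambda>(x,y,z,u,w). w)
         in R1 \<ge> cond_mutual_info J U Y Z \<and>
            R \<ge> cond_mutual_info J X W (\<lambda>v. (U v, Z v)) \<and>
            measure_pmf.expectation J (\<lambda>(x,y,z,u,w). d x (xhat u w z)) \<le> D)}"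

end

theory Submission
  imports Defs
begin

text \<open>
  Converse. For a code with messages \<open>T1\<close>, \<open>T\<close>, let \<open>U_i\<close> consist of \<open>T1\<close>,
  \<open>X_1, ..., X_{i-1}\<close> and all \<open>Z_j\<close> with \<open>j \<noteq> i\<close>, and let \<open>W_i = T\<close>.
  Chain rules bound the two sums of conditional mutual informations by the logarithms of the message
  counts. The variable \<open>W_i\<close> need not be independent of \<open>Y_i\<close> given \<open>(X_i, U_i)\<close>, but only the laws of
  \<open>(Y, Z, U)\<close> and \<open>(X, Z, U, W)\<close> matter, and these have the required form. In terms of posterior
  distributions given the auxiliary variables, the attainable quadruples of \<open>(p_Y, H(Y|Z,U),
  I(X;W|U,Z), distortion)\<close> form a two-level convex hull of compact sets. Hence they form a compact
  convex set: convexity is time sharing, compactness makes the region closed, and no cardinality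
  bounds are needed.

  Achievability. By the Poisson matching lemma, shared exponential clocks allow the helper to pick
  \<open>U^n\<close> with exactly the law \<open>p(u|y)\<close>, while encoder and decoder recover it from the message and
  their own posteriors, up to an error of mean at most the expectation of \<open>t / (1 + t)\<close>, where
  \<open>t\<close> is the likelihood ratio of \<open>p(u^n|y^n)\<close> and the posterior, divided by the number of messages.
  The same is done for \<open>W^n\<close>. Since \<open>t / (1 + t)\<close> is at most any power of \<open>t\<close> with exponent in
  \<open>(0, 1]\<close>, these errors decay exponentially as soon as the rates exceed \<open>I(U;Y|Z)\<close> and \<open>I(X;W|U,Z)\<close>.
\<close>

section \<open>Entropy of finitely supported random variables\<close>

text \<open>Each half has its own obstacle. In the converse, \<open>T\<close> depends on letters
  \<open>X_j\<close> with \<open>j > i\<close>, which \<open>U_i\<close> omits, and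
  \<open>T1\<close> couples the corresponding \<open>Y_j\<close> with \<open>Y_i\<close>; so the
  Markov chain \<open>W_i - (X_i, U_i) - Y_i\<close> fails in general. Rates and distortion are sums
  over \<open>u\<close> of functionals of the vector p(y,u) and of the vectors p(x,u,w), and the
  only constraint between these is that summing p(x,u,w) over \<open>w\<close> gives the
  push-forward of p(y,u) to the \<open>X\<close> side. Any splitting that meets it comes from some
  kernel p(w|x,u) by Bayes' rule, so the region can be described by splittings instead of kernels.

  In the direct part, encoder and decoder recover \<open>U^n\<close> from one helper message with
  different side information, and a typicality proof would need a Markov lemma relating the selected
  \<open>U^n\<close> to sequences the helper does not see. A selection that follows the product
  kernel exactly makes all ideal sequences jointly i.i.d., so distortion and error terms become
  single-letter expectations or \<open>n\<close>-th powers of them; covering and binning happen in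
  one step.\<close>

definition eta :: "real \<Rightarrow> real" where
  "eta t = - t * log 2 t"

definition ent :: "'a pmf \<Rightarrow> real" where
  "ent p = (\<Sum>x\<in>set_pmf p. eta (pmf p x))"

definition entropy_of :: "'o pmf \<Rightarrow> ('o \<Rightarrow> 'a) \<Rightarrow> real" where
  "entropy_of J A = ent (map_pmf A J)"

lemma eta_0 [simp]: "eta 0 = 0"
  by (simp add: eta_def)

lemma eta_mult: "0 \<le> s \<Longrightarrow> 0 \<le> t \<Longrightarrow> eta (s * t) = s * eta t + t * eta s"
  by (cases "s = 0 \<or> t = 0") (auto simp: eta_def log_mult algebra_simps)

lemma log2_le_sub_1: "x > 0 \<Longrightarrow> log 2 x \<le> (x - 1) / ln 2"
  using ln_le_minus_one[of x] by (simp add: log_def divide_right_mono)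

lemma ent_eq_sum:
  assumes "finite S" "set_pmf p \<subseteq> S"
  shows "ent p = (\<Sum>x\<in>S. eta (pmf p x))"
  unfolding ent_def using assms
  by (intro sum.mono_neutral_left) (auto simp: set_pmf_eq)

lemma ent_eq_expectation:
  assumes "finite (set_pmf p)"
  shows "ent p = measure_pmf.expectation p (\<lambda>x. - log 2 (pmf p x))"
  using assms by (subst integral_measure_pmf_real[where A = "set_pmf p"])
    (auto simp: ent_def eta_def algebra_simps intro!: sum.cong)

lemma entropy_of_eq_expectation:
  assumes "finite (set_pmf J)"
  shows "entropy_of J A = measure_pmf.expectation J (\<lambda>s. - log 2 (pmf (map_pmf A J) (A s)))"
  using assms by (simp add: entropy_of_def ent_eq_expectation)

lemma pmf_map_apply_pos: "s \<in> set_pmf J \<Longrightarrow> 0 < pmf (map_pmf A J) (A s)"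
  by (auto simp: pmf_positive_iff)

lemma pmf_map_apply_nonzero: "s \<in> set_pmf J \<Longrightarrow> pmf (map_pmf A J) (A s) \<noteq> 0"
  using pmf_map_apply_pos[of s J A] by simp

lemma expectation_pmf_mono_finite:
  fixes f g :: "'a \<Rightarrow> real"
  assumes "finite (set_pmf p)" "\<And>x. x \<in> set_pmf p \<Longrightarrow> f x \<le> g x"
  shows "measure_pmf.expectation p f \<le> measure_pmf.expectation p g"
  using assms by (intro integral_mono_AE integrable_measure_pmf_finite) (auto simp: AE_measure_pmf_iff)

lemma expectation_pmf_cong:
  fixes f g :: "'a \<Rightarrow> real"
  assumes "\<And>x. x \<in> set_pmf p \<Longrightarrow> f x = g x"
  shows "measure_pmf.expectation p f = measure_pmf.expectation p g"
  using assms by (intro integral_cong_AE) (auto simp: AE_measure_pmf_iff)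

lemma expectation_pmf_combination:
  fixes f g h k :: "'a \<Rightarrow> real"
  assumes "finite (set_pmf p)"
  shows "measure_pmf.expectation p (\<lambda>x. f x + g x - h x - k x) = measure_pmf.expectation p f
    + measure_pmf.expectation p g - measure_pmf.expectation p h - measure_pmf.expectation p k"
  using assms by (simp add: integrable_measure_pmf_finite)

text \<open>The information density form: achievability compares its log ratios with those of the
  matching errors pointwise.\<close>

lemma cond_mutual_info_expectation:
  assumes fin: "finite (set_pmf J)"
  shows "cond_mutual_info J A B C = measure_pmf.expectation J
      (\<lambda>s. log 2 (pmf (map_pmf (\<lambda>w. (A w, B w, C w)) J) (A s, B s, C s) * pmf (map_pmf C J) (C s) /
        (pmf (map_pmf (\<lambda>w. (A w, C w)) J) (A s, C s) * pmf (map_pmf (\<lambda>w. (B w, C w)) J) (B s, C s))))"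
proof -
  let ?abc = "map_pmf (\<lambda>w. (A w, B w, C w)) J" and ?ac = "map_pmf (\<lambda>w. (A w, C w)) J"
    and ?bc = "map_pmf (\<lambda>w. (B w, C w)) J" and ?c = "map_pmf C J"
  have "cond_mutual_info J A B C = measure_pmf.expectation ?abc
      (\<lambda>(a,b,c). log 2 (pmf ?abc (a,b,c) * pmf ?c c / (pmf ?ac (a,c) * pmf ?bc (b,c))))"
    using fin unfolding cond_mutual_info_def Let_def
    by (subst integral_measure_pmf_real[where A = "set_pmf ?abc"])
       (auto intro!: sum.cong)
  then show ?thesis by simp
qed

lemma cond_mutual_info_map:
  "cond_mutual_info (map_pmf h K) A1 A2 A3 = cond_mutual_info K (\<lambda>s. A1 (h s)) (\<lambda>s. A2 (h s)) (\<lambda>s. A3 (h s))"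
  by (simp add: cond_mutual_info_def pmf.map_comp o_def)

lemma cond_mutual_info_entropy:
  assumes fin: "finite (set_pmf J)"
  shows "cond_mutual_info J A B C =
     entropy_of J (\<lambda>s. (A s, C s)) + entropy_of J (\<lambda>s. (B s, C s))
       - entropy_of J (\<lambda>s. (A s, B s, C s)) - entropy_of J C"
proof -
  let ?abc = "map_pmf (\<lambda>w. (A w, B w, C w)) J" and ?ac = "map_pmf (\<lambda>w. (A w, C w)) J"
    and ?bc = "map_pmf (\<lambda>w. (B w, C w)) J" and ?c = "map_pmf C J"
  have "cond_mutual_info J A B C = measure_pmf.expectation J
      (\<lambda>s. log 2 (pmf ?abc (A s, B s, C s) * pmf ?c (C s) / (pmf ?ac (A s, C s) * pmf ?bc (B s, C s))))"
    by (rule cond_mutual_info_expectation[OF fin])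
  also have "\<dots> = measure_pmf.expectation J
      (\<lambda>s. (- log 2 (pmf ?ac (A s, C s))) + (- log 2 (pmf ?bc (B s, C s)))
         - (- log 2 (pmf ?abc (A s, B s, C s))) - (- log 2 (pmf ?c (C s))))"
  proof (rule expectation_pmf_cong)
    fix s assume s: "s \<in> set_pmf J"
    note pos = pmf_map_apply_pos[OF s, of "\<lambda>w. (A w, B w, C w)"] pmf_map_apply_pos[OF s, of "\<lambda>w. (A w, C w)"]
      pmf_map_apply_pos[OF s, of "\<lambda>w. (B w, C w)"] pmf_map_apply_pos[OF s, of C]
    show "log 2 (pmf ?abc (A s, B s, C s) * pmf ?c (C s) / (pmf ?ac (A s, C s) * pmf ?bc (B s, C s))) =
       (- log 2 (pmf ?ac (A s, C s))) + (- log 2 (pmf ?bc (B s, C s)))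
         - (- log 2 (pmf ?abc (A s, B s, C s))) - (- log 2 (pmf ?c (C s)))"
      using pos by (simp add: log_mult log_divide)
  qed
  also have "\<dots> = entropy_of J (\<lambda>s. (A s, C s)) + entropy_of J (\<lambda>s. (B s, C s))
       - entropy_of J (\<lambda>s. (A s, B s, C s)) - entropy_of J C"
    unfolding entropy_of_eq_expectation[OF fin] by (rule expectation_pmf_combination[OF fin])
  finally show ?thesis .
qed

text \<open>Almost surely the fibre of \<open>A\<close> through \<open>s\<close> is contained in the
  fibre of \<open>B\<close>, so its probability is smaller at every \<open>s\<close>.\<close>

lemma entropy_of_mono:
  assumes fin: "finite (set_pmf J)"
    and det: "\<And>s t. s \<in> set_pmf J \<Longrightarrow> t \<in> set_pmf J \<Longrightarrow> A s = A t \<Longrightarrow> B s = B t"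
  shows "entropy_of J B \<le> entropy_of J A"
proof -
  have "- log 2 (pmf (map_pmf B J) (B s)) \<le> - log 2 (pmf (map_pmf A J) (A s))"
    if s: "s \<in> set_pmf J" for s
  proof -
    have "pmf (map_pmf A J) (A s) \<le> pmf (map_pmf B J) (B s)"
      unfolding pmf_map
    proof (rule measure_pmf.finite_measure_mono_AE)
      show "AE t in J. t \<in> A -` {A s} \<longrightarrow> t \<in> B -` {B s}"
        unfolding AE_measure_pmf_iff using det[OF _ s] by blast
    qed simp
    then show ?thesis
      using pmf_map_apply_pos[OF s, of A] by simp
  qed
  then show ?thesis
    using fin by (simp add: entropy_of_eq_expectation expectation_pmf_mono_finite)
qed

text \<open>Entropy sees only the partition that \<open>A\<close> induces on the support. This does
  all reordering and regrouping of tuples below, and also replaces a variable by an equivalent one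
  such as a longer prefix.\<close>

lemma entropy_of_cong:
  assumes "finite (set_pmf J)"
    and "\<And>s t. s \<in> set_pmf J \<Longrightarrow> t \<in> set_pmf J \<Longrightarrow> A s = A t \<longleftrightarrow> B s = B t"
  shows "entropy_of J A = entropy_of J B"
  using assms by (intro antisym entropy_of_mono) auto

text \<open>Jensen's inequality for the logarithm. The bound by the log cardinality, submodularity,
  and the comparison of the posteriors given \<open>X\<close> and given \<open>Z\<close> are this
  lemma with different ratios \<open>r\<close>.\<close>

lemma gibbs_expectation:
  fixes r :: "'o \<Rightarrow> real"
  assumes "finite (set_pmf J)" "\<And>s. s \<in> set_pmf J \<Longrightarrow> 0 < r s"
    and "measure_pmf.expectation J r \<le> 1"
  shows "measure_pmf.expectation J (\<lambda>s. log 2 (r s)) \<le> 0"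
proof -
  have "measure_pmf.expectation J (\<lambda>s. log 2 (r s)) \<le> measure_pmf.expectation J (\<lambda>s. (r s - 1) / ln 2)"
    using assms by (intro expectation_pmf_mono_finite log2_le_sub_1) auto
  also have "\<dots> = (measure_pmf.expectation J r - 1) / ln 2"
    using assms(1) by (simp add: integrable_measure_pmf_finite)
  also have "\<dots> \<le> 0"
    using assms(3) by (simp add: divide_nonpos_pos)
  finally show ?thesis .
qed

lemma entropy_of_le_log_card:
  assumes fin: "finite (set_pmf J)" and "A ` set_pmf J \<subseteq> S" "finite S"
  shows "entropy_of J A \<le> log 2 (card S)"
proof -
  let ?p = "map_pmf A J"
  have S: "card S > 0"
    using assms set_pmf_not_empty[of J] by (auto simp: card_gt_0_iff)
  have "measure_pmf.expectation J (\<lambda>s. 1 / (real (card S) * pmf ?p (A s))) =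
        measure_pmf.expectation ?p (\<lambda>a. 1 / (real (card S) * pmf ?p a))"
    by simp
  also have "\<dots> = (\<Sum>a\<in>A ` set_pmf J. 1 / real (card S))"
    using fin by (subst integral_measure_pmf_real[where A = "A ` set_pmf J"])
      (auto intro!: sum.cong simp: pmf_map_apply_nonzero simp del: integral_map_pmf sum_constant)
  also have "\<dots> \<le> 1"
    using S card_mono[OF assms(3,2)] by (simp add: divide_le_eq_1)
  finally have "measure_pmf.expectation J (\<lambda>s. log 2 (1 / (real (card S) * pmf ?p (A s)))) \<le> 0"
    using S by (intro gibbs_expectation fin) (auto simp: pmf_map_apply_pos)
  also have "measure_pmf.expectation J (\<lambda>s. log 2 (1 / (real (card S) * pmf ?p (A s)))) =
     measure_pmf.expectation J (\<lambda>s. - log 2 (pmf ?p (A s)) - log 2 (card S))"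
    using S
    by (intro expectation_pmf_cong) (simp add: log_divide log_mult pmf_map_apply_nonzero)
  also have "\<dots> = entropy_of J A - log 2 (card S)"
    unfolding entropy_of_eq_expectation[OF fin] by (simp add: integrable_measure_pmf_finite[OF fin])
  finally show ?thesis by simp
qed

lemma sum_pmf_map_fst:
  assumes "finite (set_pmf J)" "finite S" "A ` set_pmf J \<subseteq> S"
  shows "(\<Sum>a\<in>S. pmf (map_pmf (\<lambda>s. (A s, C s)) J) (a, c)) = pmf (map_pmf C J) c"
proof -
  have "(\<Sum>a\<in>S. pmf (map_pmf (\<lambda>s. (A s, C s)) J) (a, c)) =
        (\<Sum>a\<in>S. measure J ((\<lambda>s. (A s, C s)) -` {(a, c)}))"
    by (simp add: pmf_map)
  also have "\<dots> = measure J (\<Union>a\<in>S. (\<lambda>s. (A s, C s)) -` {(a, c)})"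
    by (rule measure_pmf.finite_measure_finite_Union[symmetric])
      (use assms(2) in \<open>simp_all add: disjoint_family_on_def disjnt_def set_eq_iff\<close>)
  also have "\<dots> = measure J (C -` {c})"
    using assms(3) by (intro measure_pmf.finite_measure_eq_AE) (auto simp: AE_measure_pmf_iff)
  finally show ?thesis by (simp add: pmf_map)
qed

text \<open>Nonnegativity of conditional mutual information: Gibbs with the ratio of p(a,c) p(b,c) /
  p(c) to p(a,b,c).\<close>

theorem entropy_of_submodular:
  assumes fin: "finite (set_pmf J)"
  shows "entropy_of J (\<lambda>s. (A s, B s, C s)) + entropy_of J C
    \<le> entropy_of J (\<lambda>s. (A s, C s)) + entropy_of J (\<lambda>s. (B s, C s))"
proof -
  let ?abc = "map_pmf (\<lambda>w. (A w, B w, C w)) J" and ?ac = "map_pmf (\<lambda>w. (A w, C w)) J"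
    and ?bc = "map_pmf (\<lambda>w. (B w, C w)) J" and ?c = "map_pmf C J"
  let ?S = "set_pmf J"
  let ?r = "\<lambda>(a,b,c). pmf ?ac (a,c) * pmf ?bc (b,c) / (pmf ?abc (a,b,c) * pmf ?c c)"
  have pos: "0 < pmf ?abc (A s, B s, C s)" "0 < pmf ?ac (A s, C s)" "0 < pmf ?bc (B s, C s)" "0 < pmf ?c (C s)"
    if "s \<in> ?S" for s
    using that pmf_map_apply_pos[of s J "\<lambda>w. (A w, B w, C w)"] pmf_map_apply_pos[of s J "\<lambda>w. (A w, C w)"]
      pmf_map_apply_pos[of s J "\<lambda>w. (B w, C w)"] pmf_map_apply_pos[of s J C] by auto
  note nz = pos[THEN less_imp_neq, THEN not_sym]
  have "measure_pmf.expectation J (\<lambda>s. ?r (A s, B s, C s)) = measure_pmf.expectation ?abc ?r"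
    by simp
  also have "\<dots> = (\<Sum>t\<in>set_pmf ?abc. ?r t * pmf ?abc t)"
    using fin by (subst integral_measure_pmf_real[where A = "set_pmf ?abc"]) auto
  also have "\<dots> = (\<Sum>(a,b,c)\<in>set_pmf ?abc. pmf ?ac (a,c) * pmf ?bc (b,c) / pmf ?c c)"
    by (intro sum.cong) (auto simp: nz)
  \<comment> \<open>Terms outside the support of the triple are nonnegative; on the full product set
    the sums over \<open>a\<close> and \<open>b\<close> factor for each fixed \<open>c\<close> and
    give p(c).\<close>
  also have "\<dots> \<le> (\<Sum>(a,b,c)\<in>A ` ?S \<times> B ` ?S \<times> C ` ?S. pmf ?ac (a,c) * pmf ?bc (b,c) / pmf ?c c)"
    using fin by (intro sum_mono2) auto
  also have "\<dots> = (\<Sum>a\<in>A ` ?S. \<Sum>b\<in>B ` ?S. \<Sum>c\<in>C ` ?S. pmf ?ac (a,c) * pmf ?bc (b,c) / pmf ?c c)"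
    by (simp add: sum.cartesian_product)
  also have "\<dots> = (\<Sum>c\<in>C ` ?S. (\<Sum>a\<in>A ` ?S. pmf ?ac (a,c)) * (\<Sum>b\<in>B ` ?S. pmf ?bc (b,c)) / pmf ?c c)"
  proof -
    let ?f = "\<lambda>a b c. pmf ?ac (a,c) * pmf ?bc (b,c) / pmf ?c c"
    have "(\<Sum>a\<in>A ` ?S. \<Sum>b\<in>B ` ?S. \<Sum>c\<in>C ` ?S. ?f a b c) = (\<Sum>a\<in>A ` ?S. \<Sum>c\<in>C ` ?S. \<Sum>b\<in>B ` ?S. ?f a b c)"
      by (intro sum.cong refl sum.swap)
    also have "\<dots> = (\<Sum>c\<in>C ` ?S. \<Sum>a\<in>A ` ?S. \<Sum>b\<in>B ` ?S. ?f a b c)"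
      by (rule sum.swap)
    finally show ?thesis
      by (simp add: sum_product sum_divide_distrib)
  qed
  also have "\<dots> = (\<Sum>c\<in>C ` ?S. pmf ?c c)"
    using fin by (intro sum.cong) (auto simp: sum_pmf_map_fst nz)
  also have "\<dots> = 1"
    using fin by (intro sum_pmf_eq_1) auto
  finally have le: "measure_pmf.expectation J (\<lambda>s. ?r (A s, B s, C s)) \<le> 1" .
  have "measure_pmf.expectation J (\<lambda>s. log 2 (?r (A s, B s, C s))) \<le> 0"
    by (rule gibbs_expectation[OF fin _ le]) (use pos in simp)
  also have "measure_pmf.expectation J (\<lambda>s. log 2 (?r (A s, B s, C s))) = measure_pmf.expectation J
      (\<lambda>s. (- log 2 (pmf ?abc (A s, B s, C s))) + (- log 2 (pmf ?c (C s)))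
         - (- log 2 (pmf ?ac (A s, C s))) - (- log 2 (pmf ?bc (B s, C s))))"
  proof (rule expectation_pmf_cong)
    fix s assume s: "s \<in> set_pmf J"
    show "log 2 (?r (A s, B s, C s)) = (- log 2 (pmf ?abc (A s, B s, C s))) + (- log 2 (pmf ?c (C s)))
         - (- log 2 (pmf ?ac (A s, C s))) - (- log 2 (pmf ?bc (B s, C s)))"
      using pos[OF s] by (simp add: log_mult log_divide)
  qed
  also have "\<dots> = entropy_of J (\<lambda>s. (A s, B s, C s)) + entropy_of J C
       - entropy_of J (\<lambda>s. (A s, C s)) - entropy_of J (\<lambda>s. (B s, C s))"
    unfolding entropy_of_eq_expectation[OF fin] by (rule expectation_pmf_combination[OF fin])
  finally show ?thesis by simp
qed

corollary cond_mutual_info_nonneg: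
  "finite (set_pmf J) \<Longrightarrow> 0 \<le> cond_mutual_info J A B C"
  using entropy_of_submodular[of J A B C] by (simp add: cond_mutual_info_entropy)

section \<open>The rate region as a convex hull\<close>

lemma continuous_on_eta: "continuous_on {0..} eta"
proof -
  have "continuous (at t within {0..}) eta" if "t \<ge> 0" for t :: real
  proof (cases "t = 0")
    case True
    \<comment> \<open>Continuity at 0 is the limit of \<open>ln x / x\<close> at infinity under
      \<open>x = 1 / t\<close>.\<close>
    have "((\<lambda>t::real. ln (inverse t) / inverse t) \<longlongrightarrow> 0) (at_right 0)"
      by (rule filterlim_compose[OF ln_x_over_x_tendsto_0 filterlim_inverse_at_top_right])
    then have "((\<lambda>t::real. ln (inverse t) / inverse t / ln 2) \<longlongrightarrow> 0 / ln 2) (at_right 0)"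
      by (intro tendsto_intros) auto
    moreover have "eventually (\<lambda>t. ln (inverse t) / inverse t / ln 2 = eta t) (at_right (0::real))"
      by (intro eventually_at_rightI[of 0 1])
         (auto simp: eta_def log_def ln_inverse divide_inverse)
    ultimately have "(eta \<longlongrightarrow> 0) (at_right 0)"
      by (subst (asm) tendsto_cong) auto
    moreover have "at 0 within {0..} = at_right (0::real)"
      unfolding at_within_def by (rule arg_cong[where f = "\<lambda>S. inf (nhds 0) (principal S)"]) auto
    ultimately show ?thesis
      using True by (simp add: continuous_within)
  next
    case False
    with that have "isCont eta t"
      unfolding eta_def[abs_def] by (intro continuous_intros) auto
    then show ?thesis
      by (rule continuous_at_imp_continuous_within)
  qed
  then show ?thesis
    by (simp add: continuous_on_eq_continuous_within)
qed

lemma continuous_on_eta_comp: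
  assumes "continuous_on S f" "\<And>x. x \<in> S \<Longrightarrow> 0 \<le> f x"
  shows "continuous_on S (\<lambda>x. eta (f x))"
  using assms by (intro continuous_on_compose2[OF continuous_on_eta]) auto

text \<open>If \<open>v\<close> is the distribution of \<open>A\<close> and \<open>k\<close> the channel from \<open>A\<close> to \<open>Z\<close>, this is the
  conditional entropy of \<open>A\<close> given \<open>Z\<close>; it is positively homogeneous in \<open>v\<close>.\<close>
definition equivocation :: "('a::finite \<Rightarrow> 'z::finite \<Rightarrow> real) \<Rightarrow> real ^ 'a \<Rightarrow> real" where
  "equivocation k v = (\<Sum>a\<in>UNIV. \<Sum>z\<in>UNIV. eta (v $ a * k a z)) - (\<Sum>z\<in>UNIV. eta (\<Sum>a\<in>UNIV. v $ a * k a z))"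

text \<open>By \<open>eta_mult\<close> each of the two entropy sums acquires an extra term,
  \<open>eta c\<close> times the total of \<open>v $ a * k a z\<close>; the two cancel. Homogeneity
  allows work with unnormalised posteriors, where letters of probability zero need no
  division.\<close>

lemma equivocation_scale:
  assumes "0 \<le> c" "\<And>a. 0 \<le> v $ a" "\<And>a z. 0 \<le> k a z"
  shows "equivocation k (c *\<^sub>R v) = c * equivocation k v"
proof -
  have 1: "eta (c * v $ a * k a z) = c * eta (v $ a * k a z) + (v $ a * k a z) * eta c" for a z
    using eta_mult[of c "v $ a * k a z"] assms by (simp add: mult.assoc)
  have 2: "eta (\<Sum>a\<in>UNIV. c * v $ a * k a z) = c * eta (\<Sum>a\<in>UNIV. v $ a * k a z) + (\<Sum>a\<in>UNIV. v $ a * k a z) * eta c" for z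
  proof -
    have "(\<Sum>a\<in>UNIV. c * v $ a * k a z) = c * (\<Sum>a\<in>UNIV. v $ a * k a z)"
      by (simp add: sum_distrib_left mult.assoc)
    then show ?thesis
      using eta_mult[of c "\<Sum>a\<in>UNIV. v $ a * k a z"] assms by (simp add: sum_nonneg)
  qed
  have "(\<Sum>z\<in>UNIV. \<Sum>a\<in>UNIV. v $ a * k a z) = (\<Sum>a\<in>UNIV. \<Sum>z\<in>UNIV. v $ a * k a z)"
    by (rule sum.swap)
  then show ?thesis
    unfolding equivocation_def
    by (simp add: 1 2 sum.distrib right_diff_distrib flip: sum_distrib_left sum_distrib_right)
qed

lemma equivocation_zero [simp]: "equivocation k 0 = 0"
  by (simp add: equivocation_def)

lemma continuous_on_equivocation:
  assumes "\<And>a z. 0 \<le> k a z" "continuous_on S f" "\<And>x a. x \<in> S \<Longrightarrow> 0 \<le> f x $ a"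
  shows "continuous_on S (\<lambda>x. equivocation k (f x))"
  unfolding equivocation_def using assms
  by (intro continuous_intros continuous_on_eta_comp) (auto intro!: sum_nonneg)

definition prob_simplex :: "(real ^ 'a::finite) set" where
  "prob_simplex = {v. (\<forall>a. 0 \<le> v $ a) \<and> (\<Sum>a\<in>UNIV. v $ a) = 1}"

lemma compact_prob_simplex: "compact (prob_simplex :: (real ^ 'a::finite) set)"
proof -
  have "closed {v :: real ^ 'a. \<forall>a. 0 \<le> v $ a}" "closed {v :: real ^ 'a. (\<Sum>a\<in>UNIV. v $ a) = 1}"
    by (intro closed_Collect_all closed_Collect_le closed_Collect_eq continuous_intros)+
  then have "closed (prob_simplex :: (real ^ 'a) set)"
    unfolding prob_simplex_def by (rule closed_Collect_conj)
  moreover have "bounded (prob_simplex :: (real ^ 'a) set)"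
  proof (rule boundedI)
    fix v :: "real ^ 'a" assume v: "v \<in> prob_simplex"
    have "norm v \<le> (\<Sum>a\<in>UNIV. \<bar>v $ a\<bar>)"
      by (rule norm_le_l1_cart)
    also have "\<dots> = 1"
      using v by (simp add: prob_simplex_def)
    finally show "norm v \<le> 1" .
  qed
  ultimately show ?thesis
    by (simp add: compact_eq_bounded_closed)
qed

text \<open>Membership is asked only where the weight is positive: the normalised posterior of a
  letter of probability zero is the zero vector, which lies outside the simplex.\<close>

lemma convex_sum_support:
  fixes C :: "'v::real_vector set"
  assumes "finite S" "convex C" "(\<Sum>i\<in>S. t i) = 1" "\<And>i. i \<in> S \<Longrightarrow> 0 \<le> t i"
    and "\<And>i. i \<in> S \<Longrightarrow> 0 < t i \<Longrightarrow> y i \<in> C"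
  shows "(\<Sum>i\<in>S. t i *\<^sub>R y i) \<in> C"
proof -
  let ?S = "{i\<in>S. 0 < t i}"
  have *: "t i = 0" if "i \<in> S - ?S" for i
    using that assms(4)[of i] by auto
  have "(\<Sum>i\<in>S. t i *\<^sub>R y i) = (\<Sum>i\<in>?S. t i *\<^sub>R y i)" "(\<Sum>i\<in>S. t i) = (\<Sum>i\<in>?S. t i)"
    by (rule sum.mono_neutral_right; use assms(1) * in simp)+
  moreover have "(\<Sum>i\<in>?S. t i *\<^sub>R y i) \<in> C" if "(\<Sum>i\<in>?S. t i) = 1"
    using that by (intro convex_sum) (use assms in auto)
  ultimately show ?thesis
    using assms(3) by simp
qed

text \<open>The natural number indices later become the letters of \<open>U\<close> and
  \<open>W\<close>, whose alphabets are subsets of \<open>nat\<close>.\<close>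

lemma convex_hull_nat_indexed:
  fixes p :: "'v::real_vector set"
  assumes "y \<in> convex hull p"
  obtains k :: nat and t x where "\<And>i. i < k \<Longrightarrow> 0 \<le> t i" "\<And>i. i < k \<Longrightarrow> x i \<in> p"
    "(\<Sum>i<k. t i) = 1" "(\<Sum>i<k. t i *\<^sub>R x i) = y"
proof -
  from assms obtain S u where S: "finite S" "S \<subseteq> p" "\<And>x. x \<in> S \<Longrightarrow> 0 \<le> u x" "sum u S = 1"
      "(\<Sum>v\<in>S. u v *\<^sub>R v) = y"
    unfolding convex_hull_explicit by auto
  obtain e where e: "bij_betw e {..<card S} S"
    using ex_bij_betw_nat_finite[OF S(1)] by (auto simp: atLeast0LessThan)
  have "(\<Sum>i<card S. u (e i)) = 1" "(\<Sum>i<card S. u (e i) *\<^sub>R e i) = y"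
    using sum.reindex_bij_betw[OF e, of u] sum.reindex_bij_betw[OF e, of "\<lambda>v. u v *\<^sub>R v"] S by auto
  then show thesis
    using S bij_betwE[OF e] by (intro that[of "card S" "\<lambda>i. u (e i)" e]) auto
qed

section \<open>The two-level convex hull and its closedness\<close>

locale helper_source =
  fixes pxy :: "('x::finite \<times> 'y::finite) pmf"
    and pzx :: "'x \<Rightarrow> 'z::finite pmf"
    and d :: "'x \<Rightarrow> 'xh::finite \<Rightarrow> real"
  assumes d_nonneg: "\<And>x xh. 0 \<le> d x xh"
begin

definition pY :: "'y \<Rightarrow> real" where
  "pY y = pmf (map_pmf snd pxy) y"

definition PY :: "real ^ 'y" where
  "PY = (\<chi> y. pY y)"

text \<open>The reverse channel from \<open>Y\<close> to \<open>X\<close>, with value \<open>0\<close> where \<open>pY y = 0\<close>.\<close>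
definition kxy :: "'x \<Rightarrow> 'y \<Rightarrow> real" where
  "kxy x y = pmf pxy (x, y) / pY y"

definition pz :: "'x \<Rightarrow> 'z \<Rightarrow> real" where
  "pz x z = pmf (pzx x) z"

definition kyz :: "'y \<Rightarrow> 'z \<Rightarrow> real" where
  "kyz y z = (\<Sum>x\<in>UNIV. kxy x y * pz x z)"

definition pushX :: "real ^ 'y \<Rightarrow> real ^ 'x" where
  "pushX q = (\<chi> x. \<Sum>y\<in>UNIV. q $ y * kxy x y)"

definition dist_of :: "real ^ 'x \<Rightarrow> ('z \<Rightarrow> 'xh) \<Rightarrow> real" where
  "dist_of r \<phi> = (\<Sum>x\<in>UNIV. \<Sum>z\<in>UNIV. r $ x * pz x z * d x (\<phi> z))"

text \<open>What one pair \<open>(u, w)\<close> contributes: the posterior \<open>r\<close> of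
  \<open>X\<close>, the entropy of \<open>X\<close> given \<open>Z\<close> under it, and the
  distortion when the decoder applies \<open>\<phi>\<close> to \<open>z\<close>.\<close>

definition inner_points :: "((real ^ 'x) \<times> real \<times> real) set" where
  "inner_points = (\<Union>\<phi>. (\<lambda>r. (r, equivocation pz r, dist_of r \<phi>)) ` prob_simplex)"

text \<open>What one letter \<open>u\<close> contributes: \<open>q\<close> is the posterior of
  \<open>Y\<close>, and \<open>a\<close>, \<open>b\<close> are averages over \<open>w\<close>. The
  inner posteriors must average to \<open>pushX q\<close>, so the third coordinate is the
  information between \<open>X\<close> and \<open>W\<close> given \<open>Z\<close> at this
  \<open>u\<close>.\<close>

definition outer_points :: "((real ^ 'y) \<times> real \<times> real \<times> real) set" where
  "outer_points = {(q, equivocation kyz q, equivocation pz (pushX q) - a, b) | q a b.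
     q \<in> prob_simplex \<and> (pushX q, a, b) \<in> convex hull inner_points}"

text \<open>The coordinate \<open>PY\<close> forces the posteriors of \<open>Y\<close> to average to
  the source law. The distortion is kept as a coordinate so that closedness also covers limits in
  \<open>D\<close>.\<close>

definition rate_region :: "(real \<times> real \<times> real) set" where
  "rate_region = {(R, R1, D). \<exists>h i b. (PY, h, i, b) \<in> convex hull outer_points \<and>
     equivocation kyz PY - h \<le> R1 \<and> i \<le> R \<and> b \<le> D}"

lemma pY_nonneg [simp]: "0 \<le> pY y"
  and kxy_nonneg [simp]: "0 \<le> kxy x y"
  and pz_nonneg [simp]: "0 \<le> pz x z"
  and kyz_nonneg [simp]: "0 \<le> kyz y z"
  by (auto simp: pY_def kxy_def pz_def kyz_def intro!: sum_nonneg)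

text \<open>There are finitely many maps \<open>\<phi>\<close> between finite types, so
  \<open>inner_points\<close> is a finite union of continuous images of the simplex.\<close>

lemma compact_inner_hull: "compact (convex hull inner_points)"
proof -
  have "compact ((\<lambda>r. (r, equivocation pz r, dist_of r \<phi>)) ` prob_simplex)" for \<phi>
    unfolding dist_of_def
    by (intro compact_continuous_image continuous_intros continuous_on_equivocation compact_prob_simplex)
       (auto simp: prob_simplex_def)
  then show ?thesis
    unfolding inner_points_def by (intro compact_convex_hull compact_UN) auto
qed

lemma inner_hull_nonneg: "(r, a, b) \<in> convex hull inner_points \<Longrightarrow> 0 \<le> r $ x"
proof -
  assume "(r, a, b) \<in> convex hull inner_points"
  moreover have "convex {(r :: real ^ 'x, a :: real, b :: real). 0 \<le> r $ x}"
    by (auto simp: convex_def)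
  then have "convex hull inner_points \<subseteq> {(r, a, b). 0 \<le> r $ x}"
    by (intro hull_minimal) (auto simp: inner_points_def prob_simplex_def)
  ultimately show ?thesis by auto
qed

text \<open>The pairs of a posterior \<open>q\<close> and an inner hull point over
  \<open>pushX q\<close> form a compact set, being cut out by a closed linear condition;
  \<open>outer_points\<close> is its continuous image. Compactness of the inner hull is therefore
  used before the second hull is taken.\<close>

lemma compact_outer_hull: "compact (convex hull outer_points)"
proof -
  let ?S = "(prob_simplex \<times> (convex hull inner_points)) \<inter> {(q, r, a, b). r = pushX q}"
  have "closed {w :: (real ^ 'y) \<times> (real ^ 'x) \<times> real \<times> real. fst (snd w) = pushX (fst w)}"
    unfolding pushX_def by (intro closed_Collect_eq continuous_intros)
  also have "{w :: (real ^ 'y) \<times> (real ^ 'x) \<times> real \<times> real. fst (snd w) = pushX (fst w)} = {(q, r, a, b). r = pushX q}"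
    by auto
  finally have "compact ?S"
    by (intro compact_Int_closed compact_Times compact_prob_simplex compact_inner_hull)
  moreover have "continuous_on ?S (\<lambda>w. (fst w, equivocation kyz (fst w),
      equivocation pz (fst (snd w)) - fst (snd (snd w)), snd (snd (snd w))))"
    by (intro continuous_intros continuous_on_equivocation) (auto simp: prob_simplex_def inner_hull_nonneg)
  ultimately have "compact ((\<lambda>w. (fst w, equivocation kyz (fst w),
      equivocation pz (fst (snd w)) - fst (snd (snd w)), snd (snd (snd w)))) ` ?S)"
    by (intro compact_continuous_image)
  also have "(\<lambda>w. (fst w, equivocation kyz (fst w),
      equivocation pz (fst (snd w)) - fst (snd (snd w)), snd (snd (snd w)))) ` ?S = outer_points"
  proof (intro set_eqI iffI)
    fix c assume "c \<in> outer_points"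
    then obtain q a b where "c = (q, equivocation kyz q, equivocation pz (pushX q) - a, b)" "(q, pushX q, a, b) \<in> ?S"
      unfolding outer_points_def by blast
    then show "c \<in> (\<lambda>w. (fst w, equivocation kyz (fst w),
      equivocation pz (fst (snd w)) - fst (snd (snd w)), snd (snd (snd w)))) ` ?S"
      by (intro image_eqI[of _ _ "(q, pushX q, a, b)"]) simp_all
  qed (auto simp: outer_points_def)
  finally show ?thesis
    by (rule compact_convex_hull)
qed

text \<open>The region is the sum of a compact set, the image of the slice over \<open>PY\<close>,
  and the closed nonnegative orthant.\<close>

lemma closed_rate_region: "closed rate_region"
proof -
  let ?S = "convex hull outer_points \<inter> {c. fst c = PY}"
  let ?f = "\<lambda>c :: (real ^ 'y) \<times> real \<times> real \<times> real.
     (fst (snd (snd c)), equivocation kyz PY - fst (snd c), snd (snd (snd c)))"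
  let ?T = "{w :: real \<times> real \<times> real. 0 \<le> fst w \<and> 0 \<le> fst (snd w) \<and> 0 \<le> snd (snd w)}"
  have "compact ?S"
    by (intro compact_Int_closed compact_outer_hull closed_Collect_eq continuous_intros)
  then have "compact (?f ` ?S)"
    by (intro compact_continuous_image continuous_intros)
  moreover have "closed ?T"
    by (intro closed_Collect_conj closed_Collect_le continuous_intros)
  ultimately have "closed (\<Union>x\<in>?f ` ?S. \<Union>y\<in>?T. {x + y})"
    by (rule compact_closed_sums)
  also have "(\<Union>x\<in>?f ` ?S. \<Union>y\<in>?T. {x + y}) = rate_region"
  proof (intro set_eqI iffI)
    fix w assume "w \<in> (\<Union>x\<in>?f ` ?S. \<Union>y\<in>?T. {x + y})"
    then show "w \<in> rate_region"
      by (fastforce simp: rate_region_def)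
  next
    fix w assume "w \<in> rate_region"
    then obtain R R1 D h i b where w: "w = (R, R1, D)" "(PY, h, i, b) \<in> convex hull outer_points"
        "equivocation kyz PY - h \<le> R1" "i \<le> R" "b \<le> D"
      by (auto simp: rate_region_def)
    have "w = ?f (PY, h, i, b) + (R - i, R1 - (equivocation kyz PY - h), D - b)"
      using w by simp
    moreover have "(R - i, R1 - (equivocation kyz PY - h), D - b) \<in> ?T" "(PY, h, i, b) \<in> ?S"
      using w by auto
    ultimately show "w \<in> (\<Union>x\<in>?f ` ?S. \<Union>y\<in>?T. {x + y})"
      by blast
  qed
  finally show ?thesis .
qed

end

section \<open>Single-letter realisation\<close>

text \<open>The hypothesis on \<open>v\<close> expresses the Markov chain \<open>Z - A - C\<close>:
  the channel \<open>k\<close> does not depend on \<open>c\<close>, and \<open>v c\<close> is the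
  unnormalised posterior of \<open>A\<close>. Both entropies then split over
  \<open>c\<close>.\<close>

lemma entropy_equivocation:
  fixes A :: "'o \<Rightarrow> 'a::finite" and Z :: "'o \<Rightarrow> 'z::finite" and C :: "'o \<Rightarrow> 'c"
  assumes fin: "finite (set_pmf J)" "finite S" and C: "C ` set_pmf J \<subseteq> S"
    and v: "\<And>a z c. c \<in> S \<Longrightarrow> pmf (map_pmf (\<lambda>s. (A s, Z s, C s)) J) (a, z, c) = v c $ a * k a z"
  shows "entropy_of J (\<lambda>s. (A s, Z s, C s)) - entropy_of J (\<lambda>s. (Z s, C s)) = (\<Sum>c\<in>S. equivocation k (v c))"
proof -
  have "entropy_of J (\<lambda>s. (A s, Z s, C s)) = (\<Sum>(a,z,c)\<in>UNIV \<times> UNIV \<times> S. eta (v c $ a * k a z))"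
    unfolding entropy_of_def
    by (subst ent_eq_sum[where S = "UNIV \<times> UNIV \<times> S"]) (use fin C v in \<open>auto intro!: sum.cong\<close>)
  also have "\<dots> = (\<Sum>a\<in>UNIV. \<Sum>z\<in>UNIV. \<Sum>c\<in>S. eta (v c $ a * k a z))"
    by (simp add: sum.cartesian_product)
  also have "\<dots> = (\<Sum>a\<in>UNIV. \<Sum>c\<in>S. \<Sum>z\<in>UNIV. eta (v c $ a * k a z))"
    by (intro sum.cong refl sum.swap)
  also have "\<dots> = (\<Sum>c\<in>S. \<Sum>a\<in>UNIV. \<Sum>z\<in>UNIV. eta (v c $ a * k a z))"
    by (rule sum.swap)
  finally have 1: "entropy_of J (\<lambda>s. (A s, Z s, C s)) = (\<Sum>c\<in>S. \<Sum>a\<in>UNIV. \<Sum>z\<in>UNIV. eta (v c $ a * k a z))" .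
  have m: "pmf (map_pmf (\<lambda>s. (Z s, C s)) J) (z, c) = (\<Sum>a\<in>UNIV. v c $ a * k a z)" if "c \<in> S" for z c
    using sum_pmf_map_fst[of J UNIV A "\<lambda>s. (Z s, C s)" "(z, c)"] fin v[OF that] by simp
  have "entropy_of J (\<lambda>s. (Z s, C s)) = (\<Sum>(z,c)\<in>UNIV \<times> S. eta (\<Sum>a\<in>UNIV. v c $ a * k a z))"
    unfolding entropy_of_def
    by (subst ent_eq_sum[where S = "UNIV \<times> S"]) (use fin C m in \<open>auto intro!: sum.cong\<close>)
  also have "\<dots> = (\<Sum>z\<in>UNIV. \<Sum>c\<in>S. eta (\<Sum>a\<in>UNIV. v c $ a * k a z))"
    by (simp add: sum.cartesian_product)
  also have "\<dots> = (\<Sum>c\<in>S. \<Sum>z\<in>UNIV. eta (\<Sum>a\<in>UNIV. v c $ a * k a z))"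
    by (rule sum.swap)
  finally show ?thesis
    unfolding 1 by (simp add: equivocation_def sum_subtractf)
qed

lemma pmf_map_reindex:
  assumes "finite I" "inj_on e I" "\<And>i. i \<in> I \<Longrightarrow> f (e i) = b"
    and "\<And>s. s \<in> set_pmf J \<Longrightarrow> f s = b \<Longrightarrow> s \<in> e ` I"
  shows "pmf (map_pmf f J) b = (\<Sum>i\<in>I. pmf J (e i))"
proof -
  have "AE s in J. s \<in> f -` {b} \<longleftrightarrow> s \<in> e ` I"
    unfolding AE_measure_pmf_iff using assms(3,4) by blast
  then have "pmf (map_pmf f J) b = measure J (e ` I)"
    unfolding pmf_map by (intro measure_pmf.finite_measure_eq_AE) auto
  also have "\<dots> = (\<Sum>s\<in>e ` I. pmf J s)"
    using assms(1) by (intro measure_measure_pmf_finite) auto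
  also have "\<dots> = (\<Sum>i\<in>I. pmf J (e i))"
    using assms(2) by (simp add: sum.reindex)
  finally show ?thesis .
qed

lemma pmf_bind_Pair:
  "pmf (p \<bind> (\<lambda>x. map_pmf (Pair x) (q x))) (x, y) = pmf p x * pmf (q x) y"
proof -
  have "pmf (map_pmf (Pair x') (q x')) (x, y) = (if x' = x then pmf (q x) y else 0)" for x'
    by (cases "x' = x") (auto simp: pmf_map_inj' inj_def intro!: pmf_map_outside)
  then show ?thesis
    by (simp add: pmf_bind) (subst integral_measure_pmf_real[where A = "{x}"], auto split: if_splits)
qed

lemma ex_pmf_weights:
  fixes f :: "'a \<Rightarrow> real"
  assumes "finite S" "\<And>x. x \<in> S \<Longrightarrow> 0 \<le> f x" "(\<Sum>x\<in>S. f x) = 1"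
  shows "\<exists>p. \<forall>x. pmf p x = (if x \<in> S then f x else 0)"
proof -
  let ?f = "\<lambda>x. if x \<in> S then f x else 0"
  have "(\<integral>\<^sup>+x. ennreal (?f x) \<partial>count_space UNIV) = (\<Sum>x\<in>S. ennreal (?f x))"
    using assms(1) by (intro nn_integral_count_space'[OF assms(1)]) auto
  also have "\<dots> = ennreal (\<Sum>x\<in>S. f x)"
    using assms(2) by (subst sum_ennreal[symmetric]) auto
  finally have "pmf (embed_pmf ?f) x = ?f x" for x
    using assms by (intro pmf_embed_pmf) auto
  then show ?thesis by blast
qed

context helper_source
begin

text \<open>The kernel may look at both \<open>x\<close> and \<open>y\<close>. This covers the law
  induced by a block code, where \<open>W\<close> depends on \<open>Y\<close> beyond
  \<open>(X, U)\<close>, as well as \<open>aux_joint\<close>.\<close>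

definition joint :: "('x \<Rightarrow> 'y \<Rightarrow> ('u \<times> 'w) pmf) \<Rightarrow> ('x \<times> 'y \<times> 'z \<times> 'u \<times> 'w) pmf" where
  "joint \<kappa> = do { (x,y) \<leftarrow> pxy; z \<leftarrow> pzx x; (u,w) \<leftarrow> \<kappa> x y; return_pmf (x,y,z,u,w) }"

lemma pmf_joint:
  "pmf (joint \<kappa>) (x,y,z,u,w) = pmf pxy (x,y) * pz x z * pmf (\<kappa> x y) (u,w)"
proof -
  let ?K = "pxy \<bind> (\<lambda>v. map_pmf (Pair v) (pzx (fst v) \<bind> (\<lambda>z. map_pmf (Pair z) (\<kappa> (fst v) (snd v)))))"
  let ?e = "\<lambda>(v, z, uw). (fst v, snd v, z, fst uw, snd uw)"
  have "joint \<kappa> = map_pmf ?e ?K"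
    by (simp add: joint_def map_pmf_def bind_assoc_pmf bind_return_pmf case_prod_unfold)
  moreover have "inj ?e"
    by (auto simp: inj_def)
  ultimately have "pmf (joint \<kappa>) (?e ((x,y), z, (u,w))) = pmf ?K ((x,y), z, (u,w))"
    using pmf_map_inj'[of ?e ?K "((x,y), z, (u,w))"] by metis
  then show ?thesis
    by (simp add: pmf_bind_Pair pz_def)
qed

lemma aux_joint_eq_joint:
  "aux_joint pxy pzx pu pw = joint (\<lambda>x y. pu y \<bind> (\<lambda>u. map_pmf (Pair u) (pw x u)))"
  by (simp add: aux_joint_def joint_def map_pmf_def bind_assoc_pmf bind_return_pmf case_prod_unfold)

lemma pY_eq_sum: "pY y = (\<Sum>x\<in>UNIV. pmf pxy (x, y))"
  unfolding pY_def by (rule pmf_map_reindex) (auto simp: inj_on_def)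

lemma pY_mult_kxy: "pY y * kxy x y = pmf pxy (x, y)"
proof (cases "pY y = 0")
  case True
  then have "pmf pxy (x, y) = 0"
    unfolding pY_eq_sum by (subst (asm) sum_nonneg_eq_0_iff) auto
  with True show ?thesis by simp
qed (simp add: kxy_def)

lemma sum_pz: "(\<Sum>z\<in>UNIV. pz x z) = 1"
  unfolding pz_def by (intro sum_pmf_eq_1) auto

end

text \<open>The only structural demand is \<open>marg\<close>: the law of \<open>u\<close> depends
  on \<open>y\<close> alone. Nothing is asked of \<open>w\<close>, so the joint laws obtained from
  codes qualify.\<close>

locale helper_joint = helper_source pxy pzx d
  for pxy :: "('x::finite \<times> 'y::finite) pmf" and pzx :: "'x \<Rightarrow> 'z::finite pmf"
    and d :: "'x \<Rightarrow> 'xh::finite \<Rightarrow> real" +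
  fixes \<kappa> :: "'x \<Rightarrow> 'y \<Rightarrow> ('u \<times> 'w) pmf" and S :: "'u set" and T :: "'w set" and g :: "'y \<Rightarrow> 'u \<Rightarrow> real"
  assumes fin: "finite S" "finite T"
    and supp: "\<And>x y. set_pmf (\<kappa> x y) \<subseteq> S \<times> T"
    and marg: "\<And>x y u. u \<in> S \<Longrightarrow> (\<Sum>w\<in>T. pmf (\<kappa> x y) (u, w)) = g y u"
begin

abbreviation "J \<equiv> joint \<kappa>"
abbreviation "X \<equiv> (\<lambda>(x,y,z,u,w). x) :: 'x \<times> 'y \<times> 'z \<times> 'u \<times> 'w \<Rightarrow> 'x"
abbreviation "Y \<equiv> (\<lambda>(x,y,z,u,w). y) :: 'x \<times> 'y \<times> 'z \<times> 'u \<times> 'w \<Rightarrow> 'y"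
abbreviation "Z \<equiv> (\<lambda>(x,y,z,u,w). z) :: 'x \<times> 'y \<times> 'z \<times> 'u \<times> 'w \<Rightarrow> 'z"
abbreviation "U \<equiv> (\<lambda>(x,y,z,u,w). u) :: 'x \<times> 'y \<times> 'z \<times> 'u \<times> 'w \<Rightarrow> 'u"
abbreviation "W \<equiv> (\<lambda>(x,y,z,u,w). w) :: 'x \<times> 'y \<times> 'z \<times> 'u \<times> 'w \<Rightarrow> 'w"

text \<open>This is p(y,u), and \<open>vUW\<close> is p(x,u,w): posteriors that still carry the
  probability of their letters.\<close>

definition vU :: "'u \<Rightarrow> real ^ 'y" where
  "vU u = (\<chi> y. pY y * g y u)"

definition vUW :: "'u \<Rightarrow> 'w \<Rightarrow> real ^ 'x" where
  "vUW u w = (\<chi> x. \<Sum>y\<in>UNIV. pmf pxy (x, y) * pmf (\<kappa> x y) (u, w))"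

lemma set_J: "set_pmf J \<subseteq> UNIV \<times> UNIV \<times> UNIV \<times> S \<times> T"
  using supp by (fastforce simp: joint_def)

lemma finite_J: "finite (set_pmf J)"
  by (rule finite_subset[OF set_J]) (use fin in auto)

lemma g_nonneg: "u \<in> S \<Longrightarrow> 0 \<le> g y u"
  unfolding marg[of u undefined y, symmetric] by (intro sum_nonneg) auto

lemma sum_g: "(\<Sum>u\<in>S. g y u) = 1"
proof -
  have "(\<Sum>u\<in>S. g y u) = (\<Sum>u\<in>S. \<Sum>w\<in>T. pmf (\<kappa> undefined y) (u, w))"
    by (simp add: marg)
  also have "\<dots> = (\<Sum>uw\<in>S \<times> T. pmf (\<kappa> undefined y) uw)"
    by (simp add: sum.cartesian_product)
  also have "\<dots> = 1"
    by (rule sum_pmf_eq_1) (use fin supp in auto)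
  finally show ?thesis .
qed

lemma sum_vU: "(\<Sum>u\<in>S. vU u) = PY"
  by (simp add: vec_eq_iff vU_def PY_def sum_g flip: sum_distrib_left)

text \<open>Summing over \<open>w\<close> leaves only the marginal kernel of \<open>u\<close>, which
  depends on \<open>y\<close> alone. This identity is the whole link between the outer and the inner
  level.\<close>

lemma sum_vUW: "u \<in> S \<Longrightarrow> (\<Sum>w\<in>T. vUW u w) = pushX (vU u)"
proof -
  assume u: "u \<in> S"
  have "(\<Sum>w\<in>T. \<Sum>y\<in>UNIV. pmf pxy (x, y) * pmf (\<kappa> x y) (u, w)) = (\<Sum>y\<in>UNIV. pY y * g y u * kxy x y)" for x
  proof -
    have "(\<Sum>w\<in>T. \<Sum>y\<in>UNIV. pmf pxy (x, y) * pmf (\<kappa> x y) (u, w)) =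
      (\<Sum>y\<in>UNIV. \<Sum>w\<in>T. pmf pxy (x, y) * pmf (\<kappa> x y) (u, w))"
      by (rule sum.swap)
    also have "\<dots> = (\<Sum>y\<in>UNIV. pmf pxy (x, y) * g y u)"
      using u by (simp add: marg flip: sum_distrib_left)
    also have "\<dots> = (\<Sum>y\<in>UNIV. pY y * g y u * kxy x y)"
      by (intro sum.cong refl) (simp add: pY_mult_kxy[symmetric] mult_ac)
    finally show ?thesis .
  qed
  then show ?thesis
    by (simp add: vec_eq_iff vUW_def pushX_def vU_def)
qed

lemma vU_nonneg: "u \<in> S \<Longrightarrow> 0 \<le> vU u $ y"
  by (simp add: vU_def g_nonneg)

lemma vUW_nonneg: "0 \<le> vUW u w $ x"
  by (auto simp: vUW_def intro!: sum_nonneg)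

lemma pmf_YZU:
  assumes u: "u \<in> S"
  shows "pmf (map_pmf (\<lambda>s. (Y s, Z s, U s)) J) (y, z, u) = vU u $ y * kyz y z"
proof -
  have "pmf (map_pmf (\<lambda>s. (Y s, Z s, U s)) J) (y, z, u) =
     (\<Sum>(x,w)\<in>UNIV \<times> T. pmf J (x, y, z, u, w))"
    using fin set_J
    by (subst pmf_map_reindex[where I = "UNIV \<times> T" and e = "\<lambda>(x,w). (x, y, z, u, w)"])
       (auto simp: inj_on_def case_prod_unfold image_iff)
  also have "\<dots> = (\<Sum>x\<in>UNIV. \<Sum>w\<in>T. pmf pxy (x,y) * pz x z * pmf (\<kappa> x y) (u,w))"
    by (simp add: pmf_joint sum.cartesian_product)
  also have "\<dots> = (\<Sum>x\<in>UNIV. pmf pxy (x,y) * pz x z * g y u)"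
    using u by (simp add: marg flip: sum_distrib_left)
  also have "\<dots> = vU u $ y * kyz y z"
    by (simp add: vU_def kyz_def sum_distrib_left pY_mult_kxy[symmetric] mult_ac)
  finally show ?thesis .
qed

lemma pmf_XZUW:
  assumes "u \<in> S" "w \<in> T"
  shows "pmf (map_pmf (\<lambda>s. (X s, Z s, U s, W s)) J) (x, z, u, w) = vUW u w $ x * pz x z"
proof -
  have "pmf (map_pmf (\<lambda>s. (X s, Z s, U s, W s)) J) (x, z, u, w) =
     (\<Sum>y\<in>UNIV. pmf J (x, y, z, u, w))"
    by (subst pmf_map_reindex[where I = UNIV and e = "\<lambda>y. (x, y, z, u, w)"])
       (auto simp: inj_on_def case_prod_unfold image_iff)
  also have "\<dots> = vUW u w $ x * pz x z"
    by (simp add: pmf_joint vUW_def sum_distrib_left sum_distrib_right mult_ac)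
  finally show ?thesis .
qed

lemma pmf_XZU:
  assumes "u \<in> S"
  shows "pmf (map_pmf (\<lambda>s. (X s, Z s, U s)) J) (x, z, u) = pushX (vU u) $ x * pz x z"
proof -
  have "pmf (map_pmf (\<lambda>s. (X s, Z s, U s)) J) (x, z, u) =
     (\<Sum>w\<in>T. pmf (map_pmf (\<lambda>s. (X s, Z s, U s, W s)) J) (x, z, u, w))"
    using fin set_J
      pmf_map_reindex[where I = T and e = "\<lambda>w. (x, z, u, w)" and f = "\<lambda>(x,z,u,w). (x,z,u)"
         and J = "map_pmf (\<lambda>s. (X s, Z s, U s, W s)) J" and b = "(x, z, u)"]
    by (force simp: inj_on_def case_prod_unfold image_iff pmf.map_comp o_def)
  also have "\<dots> = (\<Sum>w\<in>T. vUW u w $ x * pz x z)"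
    using assms by (simp add: pmf_XZUW)
  also have "\<dots> = pushX (vU u) $ x * pz x z"
    using sum_vUW[OF assms] by (simp add: vec_eq_iff flip: sum_distrib_right)
  finally show ?thesis .
qed

text \<open>The unit component is a trivial conditioning variable, so that
  \<open>entropy_equivocation\<close> also yields H(Y|Z).\<close>

lemma pmf_YZ: "pmf (map_pmf (\<lambda>s. (Y s, Z s, ())) J) (y, z, c) = PY $ y * kyz y z"
proof -
  have "pmf (map_pmf (\<lambda>s. (Y s, Z s, ())) J) (y, z, c) =
     (\<Sum>u\<in>S. pmf (map_pmf (\<lambda>s. (Y s, Z s, U s)) J) (y, z, u))"
    using fin set_J
      pmf_map_reindex[where I = S and e = "\<lambda>u. (y, z, u)" and f = "\<lambda>(y,z,u). (y,z,())"
         and J = "map_pmf (\<lambda>s. (Y s, Z s, U s)) J" and b = "(y, z, c)"]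
    by (force simp: inj_on_def case_prod_unfold image_iff pmf.map_comp o_def)
  also have "\<dots> = (\<Sum>u\<in>S. vU u $ y * kyz y z)"
    by (simp add: pmf_YZU)
  also have "\<dots> = PY $ y * kyz y z"
    using sum_vU by (simp add: vec_eq_iff flip: sum_distrib_right)
  finally show ?thesis .
qed

lemma entropy_Y_given_Z:
  "entropy_of J (\<lambda>s. (Y s, Z s)) - entropy_of J Z = equivocation kyz PY"
proof -
  have "entropy_of J (\<lambda>s. (Y s, Z s, ())) - entropy_of J (\<lambda>s. (Z s, ())) = (\<Sum>c\<in>{()}. equivocation kyz PY)"
    by (rule entropy_equivocation[OF finite_J]) (auto simp: pmf_YZ)
  moreover have "entropy_of J (\<lambda>s. (Y s, Z s, ())) = entropy_of J (\<lambda>s. (Y s, Z s))"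
      "entropy_of J (\<lambda>s. (Z s, ())) = entropy_of J Z"
    by (auto intro!: entropy_of_cong[OF finite_J])
  ultimately show ?thesis by simp
qed

lemma entropy_Y_given_ZU:
  "entropy_of J (\<lambda>s. (Y s, Z s, U s)) - entropy_of J (\<lambda>s. (Z s, U s)) = (\<Sum>u\<in>S. equivocation kyz (vU u))"
  by (rule entropy_equivocation[OF finite_J fin(1)]) (use set_J pmf_YZU in auto)

lemma cond_mutual_info_UY:
  "cond_mutual_info J U Y Z = equivocation kyz PY - (\<Sum>u\<in>S. equivocation kyz (vU u))"
proof -
  have "entropy_of J (\<lambda>s. (U s, Y s, Z s)) = entropy_of J (\<lambda>s. (Y s, Z s, U s))"
       "entropy_of J (\<lambda>s. (U s, Z s)) = entropy_of J (\<lambda>s. (Z s, U s))"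
    by (rule entropy_of_cong[OF finite_J]; auto)+
  then show ?thesis
    using entropy_Y_given_Z entropy_Y_given_ZU by (simp add: cond_mutual_info_entropy[OF finite_J])
qed

lemma cond_mutual_info_XW:
  "cond_mutual_info J X W (\<lambda>s. (U s, Z s)) =
     (\<Sum>u\<in>S. equivocation pz (pushX (vU u)) - (\<Sum>w\<in>T. equivocation pz (vUW u w)))"
proof -
  have 1: "entropy_of J (\<lambda>s. (X s, Z s, U s)) - entropy_of J (\<lambda>s. (Z s, U s)) = (\<Sum>u\<in>S. equivocation pz (pushX (vU u)))"
    by (rule entropy_equivocation[OF finite_J fin(1)]) (use set_J pmf_XZU in auto)
  have "entropy_of J (\<lambda>s. (X s, Z s, (U s, W s))) - entropy_of J (\<lambda>s. (Z s, (U s, W s)))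
      = (\<Sum>c\<in>S \<times> T. equivocation pz (vUW (fst c) (snd c)))"
    by (rule entropy_equivocation[OF finite_J]) (use set_J fin pmf_XZUW in auto)
  also have "\<dots> = (\<Sum>u\<in>S. \<Sum>w\<in>T. equivocation pz (vUW u w))"
    by (simp add: sum.cartesian_product case_prod_unfold)
  finally have 2: "entropy_of J (\<lambda>s. (X s, Z s, U s, W s)) - entropy_of J (\<lambda>s. (Z s, U s, W s))
      = (\<Sum>u\<in>S. \<Sum>w\<in>T. equivocation pz (vUW u w))" .
  have "entropy_of J (\<lambda>s. (X s, U s, Z s)) = entropy_of J (\<lambda>s. (X s, Z s, U s))"
    "entropy_of J (\<lambda>s. (W s, U s, Z s)) = entropy_of J (\<lambda>s. (Z s, U s, W s))"
    "entropy_of J (\<lambda>s. (X s, W s, U s, Z s)) = entropy_of J (\<lambda>s. (X s, Z s, U s, W s))"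
    "entropy_of J (\<lambda>s. (U s, Z s)) = entropy_of J (\<lambda>s. (Z s, U s))"
    by (rule entropy_of_cong[OF finite_J]; auto)+
  then show ?thesis
    using 1 2 by (simp add: cond_mutual_info_entropy[OF finite_J] sum_subtractf)
qed

lemma expectation_distortion:
  "measure_pmf.expectation J (\<lambda>(x,y,z,u,w). d x (xhat u w z)) = (\<Sum>u\<in>S. \<Sum>w\<in>T. dist_of (vUW u w) (xhat u w))"
proof -
  have "measure_pmf.expectation J (\<lambda>(x,y,z,u,w). d x (xhat u w z)) =
     measure_pmf.expectation (map_pmf (\<lambda>s. (X s, Z s, U s, W s)) J) (\<lambda>(x,z,u,w). d x (xhat u w z))"
    by (simp add: case_prod_unfold)
  also have "\<dots> = (\<Sum>(x,z,u,w)\<in>UNIV \<times> UNIV \<times> S \<times> T. d x (xhat u w z) * (vUW u w $ x * pz x z))"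
    using fin set_J
    by (subst integral_measure_pmf_real[where A = "UNIV \<times> UNIV \<times> S \<times> T"]) (auto simp: pmf_XZUW intro!: sum.cong)
  also have "\<dots> = (\<Sum>x\<in>UNIV. \<Sum>z\<in>UNIV. \<Sum>uw\<in>S \<times> T. d x (xhat (fst uw) (snd uw) z) * (vUW (fst uw) (snd uw) $ x * pz x z))"
    by (simp add: sum.cartesian_product case_prod_unfold)
  also have "\<dots> = (\<Sum>x\<in>UNIV. \<Sum>uw\<in>S \<times> T. \<Sum>z\<in>UNIV. d x (xhat (fst uw) (snd uw) z) * (vUW (fst uw) (snd uw) $ x * pz x z))"
    by (intro sum.cong refl sum.swap)
  also have "\<dots> = (\<Sum>uw\<in>S \<times> T. \<Sum>x\<in>UNIV. \<Sum>z\<in>UNIV. d x (xhat (fst uw) (snd uw) z) * (vUW (fst uw) (snd uw) $ x * pz x z))"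
    by (rule sum.swap)
  also have "\<dots> = (\<Sum>uw\<in>S \<times> T. dist_of (vUW (fst uw) (snd uw)) (xhat (fst uw) (snd uw)))"
    by (simp add: dist_of_def mult_ac)
  also have "\<dots> = (\<Sum>u\<in>S. \<Sum>w\<in>T. dist_of (vUW u w) (xhat u w))"
    by (simp add: sum.cartesian_product case_prod_unfold)
  finally show ?thesis .
qed

end


section \<open>From points of the hull to channels\<close>

context helper_source
begin

lemma dist_of_scale: "dist_of (c *\<^sub>R r) \<phi> = c * dist_of r \<phi>"
  by (simp add: dist_of_def sum_distrib_left mult_ac)

lemma dist_of_zero: "dist_of 0 \<phi> = 0"
  by (simp add: dist_of_def)

lemma inner_hullE:
  assumes "(r, a, b) \<in> convex hull inner_points"
  obtains L :: nat and s \<rho> \<phi> where "\<And>l. l < L \<Longrightarrow> 0 \<le> s l" "\<And>l. l < L \<Longrightarrow> \<rho> l \<in> prob_simplex"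
    "(\<Sum>l<L. s l) = 1" "(\<Sum>l<L. s l *\<^sub>R \<rho> l) = r" "(\<Sum>l<L. s l * equivocation pz (\<rho> l)) = a"
    "(\<Sum>l<L. s l * dist_of (\<rho> l) (\<phi> l)) = b"
proof -
  obtain L :: nat and s e where e: "\<And>l. l < L \<Longrightarrow> 0 \<le> s l" "\<And>l. l < L \<Longrightarrow> e l \<in> inner_points"
      "(\<Sum>l<L. s l) = 1" "(\<Sum>l<L. s l *\<^sub>R e l) = (r, a, b)"
    by (rule convex_hull_nat_indexed[OF assms]) blast
  have "\<forall>l. \<exists>\<rho> \<phi>. l < L \<longrightarrow> \<rho> \<in> prob_simplex \<and> e l = (\<rho>, equivocation pz \<rho>, dist_of \<rho> \<phi>)"
    using e(2) unfolding inner_points_def by blast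
  then obtain \<rho> \<phi> where \<rho>: "\<And>l. l < L \<Longrightarrow> \<rho> l \<in> prob_simplex"
      "\<And>l. l < L \<Longrightarrow> e l = (\<rho> l, equivocation pz (\<rho> l), dist_of (\<rho> l) (\<phi> l))"
    by metis
  have "(\<Sum>l<L. s l *\<^sub>R e l) = (\<Sum>l<L. (s l *\<^sub>R \<rho> l, s l * equivocation pz (\<rho> l), s l * dist_of (\<rho> l) (\<phi> l)))"
    by (intro sum.cong) (auto simp: \<rho>)
  with e(4) have "(\<Sum>l<L. s l *\<^sub>R \<rho> l) = r" "(\<Sum>l<L. s l * equivocation pz (\<rho> l)) = a"
      "(\<Sum>l<L. s l * dist_of (\<rho> l) (\<phi> l)) = b"
    by (simp_all add: sum_prod)
  with e \<rho>(1) show thesis by (intro that[of L s \<rho> \<phi>]) auto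
qed

lemma outer_hullE:
  assumes "(v, h, i, b) \<in> convex hull outer_points"
  obtains k :: nat and t q a \<beta> where "\<And>j. j < k \<Longrightarrow> 0 \<le> t j" "\<And>j. j < k \<Longrightarrow> q j \<in> prob_simplex"
    "\<And>j. j < k \<Longrightarrow> (pushX (q j), a j, \<beta> j) \<in> convex hull inner_points"
    "(\<Sum>j<k. t j) = 1" "(\<Sum>j<k. t j *\<^sub>R q j) = v" "(\<Sum>j<k. t j * equivocation kyz (q j)) = h"
    "(\<Sum>j<k. t j * (equivocation pz (pushX (q j)) - a j)) = i" "(\<Sum>j<k. t j * \<beta> j) = b"
proof -
  obtain k :: nat and t c where c: "\<And>j. j < k \<Longrightarrow> 0 \<le> t j" "\<And>j. j < k \<Longrightarrow> c j \<in> outer_points"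
      "(\<Sum>j<k. t j) = 1" "(\<Sum>j<k. t j *\<^sub>R c j) = (v, h, i, b)"
    by (rule convex_hull_nat_indexed[OF assms]) blast
  have "\<forall>j. \<exists>q a \<beta>. j < k \<longrightarrow> q \<in> prob_simplex \<and> (pushX q, a, \<beta>) \<in> convex hull inner_points \<and>
      c j = (q, equivocation kyz q, equivocation pz (pushX q) - a, \<beta>)"
    using c(2) unfolding outer_points_def by blast
  then obtain q a \<beta> where q: "\<And>j. j < k \<Longrightarrow> q j \<in> prob_simplex"
      "\<And>j. j < k \<Longrightarrow> (pushX (q j), a j, \<beta> j) \<in> convex hull inner_points"
      "\<And>j. j < k \<Longrightarrow> c j = (q j, equivocation kyz (q j), equivocation pz (pushX (q j)) - a j, \<beta> j)"
    by metis
  have "(\<Sum>j<k. t j *\<^sub>R c j) = (\<Sum>j<k. (t j *\<^sub>R q j, t j * equivocation kyz (q j),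
      t j * (equivocation pz (pushX (q j)) - a j), t j * \<beta> j))"
    by (intro sum.cong) (auto simp: q)
  with c(4) have "(\<Sum>j<k. t j *\<^sub>R q j) = v" "(\<Sum>j<k. t j * equivocation kyz (q j)) = h"
      "(\<Sum>j<k. t j * (equivocation pz (pushX (q j)) - a j)) = i" "(\<Sum>j<k. t j * \<beta> j) = b"
    by (simp_all add: sum_prod)
  with c q(1,2) show thesis by (intro that[of k t q a \<beta>]) auto
qed

text \<open>Nonnegative weights vanish wherever their total does, so the multiplied-out identity holds
  without exception.\<close>
lemma ex_channel_weights:
  fixes f :: "nat \<Rightarrow> 'a \<Rightarrow> real"
  assumes "\<And>j y. j < k \<Longrightarrow> 0 \<le> f j y"
  shows "\<exists>p. \<forall>y. set_pmf (p y) \<subseteq> {..k} \<and>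
     (\<forall>j. pmf (p y) j * (\<Sum>i<k. f i y) = (if j < k then f j y else 0))"
proof -
  have "\<exists>p. set_pmf p \<subseteq> {..k} \<and> (\<forall>j. pmf p j * (\<Sum>i<k. f i y) = (if j < k then f j y else 0))" for y
  proof (cases "(\<Sum>i<k. f i y) = 0")
    case True
    then have "\<forall>i<k. f i y = 0"
      using assms by (subst (asm) sum_nonneg_eq_0_iff) auto
    with True show ?thesis
      by (intro exI[of _ "return_pmf 0"]) auto
  next
    case False
    then have "0 < (\<Sum>i<k. f i y)"
      using assms by (metis lessThan_iff order_le_less sum_nonneg)
    then have "\<exists>p. \<forall>x. pmf p x = (if x \<in> {..<k} then f x y / (\<Sum>i<k. f i y) else 0)"
      using assms by (intro ex_pmf_weights) (auto simp flip: sum_divide_distrib)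
    then obtain p where p: "\<And>x. pmf p x = (if x < k then f x y / (\<Sum>i<k. f i y) else 0)"
      by auto
    have "set_pmf p \<subseteq> {..k}"
      by (auto simp: set_pmf_iff p split: if_splits)
    with p False show ?thesis by (intro exI[of _ p]) auto
  qed
  then show ?thesis by metis
qed

lemma helper_joint_aux:
  fixes pu :: "'y \<Rightarrow> 'u pmf" and pw :: "'x \<Rightarrow> 'u \<Rightarrow> 'w pmf"
  assumes "finite S" "finite T" and pu: "\<And>y. set_pmf (pu y) \<subseteq> S" and pw: "\<And>x u. set_pmf (pw x u) \<subseteq> T"
  shows "helper_joint d (\<lambda>x y. pu y \<bind> (\<lambda>u. map_pmf (Pair u) (pw x u))) S T (\<lambda>y u. pmf (pu y) u)"
proof
  show "set_pmf (pu y \<bind> (\<lambda>u. map_pmf (Pair u) (pw x u))) \<subseteq> S \<times> T" for x y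
    using pu[of y] pw by fastforce
  show "(\<Sum>w\<in>T. pmf (pu y \<bind> (\<lambda>u. map_pmf (Pair u) (pw x u))) (u, w)) = pmf (pu y) u" for x y u
    using assms by (simp add: pmf_bind_Pair sum_pmf_eq_1 flip: sum_distrib_left)
qed fact+

text \<open>Bayes' rule turns posteriors into channels: p(u|y) is
  \<open>t u * q u $ y / pY y\<close>, and p(w|x,u) is \<open>s u w * \<rho> u w $ x\<close> divided
  by \<open>pushX (q u) $ x\<close>. The vectors \<open>vU\<close> and \<open>vUW\<close> of this
  joint law are then the given hull points times their weights, and homogeneity returns the given
  averages.\<close>

theorem rate_region_subset:
  assumes "(R, R1, D) \<in> rate_region"
  shows "(R, R1) \<in> single_letter_region pxy pzx d D"
proof -
  from assms obtain h i b where hib: "(PY, h, i, b) \<in> convex hull outer_points"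
      "equivocation kyz PY - h \<le> R1" "i \<le> R" "b \<le> D"
    by (auto simp: rate_region_def)
  obtain k :: nat and t q a \<beta> where t: "\<And>j. j < k \<Longrightarrow> 0 \<le> t j" and q: "\<And>j. j < k \<Longrightarrow> q j \<in> prob_simplex"
    and mem: "\<And>j. j < k \<Longrightarrow> (pushX (q j), a j, \<beta> j) \<in> convex hull inner_points"
    and eqs: "(\<Sum>j<k. t j) = 1" "(\<Sum>j<k. t j *\<^sub>R q j) = PY" "(\<Sum>j<k. t j * equivocation kyz (q j)) = h"
    "(\<Sum>j<k. t j * (equivocation pz (pushX (q j)) - a j)) = i" "(\<Sum>j<k. t j * \<beta> j) = b"
    by (rule outer_hullE[OF hib(1)]) blast
  have "\<forall>j. \<exists>(L::nat) s \<rho> \<phi>. j < k \<longrightarrow> (\<forall>l<L. 0 \<le> s l) \<and> (\<forall>l<L. \<rho> l \<in> prob_simplex) \<and>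
    (\<Sum>l<L. s l) = 1 \<and> (\<Sum>l<L. s l *\<^sub>R \<rho> l) = pushX (q j) \<and> (\<Sum>l<L. s l * equivocation pz (\<rho> l)) = a j \<and>
    (\<Sum>l<L. s l * dist_of (\<rho> l) (\<phi> l)) = \<beta> j" (is "\<forall>j. \<exists>L s \<rho> \<phi>. j < k \<longrightarrow> ?P j L s \<rho> \<phi>")
  proof
    fix j
    show "\<exists>L s \<rho> \<phi>. j < k \<longrightarrow> ?P j L s \<rho> \<phi>"
    proof (cases "j < k")
      case True
      have "\<exists>L s \<rho> \<phi>. ?P j L s \<rho> \<phi>"
        by (rule inner_hullE[OF mem[OF True]]) blast
      then show ?thesis by blast
    qed auto
  qed
  then obtain L :: "nat \<Rightarrow> nat" and s \<rho> \<phi> where P: "\<And>j. j < k \<Longrightarrow> ?P j (L j) (s j) (\<rho> j) (\<phi> j)"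
    unfolding choice_iff by blast
  have s: "\<And>j l. j < k \<Longrightarrow> l < L j \<Longrightarrow> 0 \<le> s j l"
    and \<rho>: "\<And>j l. j < k \<Longrightarrow> l < L j \<Longrightarrow> \<rho> j l \<in> prob_simplex"
    and seqs: "\<And>j. j < k \<Longrightarrow> (\<Sum>l<L j. s j l *\<^sub>R \<rho> j l) = pushX (q j)"
      "\<And>j. j < k \<Longrightarrow> (\<Sum>l<L j. s j l * equivocation pz (\<rho> j l)) = a j"
      "\<And>j. j < k \<Longrightarrow> (\<Sum>l<L j. s j l * dist_of (\<rho> j l) (\<phi> j l)) = \<beta> j"
    using P by blast+
  have q0: "0 \<le> q j $ y" if "j < k" for j y
    using q[OF that] by (simp add: prob_simplex_def)
  have \<rho>0: "0 \<le> \<rho> j l $ x" if "j < k" "l < L j" for j l x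
    using \<rho>[OF that] by (simp add: prob_simplex_def)
  \<comment> \<open>The support bound is \<open>{..k}\<close> rather than \<open>{..<k}\<close> so
    that it contains the default letter \<open>0\<close> even for \<open>k = 0\<close>;
    \<open>restrict_k\<close> later discards the surplus index.\<close>
  obtain pu where pu: "\<And>y. set_pmf (pu y) \<subseteq> {..k}"
    "\<And>y j. pmf (pu y) j * (\<Sum>i<k. t i * q i $ y) = (if j < k then t j * q j $ y else 0)"
    using ex_channel_weights[of k "\<lambda>j y. t j * q j $ y", OF mult_nonneg_nonneg[OF t q0]] by blast
  have sumq: "(\<Sum>i<k. t i * q i $ y) = pY y" for y
    using eqs(2) by (simp add: vec_eq_iff PY_def)
  have pu_pY: "pmf (pu y) j * pY y = (if j < k then t j * q j $ y else 0)" for y j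
    using pu(2)[of y j] by (simp add: sumq)
  have "\<exists>p. \<forall>x. set_pmf (p x) \<subseteq> {..L j} \<and>
     (\<forall>l. pmf (p x) l * (\<Sum>l<L j. s j l * \<rho> j l $ x) = (if l < L j then s j l * \<rho> j l $ x else 0))" if "j < k" for j
    by (rule ex_channel_weights) (use s[OF that] \<rho>0[OF that] in auto)
  then have "\<forall>j. \<exists>p. j < k \<longrightarrow> (\<forall>x. set_pmf (p x) \<subseteq> {..L j} \<and>
     (\<forall>l. pmf (p x) l * (\<Sum>l<L j. s j l * \<rho> j l $ x) = (if l < L j then s j l * \<rho> j l $ x else 0)))"
    by blast
  then obtain pw' where pw': "\<And>j x. j < k \<Longrightarrow> set_pmf (pw' j x) \<subseteq> {..L j}"
    "\<And>j x l. j < k \<Longrightarrow> pmf (pw' j x) l * (\<Sum>l<L j. s j l * \<rho> j l $ x) = (if l < L j then s j l * \<rho> j l $ x else 0)"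
    unfolding choice_iff by blast
  define pw where "pw x j = (if j < k then pw' j x else return_pmf 0)" for x j
  have sum\<rho>: "(\<Sum>l<L j. s j l * \<rho> j l $ x) = pushX (q j) $ x" if "j < k" for j x
    using seqs(1)[OF that] by (simp add: vec_eq_iff)
  have pw_push: "pmf (pw x j) l * pushX (q j) $ x = (if l < L j then s j l * \<rho> j l $ x else 0)" if "j < k" for x j l
    using pw'(2)[OF that, of x l] that by (simp add: pw_def sum\<rho>)
  \<comment> \<open>One finite alphabet for all \<open>u\<close>: the sum dominates every
    \<open>L j\<close>, and it contains the default letter \<open>0\<close>.\<close>
  define T where "T = {..(\<Sum>j<k. L j)}"
  have LT: "{..L j} \<subseteq> T" if "j < k" for j
    using member_le_sum[of j "{..<k}" L] that by (auto simp: T_def)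
  have pwT: "set_pmf (pw x j) \<subseteq> T" for x j
    using subset_trans[OF pw'(1)[of j x] LT[of j]] by (auto simp: pw_def T_def)
  let ?\<kappa> = "\<lambda>x y. pu y \<bind> (\<lambda>u. map_pmf (Pair u) (pw x u))"
  have finT: "finite T"
    by (simp add: T_def)
  interpret J: helper_joint pxy pzx d ?\<kappa> "{..k}" T "\<lambda>y u. pmf (pu y) u"
    by (rule helper_joint_aux[OF finite_atMost finT pu(1) pwT])
  have vU: "J.vU u = (if u < k then t u *\<^sub>R q u else 0)" for u
    using pu_pY[of _ u] by (auto simp: J.vU_def vec_eq_iff mult.commute)
  have vUW: "J.vUW u w = (if u < k \<and> w < L u then (t u * s u w) *\<^sub>R \<rho> u w else 0)" for u w
  proof -
    have "J.vUW u w $ x = (if u < k \<and> w < L u then t u * s u w * \<rho> u w $ x else 0)" for x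
    proof -
      have "J.vUW u w $ x = (\<Sum>y\<in>UNIV. (pmf (pu y) u * pY y) * kxy x y * pmf (pw x u) w)"
        by (simp add: J.vUW_def pmf_bind_Pair pY_mult_kxy[symmetric] mult_ac)
      also have "\<dots> = (if u < k then t u * (pmf (pw x u) w * pushX (q u) $ x) else 0)"
        unfolding pu_pY by (simp add: pushX_def sum_distrib_left mult_ac)
      also have "\<dots> = (if u < k \<and> w < L u then t u * s u w * \<rho> u w $ x else 0)"
        by (simp add: pw_push)
      finally show ?thesis .
    qed
    then show ?thesis unfolding vec_eq_iff by auto
  qed
  have restrict_k: "(\<Sum>u\<le>k. if u < k then f u else 0) = (\<Sum>u<k. f u)" for f :: "nat \<Rightarrow> real"
    by (rule sum.mono_neutral_cong_right) auto
  have restrict_L: "(\<Sum>w\<in>T. if w < L u then f w else 0) = (\<Sum>w<L u. f w)" if "u < k" for u and f :: "nat \<Rightarrow> real"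
    using LT[OF that] by (intro sum.mono_neutral_cong_right) (auto simp: T_def)
  have ch_vU: "equivocation kyz (J.vU u) = (if u < k then t u * equivocation kyz (q u) else 0)" for u
    using t q0 by (simp add: vU equivocation_scale)
  have push0: "pushX 0 = 0"
    by (simp add: pushX_def vec_eq_iff)
  have push_scale: "pushX (c *\<^sub>R v) = c *\<^sub>R pushX v" for c v
    by (simp add: pushX_def vec_eq_iff sum_distrib_left mult_ac)
  have push_nonneg: "0 \<le> pushX (q u) $ x" if "u < k" for u x
    using q0[OF that] by (auto simp: pushX_def intro!: sum_nonneg)
  have ch_push: "equivocation pz (pushX (J.vU u)) = (if u < k then t u * equivocation pz (pushX (q u)) else 0)" for u
    using t push_nonneg by (simp add: vU push_scale push0 equivocation_scale)
  have ch_vUW: "(\<Sum>w\<in>T. equivocation pz (J.vUW u w)) = (if u < k then t u * a u else 0)" for u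
  proof (cases "u < k")
    case True
    have "(\<Sum>w\<in>T. equivocation pz (J.vUW u w)) =
        (\<Sum>w\<in>T. if w < L u then t u * (s u w * equivocation pz (\<rho> u w)) else 0)"
      using True t s \<rho>0 by (intro sum.cong refl) (auto simp: vUW equivocation_scale)
    also have "\<dots> = t u * a u"
      using True by (simp add: restrict_L seqs(2)[symmetric] sum_distrib_left)
    finally show ?thesis using True by simp
  qed (simp add: vUW)
  have dist_vUW: "(\<Sum>w\<in>T. dist_of (J.vUW u w) (\<phi> u w)) = (if u < k then t u * \<beta> u else 0)" for u
  proof (cases "u < k")
    case True
    have "(\<Sum>w\<in>T. dist_of (J.vUW u w) (\<phi> u w)) =
        (\<Sum>w\<in>T. if w < L u then t u * (s u w * dist_of (\<rho> u w) (\<phi> u w)) else 0)"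
      using True by (intro sum.cong refl) (auto simp: vUW dist_of_scale dist_of_zero mult.assoc)
    also have "\<dots> = t u * \<beta> u"
      using True by (simp add: restrict_L seqs(3)[symmetric] sum_distrib_left)
    finally show ?thesis using True by simp
  qed (simp add: vUW dist_of_zero)
  have "cond_mutual_info J.J J.U J.Y J.Z \<le> R1"
    using hib(2) eqs(3) by (simp add: J.cond_mutual_info_UY ch_vU restrict_k)
  moreover have "cond_mutual_info J.J J.X J.W (\<lambda>v. (J.U v, J.Z v)) \<le> R"
  proof -
    have "cond_mutual_info J.J J.X J.W (\<lambda>v. (J.U v, J.Z v)) =
      (\<Sum>u\<le>k. if u < k then t u * (equivocation pz (pushX (q u)) - a u) else 0)"
      unfolding J.cond_mutual_info_XW ch_push ch_vUW by (intro sum.cong) (auto simp: algebra_simps)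
    then show ?thesis
      using hib(3) eqs(4) by (simp add: restrict_k)
  qed
  moreover have "measure_pmf.expectation J.J (\<lambda>(x,y,z,u,w). d x (\<phi> u w z)) \<le> D"
    using hib(4) eqs(5) by (simp add: J.expectation_distortion dist_vUW restrict_k)
  moreover have "finite (\<Union>y. set_pmf (pu y))"
    by (rule finite_subset[of _ "{..k}"]) (use pu(1) in auto)
  moreover have "finite (\<Union>x. \<Union>u. set_pmf (pw x u))"
    by (rule finite_subset[of _ T]) (use pwT in \<open>auto simp: T_def\<close>)
  ultimately show ?thesis
    unfolding single_letter_region_def Let_def aux_joint_eq_joint mem_Collect_eq prod.case
    by (intro exI[of _ pu] exI[of _ pw] exI[of _ \<phi>] conjI)
qed

end

section \<open>Converse\<close>

lemma entropy_of_const [simp]: "entropy_of J (\<lambda>_. c) = 0"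
  by (simp add: entropy_of_def ent_def eta_def)

lemma entropy_of_subadditive:
  assumes "finite (set_pmf J)"
  shows "entropy_of J (\<lambda>s. (A s, B s)) \<le> entropy_of J A + entropy_of J B"
proof -
  have "entropy_of J (\<lambda>s. (A s, B s, ())) = entropy_of J (\<lambda>s. (A s, B s))"
    "entropy_of J (\<lambda>s. (A s, ())) = entropy_of J A" "entropy_of J (\<lambda>s. (B s, ())) = entropy_of J B"
    by (auto intro!: entropy_of_cong assms)
  then show ?thesis
    using entropy_of_submodular[OF assms, of A B "\<lambda>_. ()"] by simp
qed

text \<open>Submodularity when \<open>C\<close> is a function of \<open>B\<close>: conditioning on
  more lowers the entropy of \<open>A\<close>.\<close>

lemma cond_entropy_mono:
  assumes fin: "finite (set_pmf J)"
    and det: "\<And>s t. s \<in> set_pmf J \<Longrightarrow> t \<in> set_pmf J \<Longrightarrow> B s = B t \<Longrightarrow> C s = C t"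
  shows "entropy_of J (\<lambda>s. (A s, B s)) + entropy_of J C \<le> entropy_of J (\<lambda>s. (A s, C s)) + entropy_of J B"
proof -
  have "entropy_of J (\<lambda>s. (A s, B s, C s)) = entropy_of J (\<lambda>s. (A s, B s))"
    by (rule entropy_of_cong[OF fin]) (use det in blast)
  moreover have "entropy_of J (\<lambda>s. (B s, C s)) = entropy_of J B"
    by (rule entropy_of_cong[OF fin]) (use det in blast)
  ultimately show ?thesis
    using entropy_of_submodular[OF fin, of A B C] by simp
qed

text \<open>Since \<open>A\<close> determines \<open>Z\<close>, the right side is the information
  between \<open>V\<close> and \<open>A\<close> given \<open>Z\<close>. The first inequality
  enlarges \<open>U\<close> to \<open>A\<close>, the second enlarges \<open>Y\<close> to
  \<open>V\<close>. It is needed because the chain rule for the helper runs over the pairs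
  \<open>(X_i, Y_i)\<close> while \<open>U_i\<close> sees less.\<close>

lemma cond_mutual_info_data_processing:
  assumes fin: "finite (set_pmf J)"
    and Y: "\<And>s t. s \<in> set_pmf J \<Longrightarrow> t \<in> set_pmf J \<Longrightarrow> V s = V t \<Longrightarrow> Y s = Y t"
    and UZ: "\<And>s t. s \<in> set_pmf J \<Longrightarrow> t \<in> set_pmf J \<Longrightarrow> A s = A t \<Longrightarrow> U s = U t \<and> Z s = Z t"
  shows "cond_mutual_info J U Y Z \<le> entropy_of J (\<lambda>s. (V s, Z s)) - entropy_of J Z
     - (entropy_of J (\<lambda>s. (V s, A s)) - entropy_of J A)"
proof -
  have 1: "entropy_of J (\<lambda>s. (Y s, A s)) + entropy_of J (\<lambda>s. (U s, Z s))
      \<le> entropy_of J (\<lambda>s. (Y s, (U s, Z s))) + entropy_of J A"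
    by (rule cond_entropy_mono[OF fin]) (use UZ in blast)
  have 2: "entropy_of J (\<lambda>s. (V s, (Y s, A s))) + entropy_of J (\<lambda>s. (Y s, Z s))
      \<le> entropy_of J (\<lambda>s. (V s, (Y s, Z s))) + entropy_of J (\<lambda>s. (Y s, A s))"
    by (rule cond_entropy_mono[OF fin]) (use UZ in blast)
  have "entropy_of J (\<lambda>s. (V s, (Y s, A s))) = entropy_of J (\<lambda>s. (V s, A s))"
    by (rule entropy_of_cong[OF fin]) (use Y in blast)
  moreover have "entropy_of J (\<lambda>s. (V s, (Y s, Z s))) = entropy_of J (\<lambda>s. (V s, Z s))"
    by (rule entropy_of_cong[OF fin]) (use Y in blast)
  moreover have "entropy_of J (\<lambda>s. (U s, Y s, Z s)) = entropy_of J (\<lambda>s. (Y s, (U s, Z s)))"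
    by (rule entropy_of_cong[OF fin]) blast
  ultimately show ?thesis
    using 1 2 unfolding cond_mutual_info_entropy[OF fin] by linarith
qed

lemma ent_Pi_pmf:
  assumes "finite A" "finite (set_pmf p)"
  shows "ent (Pi_pmf A dflt (\<lambda>_. p)) = card A * ent p"
proof -
  let ?P = "Pi_pmf A dflt (\<lambda>_. p)"
  have fin: "finite (set_pmf ?P)"
    using assms by (auto simp: set_Pi_pmf)
  have "ent ?P = measure_pmf.expectation ?P (\<lambda>s. \<Sum>i\<in>A. - log 2 (pmf p (s i)))"
    unfolding ent_eq_expectation[OF fin]
  proof (rule expectation_pmf_cong)
    fix s assume s: "s \<in> set_pmf ?P"
    then have "s \<in> PiE_dflt A dflt (\<lambda>_. set_pmf p)"
      using assms by (simp add: set_Pi_pmf)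
    then have "pmf ?P s = (\<Prod>i\<in>A. pmf p (s i))" "\<And>i. i \<in> A \<Longrightarrow> pmf p (s i) \<noteq> 0"
      using assms by (auto simp: pmf_Pi' PiE_dflt_def set_pmf_iff)
    then show "- log 2 (pmf ?P s) = (\<Sum>i\<in>A. - log 2 (pmf p (s i)))"
      using assms ln_prod[of A "\<lambda>i. pmf p (s i)"] by (simp add: log_def sum_negf sum_divide_distrib)
  qed
  also have "\<dots> = (\<Sum>i\<in>A. measure_pmf.expectation ?P (\<lambda>s. - log 2 (pmf p (s i))))"
    by (rule Bochner_Integration.integral_sum) (rule integrable_measure_pmf_finite[OF fin])
  also have "\<dots> = (\<Sum>i\<in>A. ent p)"
  proof (rule sum.cong[OF refl])
    fix i assume "i \<in> A"
    have "measure_pmf.expectation ?P (\<lambda>s. - log 2 (pmf p (s i))) =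
        measure_pmf.expectation (map_pmf (\<lambda>s. s i) ?P) (\<lambda>v. - log 2 (pmf p v))"
      by simp
    also have "\<dots> = ent p"
      using \<open>i \<in> A\<close> assms by (simp only: Pi_pmf_component ent_eq_expectation if_True)
    finally show "measure_pmf.expectation ?P (\<lambda>s. - log 2 (pmf p (s i))) = ent p" .
  qed
  finally show ?thesis by simp
qed

section \<open>Joint laws as two-level mixtures of normalised posteriors\<close>

definition mass :: "real ^ 'a::finite \<Rightarrow> real" where
  "mass v = (\<Sum>a\<in>UNIV. v $ a)"

lemma mass_0 [simp]: "mass 0 = 0"
  by (simp add: mass_def)

lemma mass_zero_imp:
  assumes "\<And>a. 0 \<le> v $ a" "mass v = 0"
  shows "v = 0"
  using assms by (simp add: mass_def sum_nonneg_eq_0_iff vec_eq_iff)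

lemma mass_normalized:
  assumes "\<And>a. 0 \<le> v $ a" "0 < mass v"
  shows "(1 / mass v) *\<^sub>R v \<in> prob_simplex"
  using assms by (simp add: prob_simplex_def mass_def flip: sum_divide_distrib)

context helper_source
begin

text \<open>The columns of \<open>kxy\<close> sum to one only where \<open>pY y\<close> is nonzero
  and vanish elsewhere, hence the support condition on \<open>v\<close>.\<close>

lemma mass_pushX: "(\<And>y. pY y = 0 \<Longrightarrow> v $ y = 0) \<Longrightarrow> mass (pushX v) = mass v"
proof -
  assume v: "\<And>y. pY y = 0 \<Longrightarrow> v $ y = 0"
  have "mass (pushX v) = (\<Sum>y\<in>UNIV. v $ y * (\<Sum>x\<in>UNIV. kxy x y))"
    unfolding mass_def pushX_def by (simp add: sum_distrib_left) (rule sum.swap)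
  also have "\<dots> = mass v"
    unfolding mass_def
  proof (rule sum.cong[OF refl])
    fix y
    show "v $ y * (\<Sum>x\<in>UNIV. kxy x y) = v $ y"
      using v[of y] by (cases "pY y = 0") (simp_all add: kxy_def pY_eq_sum flip: sum_divide_distrib)
  qed
  finally show ?thesis .
qed

lemma pushX_scale: "pushX (c *\<^sub>R v) = c *\<^sub>R pushX v"
  by (simp add: pushX_def vec_eq_iff sum_distrib_left mult_ac)

lemma pushX_nonneg: "(\<And>y. 0 \<le> v $ y) \<Longrightarrow> 0 \<le> pushX v $ x"
  by (auto simp: pushX_def intro!: sum_nonneg)

end

text \<open>The outer weights are the probabilities of \<open>u\<close>, the inner weights those of
  \<open>w\<close> given \<open>u\<close>, and the points are the normalised posteriors;
  \<open>sum_vUW\<close> supplies the consistency condition.\<close>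

lemma (in helper_joint) joint_in_outer_hull:
  "(PY, \<Sum>u\<in>S. equivocation kyz (vU u), cond_mutual_info J X W (\<lambda>s. (U s, Z s)),
     measure_pmf.expectation J (\<lambda>(x,y,z,u,w). d x (xhat u w z))) \<in> convex hull outer_points"
proof -
  let ?a = "\<lambda>u. \<Sum>w\<in>T. equivocation pz (vUW u w)" and ?b = "\<lambda>u. \<Sum>w\<in>T. dist_of (vUW u w) (xhat u w)"
  let ?m = "\<lambda>u. mass (vU u)" and ?n = "\<lambda>u. 1 / mass (vU u)"
  define pt where "pt u = (?n u *\<^sub>R vU u, equivocation kyz (?n u *\<^sub>R vU u),
     equivocation pz (pushX (?n u *\<^sub>R vU u)) - ?n u * ?a u, ?n u * ?b u)" for u
  have m0: "0 \<le> ?m u" if "u \<in> S" for u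
    unfolding mass_def by (intro sum_nonneg vU_nonneg that)
  have inner: "(pushX (?n u *\<^sub>R vU u), ?n u * ?a u, ?n u * ?b u) \<in> convex hull inner_points"
    if u: "u \<in> S" "0 < ?m u" for u
  proof -
    let ?k = "\<lambda>w. 1 / mass (vUW u w)"
    define e where "e w = (?k w *\<^sub>R vUW u w, equivocation pz (?k w *\<^sub>R vUW u w), dist_of (?k w *\<^sub>R vUW u w) (xhat u w))" for w
    have nn: "0 \<le> mass (vUW u w)" for w
      unfolding mass_def by (intro sum_nonneg vUW_nonneg)
    have "(\<Sum>w\<in>T. (?n u * mass (vUW u w)) *\<^sub>R e w) \<in> convex hull inner_points"
    proof (rule convex_sum_support[OF fin(2) convex_convex_hull])
      have "(\<Sum>w\<in>T. mass (vUW u w)) = mass (\<Sum>w\<in>T. vUW u w)"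
        unfolding mass_def by (simp add: sum.swap[of _ UNIV])
      also have "\<dots> = ?m u"
        by (simp add: sum_vUW u mass_pushX vU_def)
      finally show "(\<Sum>w\<in>T. ?n u * mass (vUW u w)) = 1"
        using u by (simp flip: sum_divide_distrib)
    next
      fix w assume "0 < ?n u * mass (vUW u w)"
      then have "0 < mass (vUW u w)"
        using u by (simp add: zero_less_divide_iff)
      then show "e w \<in> convex hull inner_points"
        unfolding e_def inner_points_def
        by (intro hull_inc UN_I[of "xhat u w"] UNIV_I image_eqI[OF refl] mass_normalized vUW_nonneg)
    qed (use u nn in auto)
    moreover have "(?n u * mass (vUW u w)) *\<^sub>R e w =
       (?n u *\<^sub>R vUW u w, ?n u * equivocation pz (vUW u w), ?n u * dist_of (vUW u w) (xhat u w))" for w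
    proof (cases "mass (vUW u w) = 0")
      case True
      then have "vUW u w = 0"
        using vUW_nonneg by (rule mass_zero_imp[rotated])
      then show ?thesis by (simp add: True dist_of_zero zero_prod_def)
    next
      case False
      then show ?thesis
        using nn[of w] by (simp add: e_def equivocation_scale vUW_nonneg dist_of_scale)
    qed
    ultimately show ?thesis
      using u by (simp only: sum_prod sum_vUW[symmetric] pushX_scale sum_distrib_left scaleR_sum_right)
  qed
  have "(\<Sum>u\<in>S. ?m u *\<^sub>R pt u) \<in> convex hull outer_points"
  proof (rule convex_sum_support[OF fin(1) convex_convex_hull])
    have "(\<Sum>u\<in>S. ?m u) = mass (\<Sum>u\<in>S. vU u)"
      unfolding mass_def by (simp add: sum.swap[of _ UNIV])
    also have "\<dots> = 1"
      unfolding sum_vU mass_def PY_def pY_def by (simp add: sum_pmf_eq_1)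
    finally show "(\<Sum>u\<in>S. ?m u) = 1" .
  next
    fix u assume u: "u \<in> S" "0 < ?m u"
    then show "pt u \<in> convex hull outer_points"
      unfolding pt_def outer_points_def using inner[OF u] mass_normalized[OF vU_nonneg]
      by (intro hull_inc) blast
  qed (rule m0)
  also have "(\<Sum>u\<in>S. ?m u *\<^sub>R pt u) =
    (\<Sum>u\<in>S. (vU u, equivocation kyz (vU u), equivocation pz (pushX (vU u)) - ?a u, ?b u))"
  proof (rule sum.cong[OF refl])
    fix u assume u: "u \<in> S"
    show "?m u *\<^sub>R pt u = (vU u, equivocation kyz (vU u), equivocation pz (pushX (vU u)) - ?a u, ?b u)"
    proof (cases "?m u = 0")
      \<comment> \<open>If \<open>u\<close> has probability zero, so has every \<open>(u, w)\<close>
        by \<open>sum_vUW\<close>, and both sides vanish.\<close>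
      case True
      then have vU0: "vU u = 0"
        using vU_nonneg[OF u] by (rule mass_zero_imp[rotated])
      then have "(\<Sum>w\<in>T. vUW u w $ x) = 0" for x
        using sum_vUW[OF u] by (simp add: pushX_def vec_eq_iff)
      then have "vUW u w = 0" if "w \<in> T" for w
        using that fin(2) vUW_nonneg by (simp add: sum_nonneg_eq_0_iff vec_eq_iff)
      then show ?thesis
        using vU0 by (simp add: True dist_of_zero pushX_def zero_vec_def[symmetric] zero_prod_def)
    next
      case False
      with m0[OF u] have "0 < ?m u" by simp
      then show ?thesis
        by (simp add: pt_def equivocation_scale vU_nonneg[OF u] pushX_scale pushX_nonneg right_diff_distrib)
    qed
  qed
  also have "\<dots> = (PY, \<Sum>u\<in>S. equivocation kyz (vU u), cond_mutual_info J X W (\<lambda>s. (U s, Z s)),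
     measure_pmf.expectation J (\<lambda>(x,y,z,u,w). d x (xhat u w z)))"
    by (simp add: sum_prod sum_vU cond_mutual_info_XW expectation_distortion)
  finally show ?thesis .
qed


section \<open>Single-letterisation of a block code\<close>

lemma finite_src_block: 
  fixes pxy :: "('x::finite \<times> 'y::finite) pmf" and pzx :: "'x \<Rightarrow> 'z::finite pmf"
  shows "finite (set_pmf (src_block pxy pzx n))"
  unfolding src_block_def by (auto simp: set_Pi_pmf)

lemma src_block_outside:
  "s \<in> set_pmf (src_block pxy pzx n) \<Longrightarrow> \<not> i < n \<Longrightarrow> s i = undefined"
  using set_Pi_pmf_subset[of "{..<n}" undefined] unfolding src_block_def by fastforce

locale helper_code = helper_source pxy pzx d
  for pxy :: "('x::finite \<times> 'y::finite) pmf" and pzx :: "'x \<Rightarrow> 'z::finite pmf"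
    and d :: "'x \<Rightarrow> 'xh::finite \<Rightarrow> real" +
  fixes n M1 M :: nat and f1 :: "(nat \<Rightarrow> 'y) \<Rightarrow> nat" and f :: "(nat \<Rightarrow> 'x) \<Rightarrow> nat \<Rightarrow> nat"
    and g :: "nat \<Rightarrow> nat \<Rightarrow> (nat \<Rightarrow> 'z) \<Rightarrow> nat \<Rightarrow> 'xh"
  assumes n_pos: "0 < n"
    and f1_range: "\<And>ys. f1 ys \<in> {1..M1}"
    and f_range: "\<And>xs t1. f xs t1 \<in> {1..M}"
begin

abbreviation "B \<equiv> src_block pxy pzx n"
abbreviation "xs s \<equiv> (\<lambda>i::nat. fst (s i :: 'x \<times> 'y \<times> 'z))"
abbreviation "ys s \<equiv> (\<lambda>i::nat. fst (snd (s i :: 'x \<times> 'y \<times> 'z)))"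
abbreviation "zs s \<equiv> (\<lambda>i::nat. snd (snd (s i :: 'x \<times> 'y \<times> 'z)))"
abbreviation "T1 s \<equiv> f1 (ys s)"
abbreviation "T2 s \<equiv> f (xs s) (T1 s)"
abbreviation "H \<equiv> entropy_of B"

text \<open>Three demands fix this choice. It reads letter \<open>i\<close> only through
  \<open>Y_i\<close>, and only via \<open>T1\<close>; together with \<open>T\<close> and
  \<open>Z_i\<close> it contains everything the decoder sees; and the past of \<open>X\<close> makes
  the chain rules telescope. Masked positions are \<open>undefined\<close>, so they carry no
  information.\<close>

definition Ui :: "nat \<Rightarrow> (nat \<Rightarrow> 'x \<times> 'y \<times> 'z) \<Rightarrow> nat \<times> (nat \<Rightarrow> 'x) \<times> (nat \<Rightarrow> 'z)" where
  "Ui i s = (T1 s, (\<lambda>j. if j < i then xs s j else undefined), (\<lambda>j. if j = i then undefined else zs s j))"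

definition rest :: "nat \<Rightarrow> (nat \<Rightarrow> 'x \<times> 'y \<times> 'z) pmf" where
  "rest i = Pi_pmf ({..<n} - {i}) undefined (\<lambda>_. src_pmf pxy pzx)"

text \<open>The other letters are drawn afresh, independently of letter \<open>i\<close>. The slot
  of \<open>Z_i\<close> may hold \<open>undefined\<close>, since neither \<open>Ui i\<close> nor
  \<open>T2\<close> reads it.\<close>

definition \<kappa>i :: "nat \<Rightarrow> 'x \<Rightarrow> 'y \<Rightarrow> ((nat \<times> (nat \<Rightarrow> 'x) \<times> (nat \<Rightarrow> 'z)) \<times> nat) pmf" where
  "\<kappa>i i x y = map_pmf (\<lambda>r. (Ui i (r(i := (x, y, undefined))), T2 (r(i := (x, y, undefined))))) (rest i)"

definition xhat_i :: "nat \<Rightarrow> nat \<times> (nat \<Rightarrow> 'x) \<times> (nat \<Rightarrow> 'z) \<Rightarrow> nat \<Rightarrow> 'z \<Rightarrow> 'xh" where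
  "xhat_i i u w z = g w (fst u) (\<lambda>j. if j = i then z else snd (snd u) j) i"

lemma finB: "finite (set_pmf B)"
  by (rule finite_src_block)

text \<open>The deterministic core of the Markov chain \<open>U_i - Y_i - (X_i, Z_i)\<close>: with
  the other letters frozen, only the \<open>y\<close> at position \<open>i\<close> matters. It
  yields \<open>marg\<close> for \<open>\<kappa>i i\<close>.\<close>

lemma Ui_update: "Ui i (r(i := (x, y, z))) = Ui i (r(i := (x', y, z')))"
proof -
  have "ys (r(i := (x, y, z))) = ys (r(i := (x', y, z')))"
    by (auto simp: fun_eq_iff)
  moreover have "(\<lambda>j. if j < i then xs (r(i := (x, y, z))) j else undefined) =
      (\<lambda>j. if j < i then xs (r(i := (x', y, z'))) j else undefined)"
    "(\<lambda>j. if j = i then undefined else zs (r(i := (x, y, z))) j) =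
      (\<lambda>j. if j = i then undefined else zs (r(i := (x', y, z'))) j)"
    by (auto simp: fun_eq_iff)
  ultimately show ?thesis unfolding Ui_def by metis
qed

lemma T2_update: "T2 (r(i := (x, y, z))) = T2 (r(i := (x, y, z')))"
proof -
  have "ys (r(i := (x, y, z))) = ys (r(i := (x, y, z')))" "xs (r(i := (x, y, z))) = xs (r(i := (x, y, z')))"
    by (auto simp: fun_eq_iff)
  then show ?thesis by metis
qed

lemma joint_\<kappa>i:
  assumes i: "i < n"
  shows "joint (\<kappa>i i) = map_pmf (\<lambda>s. (xs s i, ys s i, zs s i, Ui i s, T2 s)) B"
proof -
  have ins: "{..<n} = insert i ({..<n} - {i})"
    using i by auto
  have "B = do { v \<leftarrow> src_pmf pxy pzx; r \<leftarrow> rest i; return_pmf (r(i := v)) }"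
    unfolding src_block_def rest_def by (subst ins, subst Pi_pmf_insert') auto
  also have "\<dots> = do { (x,y) \<leftarrow> pxy; z \<leftarrow> pzx x; r \<leftarrow> rest i; return_pmf (r(i := (x,y,z))) }"
    by (simp add: src_pmf_def bind_assoc_pmf bind_return_pmf case_prod_unfold)
  finally have B: "B = do { (x,y) \<leftarrow> pxy; z \<leftarrow> pzx x; r \<leftarrow> rest i; return_pmf (r(i := (x,y,z))) }" .
  have "map_pmf (\<lambda>s. (xs s i, ys s i, zs s i, Ui i s, T2 s)) B =
    do { (x,y) \<leftarrow> pxy; z \<leftarrow> pzx x; r \<leftarrow> rest i;
         return_pmf (x, y, z, Ui i (r(i := (x,y,z))), T2 (r(i := (x,y,z)))) }"
    unfolding B by (simp add: map_pmf_def bind_assoc_pmf bind_return_pmf case_prod_unfold)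
  also have "\<dots> = do { (x,y) \<leftarrow> pxy; z \<leftarrow> pzx x; r \<leftarrow> rest i;
         return_pmf (x, y, z, Ui i (r(i := (x,y,undefined))), T2 (r(i := (x,y,undefined)))) }"
  proof -
    have "(x, y, z, Ui i (r(i := (x,y,z))), T2 (r(i := (x,y,z)))) =
      (x, y, z, Ui i (r(i := (x,y,undefined))), T2 (r(i := (x,y,undefined))))" for x y z r
      by (simp only: Ui_update[of i r x y z x undefined] T2_update[of r i x y z undefined])
    then show ?thesis by (simp only:)
  qed
  also have "\<dots> = joint (\<kappa>i i)"
    unfolding joint_def \<kappa>i_def by (simp add: map_pmf_def bind_assoc_pmf bind_return_pmf case_prod_unfold)
  finally show ?thesis ..
qed

lemma helper_joint_\<kappa>i:
  "helper_joint d (\<kappa>i i) (\<Union>x. \<Union>y. fst ` set_pmf (\<kappa>i i x y)) (\<Union>x. \<Union>y. snd ` set_pmf (\<kappa>i i x y))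
     (\<lambda>y u. pmf (map_pmf (\<lambda>r. Ui i (r(i := (undefined, y, undefined)))) (rest i)) u)"
proof
  have fin: "finite (set_pmf (\<kappa>i i x y))" for x y
    unfolding \<kappa>i_def rest_def set_map_pmf by (intro finite_imageI) (auto simp: set_Pi_pmf)
  show "finite (\<Union>x. \<Union>y. fst ` set_pmf (\<kappa>i i x y))"
    and finT: "finite (\<Union>x. \<Union>y. snd ` set_pmf (\<kappa>i i x y))"
    using fin by auto
  show "set_pmf (\<kappa>i i x y) \<subseteq> (\<Union>x. \<Union>y. fst ` set_pmf (\<kappa>i i x y)) \<times> (\<Union>x. \<Union>y. snd ` set_pmf (\<kappa>i i x y))" for x y
    by force
  fix x y u
  let ?T = "\<Union>x. \<Union>y. snd ` set_pmf (\<kappa>i i x y)"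
  have "(\<Sum>w\<in>?T. pmf (\<kappa>i i x y) (u, w)) = pmf (map_pmf fst (\<kappa>i i x y)) u"
    by (subst pmf_map_reindex[where I = ?T and e = "Pair u", OF finT])
       (force simp: inj_on_def image_iff)+
  also have "map_pmf fst (\<kappa>i i x y) = map_pmf (\<lambda>r. Ui i (r(i := (undefined, y, undefined)))) (rest i)"
    unfolding \<kappa>i_def pmf.map_comp o_def fst_conv by (subst Ui_update[where x' = undefined and z' = undefined]) (rule refl)
  finally show "(\<Sum>w\<in>?T. pmf (\<kappa>i i x y) (u, w)) =
     pmf (map_pmf (\<lambda>r. Ui i (r(i := (undefined, y, undefined)))) (rest i)) u" .
qed

text \<open>This is H(Y_i | Z_i, U_i), written so that summing over \<open>i\<close> exposes the
  helper's information directly.\<close>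

definition hi :: "nat \<Rightarrow> real" where
  "hi i = equivocation kyz PY - cond_mutual_info B (Ui i) (\<lambda>s. ys s i) (\<lambda>s. zs s i)"

definition I2i :: "nat \<Rightarrow> real" where
  "I2i i = cond_mutual_info B (\<lambda>s. xs s i) T2 (\<lambda>s. (Ui i s, zs s i))"

definition Di :: "nat \<Rightarrow> real" where
  "Di i = measure_pmf.expectation B (\<lambda>s. d (xs s i) (g (T2 s) (T1 s) (zs s) i))"

lemma coordinate_in_outer_hull:
  assumes i: "i < n"
  shows "(PY, hi i, I2i i, Di i) \<in> convex hull outer_points"
proof -
  interpret J: helper_joint pxy pzx d "\<kappa>i i" "\<Union>x. \<Union>y. fst ` set_pmf (\<kappa>i i x y)" "\<Union>x. \<Union>y. snd ` set_pmf (\<kappa>i i x y)"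
     "\<lambda>y u. pmf (map_pmf (\<lambda>r. Ui i (r(i := (undefined, y, undefined)))) (rest i)) u"
    by (rule helper_joint_\<kappa>i)
  note J.joint_in_outer_hull[of "xhat_i i"]
  also have "(\<Sum>u\<in>(\<Union>x. \<Union>y. fst ` set_pmf (\<kappa>i i x y)). equivocation kyz (J.vU u)) = hi i"
    using J.cond_mutual_info_UY unfolding joint_\<kappa>i[OF i] cond_mutual_info_map by (simp add: hi_def)
  also have "cond_mutual_info J.J J.X J.W (\<lambda>s. (J.U s, J.Z s)) = I2i i"
    unfolding joint_\<kappa>i[OF i] cond_mutual_info_map by (simp add: I2i_def)
  also have "measure_pmf.expectation J.J (\<lambda>(x,y,z,u,w). d x (xhat_i i u w z)) = Di i"
  proof -
    have "xhat_i i (Ui i s) (T2 s) (zs s i) = g (T2 s) (T1 s) (zs s) i" for s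
    proof -
      have "(\<lambda>j. if j = i then zs s i else snd (snd (Ui i s)) j) = zs s"
        by (auto simp: Ui_def fun_eq_iff)
      then show ?thesis
        unfolding xhat_i_def by (simp add: Ui_def)
    qed
    then show ?thesis
      unfolding joint_\<kappa>i[OF i] by (simp add: Di_def)
  qed
  finally show ?thesis .
qed

lemma sum_Di: "(\<Sum>i<n. Di i) / n = code_distortion pxy pzx d n f1 f g"
  unfolding Di_def code_distortion_def Let_def
  by (simp add: integrable_measure_pmf_finite[OF finB])

text \<open>The pair \<open>(U_i, Z_i)\<close> is equivalent to \<open>b i\<close>, that is to the
  past of \<open>X\<close>, \<open>T1\<close> and all of \<open>Z^n\<close>. So the terms are those
  of the chain rule for the information between \<open>X^n\<close> and \<open>T\<close> given
  \<open>(T1, Z^n)\<close>, which is at most H(T).\<close>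

lemma sum_I2i: "(\<Sum>i<n. I2i i) \<le> log 2 M"
proof -
  define b where "b k s = ((\<lambda>j. if j < k then xs s j else undefined), T1 s, zs s)" for k s
  have "I2i i = H (b (Suc i)) - H (b i) - (H (\<lambda>s. (T2 s, b (Suc i) s)) - H (\<lambda>s. (T2 s, b i s)))" for i
  proof -
    have z: "(\<lambda>j. if j = i then undefined else zs s j) = (\<lambda>j. if j = i then undefined else zs t j) \<and> zs s i = zs t i
      \<longleftrightarrow> zs s = zs t" for s t
      by (auto simp: fun_eq_iff)
    have x: "(\<lambda>j. if j < Suc i then xs s j else undefined) = (\<lambda>j. if j < Suc i then xs t j else undefined) \<longleftrightarrow>
      (\<lambda>j. if j < i then xs s j else undefined) = (\<lambda>j. if j < i then xs t j else undefined) \<and> xs s i = xs t i" for s t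
      by (auto simp: fun_eq_iff less_Suc_eq)
    have 1: "(Ui i s, zs s i) = (Ui i t, zs t i) \<longleftrightarrow> b i s = b i t" for s t
      unfolding Ui_def b_def prod.inject using z[of s t] by argo
    have 2: "b (Suc i) s = b (Suc i) t \<longleftrightarrow> b i s = b i t \<and> xs s i = xs t i" for s t
      unfolding b_def prod.inject x by argo
    have "H (\<lambda>s. (xs s i, Ui i s, zs s i)) = H (b (Suc i))"
      "H (\<lambda>s. (T2 s, Ui i s, zs s i)) = H (\<lambda>s. (T2 s, b i s))"
      "H (\<lambda>s. (xs s i, T2 s, Ui i s, zs s i)) = H (\<lambda>s. (T2 s, b (Suc i) s))"
      "H (\<lambda>s. (Ui i s, zs s i)) = H (b i)"
      by (rule entropy_of_cong[OF finB]; use 1 2 in blast)+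
    then show ?thesis
      unfolding I2i_def cond_mutual_info_entropy[OF finB] by simp
  qed
  then have "(\<Sum>i<n. I2i i) = (\<Sum>i<n. H (b (Suc i)) - H (b i)) - (\<Sum>i<n. H (\<lambda>s. (T2 s, b (Suc i) s)) - H (\<lambda>s. (T2 s, b i s)))"
    by (simp add: sum_subtractf)
  also have "\<dots> = (H (b n) - H (b 0)) - (H (\<lambda>s. (T2 s, b n s)) - H (\<lambda>s. (T2 s, b 0 s)))"
    using sum_lessThan_telescope[of "\<lambda>i. H (b i)" n]
      sum_lessThan_telescope[of "\<lambda>i. H (\<lambda>s. (T2 s, b i s))" n] by simp
  also have "\<dots> \<le> H (\<lambda>s. (T2 s, b 0 s)) - H (b 0)"
    using entropy_of_mono[OF finB, of "\<lambda>s. (T2 s, b n s)" "b n"] by simp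
  also have "\<dots> \<le> H T2"
    using entropy_of_subadditive[OF finB, of T2 "b 0"] by simp
  also have "\<dots> \<le> log 2 (card {1..M})"
    by (rule entropy_of_le_log_card[OF finB]) (use f_range in auto)
  finally show ?thesis by simp
qed

text \<open>Data processing replaces \<open>U_i\<close> by \<open>pre i\<close>, which also holds
  the past of \<open>Y\<close>, and \<open>Y_i\<close> by \<open>(X_i, Y_i)\<close>. The terms
  telescope to H(T1, Z^n) minus the entropy of the whole block. By independence the latter cancels
  the sum of the letter entropies, and subadditivity for \<open>Z^n\<close> leaves at most
  H(T1).\<close>

lemma sum_I1i: "(\<Sum>i<n. cond_mutual_info B (Ui i) (\<lambda>s. ys s i) (\<lambda>s. zs s i)) \<le> log 2 M1"
proof -
  define V where "V i s = (xs s i, ys s i)" for i and s :: "nat \<Rightarrow> 'x \<times> 'y \<times> 'z"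
  define pre where "pre k s = ((\<lambda>j. if j < k then V j s else undefined), T1 s, zs s)" for k s
  define prez where "prez k s = (\<lambda>j. if j < k then zs s j else undefined)" for k :: nat and s
  have step: "cond_mutual_info B (Ui i) (\<lambda>s. ys s i) (\<lambda>s. zs s i)
      \<le> H (\<lambda>s. s i) - H (\<lambda>s. zs s i) - (H (pre (Suc i)) - H (pre i))" for i
  proof -
    have p: "pre (Suc i) s = pre (Suc i) t \<longleftrightarrow> V i s = V i t \<and> pre i s = pre i t" for s t
      by (auto simp: pre_def fun_eq_iff less_Suc_eq)
    have UZ: "Ui i s = Ui i t \<and> zs s i = zs t i" if "pre i s = pre i t" for s t
    proof -
      have eq: "T1 s = T1 t" "\<And>j. zs s j = zs t j" "\<And>j. j < i \<Longrightarrow> xs s j = xs t j"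
        using that by (auto simp: pre_def V_def fun_eq_iff split: if_splits)
      then have "(\<lambda>j. if j < i then xs s j else undefined) = (\<lambda>j. if j < i then xs t j else undefined)"
        by (auto simp: fun_eq_iff)
      then show ?thesis unfolding Ui_def prod.inject by (simp only: eq simp_thms)
    qed
    have "cond_mutual_info B (Ui i) (\<lambda>s. ys s i) (\<lambda>s. zs s i) \<le> H (\<lambda>s. (V i s, zs s i)) - H (\<lambda>s. zs s i)
       - (H (\<lambda>s. (V i s, pre i s)) - H (pre i))"
      by (rule cond_mutual_info_data_processing[OF finB]) (simp add: V_def, rule UZ)
    moreover have "H (\<lambda>s. (V i s, zs s i)) = H (\<lambda>s. s i)"
      by (rule entropy_of_cong[OF finB]) (auto simp: V_def prod_eq_iff)
    moreover have "H (\<lambda>s. (V i s, pre i s)) = H (pre (Suc i))"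
      by (rule entropy_of_cong[OF finB]) (simp add: p)
    ultimately show ?thesis by simp
  qed
  have "H (prez k) \<le> (\<Sum>i<k. H (\<lambda>s. zs s i))" for k
  proof (induction k)
    case 0
    have "H (prez 0) = H (\<lambda>_. ())"
      by (rule entropy_of_cong[OF finB]) (simp add: prez_def)
    then show ?case by simp
  next
    case (Suc k)
    have "H (prez (Suc k)) = H (\<lambda>s. (prez k s, zs s k))"
      by (rule entropy_of_cong[OF finB]) (auto simp: prez_def fun_eq_iff less_Suc_eq)
    then show ?case
      using Suc entropy_of_subadditive[OF finB, of "prez k" "\<lambda>s. zs s k"] by simp
  qed
  note prez = this[of n]
  have out: "s j = t j" if "s \<in> set_pmf B" "t \<in> set_pmf B" "\<not> j < n" for s t j
    using src_block_outside[OF that(1,3)] src_block_outside[OF that(2,3)] by simp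
  have zs_prez: "H zs = H (prez n)"
  proof (rule entropy_of_cong[OF finB])
    fix s t assume st: "s \<in> set_pmf B" "t \<in> set_pmf B"
    show "zs s = zs t \<longleftrightarrow> prez n s = prez n t"
      using out[OF st] by (auto simp: prez_def fun_eq_iff) metis
  qed
  have all: "H (pre n) = H (\<lambda>s. s)"
  proof (rule entropy_of_cong[OF finB])
    fix s t assume st: "s \<in> set_pmf B" "t \<in> set_pmf B"
    show "pre n s = pre n t \<longleftrightarrow> s = t"
    proof
      assume *: "pre n s = pre n t"
      show "s = t"
      proof
        fix j
        show "s j = t j"
        proof (cases "j < n")
          case True
          then have "V j s = V j t" "zs s j = zs t j"
            using * by (auto simp: pre_def fun_eq_iff split: if_splits)
          then show ?thesis by (simp add: V_def prod_eq_iff)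
        qed (use out[OF st] in auto)
      qed
    qed simp
  qed
  have "H (\<lambda>s. s) = n * ent (src_pmf pxy pzx)"
    by (simp add: entropy_of_def src_block_def ent_Pi_pmf)
  also have "\<dots> = (\<Sum>i<n. H (\<lambda>s. s i))"
    by (simp add: entropy_of_def src_block_def Pi_pmf_component)
  finally have Hs: "H (\<lambda>s. s) = (\<Sum>i<n. H (\<lambda>s. s i))" .
  have pre0: "H (pre 0) = H (\<lambda>s. (T1 s, zs s))"
    by (rule entropy_of_cong[OF finB]) (simp add: pre_def)
  have "(\<Sum>i<n. cond_mutual_info B (Ui i) (\<lambda>s. ys s i) (\<lambda>s. zs s i)) \<le>
    (\<Sum>i<n. H (\<lambda>s. s i) - H (\<lambda>s. zs s i) - (H (pre (Suc i)) - H (pre i)))"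
    by (intro sum_mono step)
  also have "\<dots> = (\<Sum>i<n. H (\<lambda>s. s i)) - (\<Sum>i<n. H (\<lambda>s. zs s i)) - (H (pre n) - H (pre 0))"
    using sum_lessThan_telescope[of "\<lambda>i. H (pre i)" n] by (simp add: sum_subtractf)
  also have "\<dots> \<le> H T1"
    using prez entropy_of_subadditive[OF finB, of T1 zs] by (simp add: all Hs pre0 zs_prez)
  also have "\<dots> \<le> log 2 (card {1..M1})"
    by (rule entropy_of_le_log_card[OF finB]) (use f1_range in auto)
  finally show ?thesis by simp
qed

text \<open>All coordinates give hull points over the same \<open>PY\<close>, so their uniform
  average is again such a point; this is the time sharing that convexity of the hull
  provides.\<close>

theorem code_in_rate_region:
  "(log 2 M / n, log 2 M1 / n, code_distortion pxy pzx d n f1 f g) \<in> rate_region"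
proof -
  have "(\<Sum>i<n. (1 / n) *\<^sub>R (PY, hi i, I2i i, Di i)) \<in> convex hull outer_points"
    using n_pos by (intro convex_sum coordinate_in_outer_hull) auto
  also have "(\<Sum>i<n. (1 / n) *\<^sub>R (PY, hi i, I2i i, Di i)) =
     (PY, (\<Sum>i<n. hi i) / n, (\<Sum>i<n. I2i i) / n, (\<Sum>i<n. Di i) / n)"
    using n_pos by (simp add: sum_prod sum_divide_distrib sum_constant_scaleR del: sum_constant)
  finally have "(PY, (\<Sum>i<n. hi i) / n, (\<Sum>i<n. I2i i) / n, code_distortion pxy pzx d n f1 f g) \<in> convex hull outer_points"
    by (simp add: sum_Di)
  moreover have "equivocation kyz PY - (\<Sum>i<n. hi i) / n \<le> log 2 M1 / n"
    using sum_I1i n_pos by (simp add: hi_def sum_subtractf field_simps)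
  moreover have "(\<Sum>i<n. I2i i) / n \<le> log 2 M / n"
    using sum_I2i by (simp add: divide_right_mono)
  ultimately show ?thesis
    unfolding rate_region_def by blast
qed

end

section \<open>From codes to the operational region\<close>

lemma log_num_msgs_le:
  assumes "0 < num_msgs n R" "0 < n"
  shows "log 2 (num_msgs n R) / n \<le> R"
proof -
  have "real (num_msgs n R) \<le> 2 powr (real n * R)"
    unfolding num_msgs_def by (simp add: of_nat_nat)
  then have "log 2 (num_msgs n R) \<le> real n * R"
    using assms by (simp add: log_le_iff)
  then show ?thesis
    using assms by (simp add: field_simps)
qed

context helper_source
begin

lemma rate_region_mono:
  "(R, R1, D) \<in> rate_region \<Longrightarrow> R \<le> R' \<Longrightarrow> R1 \<le> R1' \<Longrightarrow> D \<le> D' \<Longrightarrow> (R', R1', D') \<in> rate_region"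
  unfolding rate_region_def by clarsimp (meson order_trans)

text \<open>One block length for each \<open>\<epsilon>\<close> is enough, because the single-letter
  bound holds for every \<open>n\<close>; closedness in the distortion coordinate then removes
  \<open>\<epsilon>\<close>.\<close>

theorem converse:
  assumes "achievable pxy pzx d D R R1"
  shows "(R, R1, D) \<in> rate_region"
proof -
  have mem: "(R, R1, D + \<epsilon>) \<in> rate_region" if "\<epsilon> > 0" for \<epsilon>
  proof -
    obtain N where N: "\<And>n. n \<ge> N \<Longrightarrow> \<exists>f1 f g.
        (\<forall>ys. f1 ys \<in> {1..num_msgs n R1}) \<and>
        (\<forall>xs t1. f xs t1 \<in> {1..num_msgs n R}) \<and>
        code_distortion pxy pzx d n f1 f g \<le> D + \<epsilon>"
      using assms \<open>\<epsilon> > 0\<close> unfolding achievable_def by blast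
    \<comment> \<open>The successor makes \<open>n\<close> positive, as division by \<open>n\<close>
      requires.\<close>
    define n where "n = Suc N"
    obtain f1 f g where c: "\<And>ys. f1 ys \<in> {1..num_msgs n R1}" "\<And>xs t1. f xs t1 \<in> {1..num_msgs n R}"
        "code_distortion pxy pzx d n f1 f g \<le> D + \<epsilon>"
      using N[of n] unfolding n_def by auto
    interpret helper_code pxy pzx d n "num_msgs n R1" "num_msgs n R" f1 f g
      by unfold_locales (use c in \<open>auto simp: n_def\<close>)
    \<comment> \<open>An encoder has a value in each message set, so neither set is empty and the
      logarithms of the counts are meaningful.\<close>
    have "0 < num_msgs n R1" "0 < num_msgs n R"
      using c(1)[of undefined] c(2)[of undefined undefined] by auto
    then show ?thesis
      using n_pos c(3) by (intro rate_region_mono[OF code_in_rate_region] log_num_msgs_le) auto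
  qed
  have "(\<lambda>k. (R, R1, D + 1 / real (Suc k))) \<longlonglongrightarrow> (R, R1, D + 0)"
    by (intro tendsto_intros LIMSEQ_inverse_real_of_nat[unfolded inverse_eq_divide])
  moreover have "(R, R1, D + 1 / real (Suc k)) \<in> rate_region" for k
    by (rule mem) simp
  ultimately show ?thesis
    using closed_sequentially[OF closed_rate_region, of "\<lambda>k. (R, R1, D + 1 / real (Suc k))"] by simp
qed

theorem operational_region_subset:
  "operational_region pxy pzx d D \<subseteq> single_letter_region pxy pzx d D"
proof -
  let ?C = "{(R, R1). (R, R1, D) \<in> rate_region}"
  have "closed ((\<lambda>p. (fst p, snd p, D)) -` rate_region)"
    by (intro closed_vimage closed_rate_region continuous_intros)
  also have "(\<lambda>p. (fst p, snd p, D)) -` rate_region = ?C"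
    by auto
  finally have "closure {(R, R1). achievable pxy pzx d D R R1} \<subseteq> ?C"
    using converse by (intro closure_minimal) auto
  also have "?C \<subseteq> single_letter_region pxy pzx d D"
    using rate_region_subset by auto
  finally show ?thesis
    unfolding operational_region_def .
qed

end

section \<open>Poisson matching\<close>

definition exp_clock :: "real measure" where
  "exp_clock = density lborel (exponential_density 1)"

lemma prob_space_exp_clock: "prob_space exp_clock"
  unfolding exp_clock_def by (rule prob_space_exponential_density) simp

lemma sets_exp_clock [measurable_cong, simp]: "sets exp_clock = sets borel"
  by (simp add: exp_clock_def)

lemma space_exp_clock [simp]: "space exp_clock = UNIV"
  by (simp add: exp_clock_def)

lemma emeasure_exp_clock_gt:
  assumes "0 \<le> a"
  shows "emeasure exp_clock {a<..} = ennreal (exp (- a))"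
proof -
  interpret prob_space exp_clock by (rule prob_space_exp_clock)
  have "distributed exp_clock lborel (\<lambda>x. x) (exponential_density 1)"
    unfolding distributed_def exp_clock_def
    by (auto simp: distr_id2)
  from exponential_distributedD_gt[OF this assms]
  show ?thesis
    by (simp add: emeasure_eq_measure greaterThan_def)
qed

lemma product_sigma_finite_exp_clock: "product_sigma_finite (\<lambda>_. exp_clock)"
proof -
  interpret prob_space exp_clock by (rule prob_space_exp_clock)
  show ?thesis
    unfolding product_sigma_finite_def by (intro allI sigma_finite_measure_axioms)
qed

text \<open>Given \<open>e i = t\<close>, the other clocks exceed their thresholds with probability
  \<open>exp (- C * t)\<close>, where \<open>C\<close> is the sum of the \<open>c j\<close>. The
  condition \<open>0 \<le> e i\<close> restricts the line to the half-line that carries the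
  clock.\<close>

lemma exponential_race:
  assumes "finite I" "i \<in> I" and c: "\<And>j. j \<in> I - {i} \<Longrightarrow> 0 \<le> c j"
  shows "measure (PiM I (\<lambda>_. exp_clock))
      {e \<in> space (PiM I (\<lambda>_. exp_clock)). 0 \<le> e i \<and> (\<forall>j\<in>I - {i}. c j * e i < e j)}
    = 1 / (1 + (\<Sum>j\<in>I - {i}. c j))"
proof -
  interpret product_sigma_finite "\<lambda>_. exp_clock" by (rule product_sigma_finite_exp_clock)
  define I' where "I' = I - {i}"
  have I: "I = insert i I'" "finite I'" "i \<notin> I'" and c': "\<And>j. j \<in> I' \<Longrightarrow> 0 \<le> c j"
    using assms by (auto simp: I'_def)
  define C where "C = (\<Sum>j\<in>I'. c j)"
  have C: "0 \<le> C"
    unfolding C_def using c' by (intro sum_nonneg)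
  let ?M = "PiM (insert i I') (\<lambda>_. exp_clock)"
  let ?A = "{e \<in> space ?M. 0 \<le> e i \<and> (\<forall>j\<in>I'. c j * e i < e j)}"
  have comp: "(\<lambda>e. e j) \<in> borel_measurable ?M" if "j \<in> insert i I'" for j
    using measurable_component_singleton[OF that, of "\<lambda>_. exp_clock"]
      measurable_cong_sets[OF refl sets_exp_clock] by blast
  have A: "?A \<in> sets ?M"
    using comp I(2) by (intro sets.sets_Collect_conj sets.sets_Collect_finite_All borel_measurable_le
        borel_measurable_less borel_measurable_times borel_measurable_const) auto
  have "emeasure ?M ?A = (\<integral>\<^sup>+ e. indicator ?A e \<partial>?M)"
    using A by simp
  also have "\<dots> = (\<integral>\<^sup>+ t. (\<integral>\<^sup>+ e. indicator ?A (e(i := t)) \<partial>PiM I' (\<lambda>_. exp_clock)) \<partial>exp_clock)"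
    using I A by (intro product_nn_integral_insert_rev) auto
  also have "\<dots> = (\<integral>\<^sup>+ t. indicator {0..} t * ennreal (exp (- (C * t))) \<partial>exp_clock)"
  proof (rule nn_integral_cong)
    fix t :: real
    have "(\<integral>\<^sup>+ e. indicator ?A (e(i := t)) \<partial>PiM I' (\<lambda>_. exp_clock)) =
        (\<integral>\<^sup>+ e. indicator {0..} t * indicator (Pi\<^sub>E I' (\<lambda>j. {c j * t<..})) e \<partial>PiM I' (\<lambda>_. exp_clock))"
      using I by (intro nn_integral_cong)
         (auto simp: indicator_def space_PiM PiE_iff extensional_def fun_upd_apply split: if_splits)
    also have "\<dots> = indicator {0..} t * emeasure (PiM I' (\<lambda>_. exp_clock)) (Pi\<^sub>E I' (\<lambda>j. {c j * t<..}))"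
      using I(2) by (subst nn_integral_cmult_indicator) (auto intro!: sets_PiM_I_finite)
    also have "\<dots> = indicator {0..} t * (\<Prod>j\<in>I'. emeasure exp_clock {c j * t<..})"
      using I(2) by (subst emeasure_PiM) auto
    also have "\<dots> = indicator {0..} t * ennreal (exp (- (C * t)))"
    proof (cases "0 \<le> t")
      case True
      have "(\<Prod>j\<in>I'. emeasure exp_clock {c j * t<..}) = (\<Prod>j\<in>I'. ennreal (exp (- (c j * t))))"
        using True c' by (intro prod.cong) (auto simp: emeasure_exp_clock_gt)
      also have "\<dots> = ennreal (exp (- (C * t)))"
        using I(2) by (subst prod_ennreal) (auto simp: C_def sum_distrib_right sum_negf simp flip: exp_sum)
      finally show ?thesis by simp
    qed simp
    finally show "(\<integral>\<^sup>+ e. indicator ?A (e(i := t)) \<partial>PiM I' (\<lambda>_. exp_clock)) =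
       indicator {0..} t * ennreal (exp (- (C * t)))" .
  qed
  also have "\<dots> = (\<integral>\<^sup>+ t. ennreal (exponential_density 1 t) * (indicator {0..} t * ennreal (exp (- (C * t)))) \<partial>lborel)"
    unfolding exp_clock_def by (subst nn_integral_density) auto
  \<comment> \<open>Up to the factor \<open>1 / (1 + C)\<close> the integrand is the exponential
    density of rate \<open>1 + C\<close>.\<close>
  also have "\<dots> = (\<integral>\<^sup>+ t. ennreal (1 / (1 + C)) * ennreal (exponential_density (1 + C) t) \<partial>lborel)"
  proof (rule nn_integral_cong)
    fix t
    show "ennreal (exponential_density 1 t) * (indicator {0..} t * ennreal (exp (- (C * t)))) =
      ennreal (1 / (1 + C)) * ennreal (exponential_density (1 + C) t)"
    proof (cases "0 \<le> t")
      case True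
      have "exp (- t) * exp (- (C * t)) = exp (- t * (1 + C))"
        by (simp add: algebra_simps flip: exp_add)
      also have "\<dots> = 1 / (1 + C) * ((1 + C) * exp (- t * (1 + C)))"
        using C by simp
      finally show ?thesis
        using True C by (simp add: exponential_density_def flip: ennreal_mult)
    qed (simp add: exponential_density_def)
  qed
  also have "\<dots> = ennreal (1 / (1 + C)) * (\<integral>\<^sup>+ t. ennreal (exponential_density (1 + C) t) \<partial>lborel)"
    by (rule nn_integral_cmult) simp
  also have "(\<integral>\<^sup>+ t. ennreal (exponential_density (1 + C) t) \<partial>lborel) = 1"
  proof -
    interpret prob_space "density lborel (exponential_density (1 + C))"
      using C by (intro prob_space_exponential_density) simp
    show ?thesis
      using emeasure_space_1 by (simp add: emeasure_density)
  qed
  finally have "emeasure ?M ?A = ennreal (1 / (1 + C))"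
    by simp
  then have "measure ?M ?A = 1 / (1 + C)"
    using C by (simp add: measure_def)
  then show ?thesis
    unfolding C_def I'_def using assms(2) by (simp add: insert_absorb)
qed

text \<open>Leaves the continuous clock space: only the finitely many possible selections matter
  afterwards, so all later averaging is over a finitely supported law.\<close>

lemma ex_pmf_of_finite_rv:
  assumes "prob_space M" "finite S" "\<And>e. e \<in> space M \<Longrightarrow> \<sigma> e \<in> S"
    and meas: "\<And>s. s \<in> S \<Longrightarrow> {e \<in> space M. \<sigma> e = s} \<in> sets M"
  shows "\<exists>\<mu>. set_pmf \<mu> \<subseteq> S \<and> (\<forall>\<Phi>. measure_pmf.prob \<mu> {s. \<Phi> s} = measure M {e \<in> space M. \<Phi> (\<sigma> e)})"
proof -
  interpret prob_space M by fact
  have union: "(\<Sum>s\<in>{s\<in>S. \<Phi> s}. prob {e \<in> space M. \<sigma> e = s}) = prob {e \<in> space M. \<Phi> (\<sigma> e)}" for \<Phi>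
  proof -
    have "(\<Sum>s\<in>{s\<in>S. \<Phi> s}. prob {e \<in> space M. \<sigma> e = s}) = prob (\<Union>s\<in>{s\<in>S. \<Phi> s}. {e \<in> space M. \<sigma> e = s})"
      using assms(2) meas by (intro finite_measure_finite_Union[symmetric]) (auto simp: disjoint_family_on_def)
    also have "(\<Union>s\<in>{s\<in>S. \<Phi> s}. {e \<in> space M. \<sigma> e = s}) = {e \<in> space M. \<Phi> (\<sigma> e)}"
      using assms(3) by auto
    finally show ?thesis .
  qed
  have "(\<Sum>s\<in>S. prob {e \<in> space M. \<sigma> e = s}) = 1"
    using union[of "\<lambda>_. True"] prob_space by simp
  then obtain \<mu> where \<mu>: "\<And>s. pmf \<mu> s = (if s \<in> S then prob {e \<in> space M. \<sigma> e = s} else 0)"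
    using ex_pmf_weights[OF assms(2), of "\<lambda>s. prob {e \<in> space M. \<sigma> e = s}"] by auto
  have supp: "set_pmf \<mu> \<subseteq> S"
    by (auto simp: set_pmf_iff \<mu> split: if_splits)
  have "measure_pmf.prob \<mu> {s. \<Phi> s} = prob {e \<in> space M. \<Phi> (\<sigma> e)}" for \<Phi>
  proof -
    have "measure_pmf.prob \<mu> {s. \<Phi> s} = measure_pmf.prob \<mu> {s\<in>S. \<Phi> s}"
      using supp by (intro measure_pmf.finite_measure_eq_AE) (auto simp: AE_measure_pmf_iff)
    also have "\<dots> = (\<Sum>s\<in>{s\<in>S. \<Phi> s}. pmf \<mu> s)"
      using assms(2) by (intro measure_measure_pmf_finite) auto
    also have "\<dots> = prob {e \<in> space M. \<Phi> (\<sigma> e)}"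
      unfolding union[symmetric] by (intro sum.cong) (auto simp: \<mu>)
    finally show ?thesis .
  qed
  with supp show ?thesis by blast
qed

text \<open>Equal total mass leaves no room for excess. Hence lower bounds from strict wins already
  determine the law of a selector, without an analysis of ties.\<close>

lemma pmf_eq_of_ge:
  assumes "finite I" "set_pmf p \<subseteq> I" "\<And>i. i \<in> I \<Longrightarrow> pmf p i \<le> pmf q i"
  shows "q = p"
proof (rule pmf_eqI)
  fix i
  have out: "pmf p j = 0" if "j \<notin> I" for j
    using assms(2) that by (auto simp: set_pmf_iff)
  have le: "pmf p j \<le> pmf q j" for j
    using assms(3)[of j] out[of j] by (cases "j \<in> I") auto
  have "(\<Sum>j\<in>insert i I. pmf q j) \<le> 1"
    using assms(1) by (subst measure_measure_pmf_finite[symmetric]) auto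
  also have "1 = (\<Sum>j\<in>insert i I. pmf p j)"
    using assms(1,2) by (intro sum_pmf_eq_1[symmetric]) auto
  finally have "(\<Sum>j\<in>insert i I. pmf q j - pmf p j) \<le> 0"
    by (simp only: sum_subtractf diff_le_0_iff_le)
  moreover have "pmf q i - pmf p i \<le> (\<Sum>j\<in>insert i I. pmf q j - pmf p j)"
    using assms(1) le by (intro member_le_sum) auto
  ultimately show "pmf q i = pmf p i"
    using le[of i] by simp
qed

text \<open>The Poisson matching lemma of Li and Anantharam, in its finite form: with independent
  exponential clocks \<open>e j\<close>, the selector for \<open>P\<close> returns the index minimising \<open>e j / pmf P j\<close>.\<close>
theorem poisson_matching:
  fixes PP :: "'i pmf set"
  assumes fin: "finite PP" "\<And>P. P \<in> PP \<Longrightarrow> finite (set_pmf P)"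
  shows "\<exists>\<mu> :: ('i pmf \<Rightarrow> 'i) pmf. finite (set_pmf \<mu>) \<and>
    (\<forall>P\<in>PP. map_pmf (\<lambda>s. s P) \<mu> = P) \<and>
    (\<forall>P\<in>PP. \<forall>Q\<in>PP. \<forall>i. measure_pmf.prob \<mu> {s. s P = i \<and> s Q \<noteq> i}
        \<le> pmf P i * (pmf P i / (pmf P i + pmf Q i)))"
proof -
  define I where "I = (\<Union>P\<in>PP. set_pmf P)"
  have finI: "finite I"
    using fin by (auto simp: I_def)
  let ?M = "PiM I (\<lambda>_. exp_clock)"
  interpret prob_space ?M
    by (intro prob_space_PiM prob_space_exp_clock)
  \<comment> \<open>Cross-multiplied, so that indices of probability zero cause no division;
    strictness makes the winner unique.\<close>
  define win where "win P i = {e \<in> space ?M. 0 \<le> e i \<and> (\<forall>j\<in>I - {i}. e i * pmf P j < e j * pmf P i)}" for P i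
  \<comment> \<open>When nobody wins strictly, the default still lies in the support of
    \<open>P\<close>.\<close>
  define sel where "sel P e = (if \<exists>i\<in>set_pmf P. e \<in> win P i then THE i. i \<in> set_pmf P \<and> e \<in> win P i
      else SOME i. i \<in> set_pmf P)" for P e
  have PI: "set_pmf P \<subseteq> I" if "P \<in> PP" for P
    using that by (auto simp: I_def)
  have comp: "(\<lambda>e. e j) \<in> borel_measurable ?M" if "j \<in> I" for j
    using measurable_component_singleton[OF that, of "\<lambda>_. exp_clock"]
      measurable_cong_sets[OF refl sets_exp_clock] by blast
  have win_sets: "win P i \<in> events" if "i \<in> I" for P i
    unfolding win_def using comp finI that
    by (intro sets.sets_Collect_conj sets.sets_Collect_finite_All borel_measurable_le
        borel_measurable_less borel_measurable_times borel_measurable_const) auto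
  have uniq: "i = j" if "P \<in> PP" "i \<in> set_pmf P" "j \<in> set_pmf P" "e \<in> win P i" "e \<in> win P j" for P i j e
  proof (rule ccontr)
    assume "i \<noteq> j"
    with that PI[of P] have "e i * pmf P j < e j * pmf P i" "e j * pmf P i < e i * pmf P j"
      by (auto simp: win_def)
    then show False by simp
  qed
  have sel_win: "sel P e = i" if "P \<in> PP" "i \<in> set_pmf P" "e \<in> win P i" for P e i
  proof -
    have "(THE i. i \<in> set_pmf P \<and> e \<in> win P i) = i"
      using that uniq by (intro the_equality) auto
    with that show ?thesis
      unfolding sel_def by auto
  qed
  have sel_in: "sel P e \<in> set_pmf P" if "P \<in> PP" for P e
  proof (cases "\<exists>i\<in>set_pmf P. e \<in> win P i")
    case True
    then obtain i where "i \<in> set_pmf P" "e \<in> win P i" by blast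
    with sel_win[OF that this] show ?thesis by simp
  next
    case False
    then have "sel P e = (SOME i. i \<in> set_pmf P)"
      unfolding sel_def by (rule if_not_P)
    then show ?thesis
      using set_pmf_not_empty[of P] some_in_eq[of "set_pmf P"] by simp
  qed
  have sel_sets: "{e \<in> space ?M. sel P e = i} \<in> events" if P: "P \<in> PP" for P i
  proof -
    let ?none = "{e \<in> space ?M. \<not> (\<exists>i\<in>set_pmf P. e \<in> win P i)}"
    have "?none = space ?M - (\<Union>i\<in>set_pmf P. win P i)"
      by auto
    also have "\<dots> \<in> events"
      using win_sets PI[OF P] fin(2)[OF P] by (intro sets.Diff sets.top sets.finite_UN) auto
    finally have none: "?none \<in> events" .
    have "{e \<in> space ?M. sel P e = i} = (if i \<in> set_pmf P then win P i else {}) \<union>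
        (if i = (SOME i. i \<in> set_pmf P) then ?none else {})"
    proof (intro set_eqI iffI)
      fix e assume e: "e \<in> {e \<in> space ?M. sel P e = i}"
      show "e \<in> (if i \<in> set_pmf P then win P i else {}) \<union> (if i = (SOME i. i \<in> set_pmf P) then ?none else {})"
      proof (cases "\<exists>j\<in>set_pmf P. e \<in> win P j")
        case True
        then obtain j where "j \<in> set_pmf P" "e \<in> win P j" by blast
        with sel_win[OF P this] e show ?thesis by auto
      next
        case False
        with e have "i = (SOME i. i \<in> set_pmf P)"
          unfolding sel_def by auto
        with False e show ?thesis by auto
      qed
    next
      fix e assume e: "e \<in> (if i \<in> set_pmf P then win P i else {}) \<union> (if i = (SOME i. i \<in> set_pmf P) then ?none else {})"
      then have "e \<in> space ?M"
        by (auto simp: win_def split: if_splits)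
      moreover have "sel P e = i"
      proof (cases "i \<in> set_pmf P \<and> e \<in> win P i")
        case True
        then show ?thesis using sel_win[OF P] by blast
      next
        case False
        with e have "i = (SOME i. i \<in> set_pmf P)" "e \<in> ?none"
          by (auto split: if_splits)
        then show ?thesis unfolding sel_def by auto
      qed
      ultimately show "e \<in> {e \<in> space ?M. sel P e = i}" by simp
    qed
    with none win_sets PI[OF P] show ?thesis
      by (auto split: if_splits)
  qed
  \<comment> \<open>Records the selections of all members of \<open>PP\<close> from the same clocks;
    their coupling is the point of the construction.\<close>
  define \<sigma> where "\<sigma> e = (\<lambda>P. if P \<in> PP then sel P e else undefined)" for e
  let ?S = "PiE_dflt PP undefined set_pmf"
  have "\<exists>\<mu>. set_pmf \<mu> \<subseteq> ?S \<and> (\<forall>\<Phi>. measure_pmf.prob \<mu> {s. \<Phi> s} = prob {e \<in> space ?M. \<Phi> (\<sigma> e)})"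
  proof (rule ex_pmf_of_finite_rv)
    show "finite ?S" using fin by auto
    show "\<sigma> e \<in> ?S" for e
      using sel_in by (auto simp: \<sigma>_def PiE_dflt_def)
    fix s assume s: "s \<in> ?S"
    have "{e \<in> space ?M. \<sigma> e = s} = {e \<in> space ?M. \<forall>P\<in>PP. sel P e = s P}"
      using s by (auto simp: \<sigma>_def PiE_dflt_def fun_eq_iff)
    also have "\<dots> \<in> events"
      using fin(1) sel_sets by (intro sets.sets_Collect_finite_All) auto
    finally show "{e \<in> space ?M. \<sigma> e = s} \<in> events" .
  qed (rule prob_space_axioms)
  then obtain \<mu> where \<mu>S: "set_pmf \<mu> \<subseteq> ?S"
    and \<mu>: "\<And>\<Phi>. measure_pmf.prob \<mu> {s. \<Phi> s} = prob {e \<in> space ?M. \<Phi> (\<sigma> e)}"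
    by blast
  have fin\<mu>: "finite (set_pmf \<mu>)"
    by (rule finite_subset[OF \<mu>S]) (use fin in auto)
  have both: "pmf P i * pmf Q i / (pmf P i + pmf Q i) \<le> measure_pmf.prob \<mu> {s. s P = i \<and> s Q = i}"
    and single: "pmf P i \<le> measure_pmf.prob \<mu> {s. s P = i}"
    if PQ: "P \<in> PP" "Q \<in> PP" and i: "i \<in> set_pmf P" "i \<in> set_pmf Q" for P Q i
  proof -
    have iI: "i \<in> I" and pos: "0 < pmf P i" "0 < pmf Q i"
      using PI PQ i by (auto simp: pmf_positive)
    have sumI: "(\<Sum>j\<in>I - {i}. pmf R j / pmf R i) = (1 - pmf R i) / pmf R i" if "R \<in> PP" "0 < pmf R i" for R
    proof -
      have "(\<Sum>j\<in>I. pmf R j) = 1"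
        using finI PI[OF that(1)] by (intro sum_pmf_eq_1) auto
      then show ?thesis
        using finI iI by (simp add: sum.remove[of I i] flip: sum_divide_distrib)
    qed
    \<comment> \<open>If \<open>c\<close> dominates the likelihood ratios of \<open>P\<close> and of
      \<open>R\<close>, then one race with rates \<open>c\<close> makes \<open>i\<close> win under
      both. Taking \<open>R = P\<close> gives the marginal, \<open>R = Q\<close> the agreement
      probability.\<close>
    have gen: "1 / (1 + (\<Sum>j\<in>I - {i}. c j)) \<le> measure_pmf.prob \<mu> {s. s P = i \<and> s R = i}"
      if R: "R \<in> PP" "0 < pmf R i" and c: "\<And>j. pmf P j / pmf P i \<le> c j" "\<And>j. pmf R j / pmf R i \<le> c j" for R c
    proof -
      have c0: "0 \<le> c j" for j
        by (rule order_trans[OF _ c(1)]) simp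
      have "1 / (1 + (\<Sum>j\<in>I - {i}. c j)) =
        prob {e \<in> space ?M. 0 \<le> e i \<and> (\<forall>j\<in>I - {i}. c j * e i < e j)}"
        using finI iI c0 by (intro exponential_race[symmetric]) auto
      also have "\<dots> \<le> prob {e \<in> space ?M. \<sigma> e P = i \<and> \<sigma> e R = i}"
      proof (rule finite_measure_mono)
        show "{e \<in> space ?M. 0 \<le> e i \<and> (\<forall>j\<in>I - {i}. c j * e i < e j)} \<subseteq> {e \<in> space ?M. \<sigma> e P = i \<and> \<sigma> e R = i}"
        proof safe
          fix e assume e: "e \<in> space ?M" "0 \<le> e i" "\<forall>j\<in>I - {i}. c j * e i < e j"
          have "e \<in> win K i" if K: "0 < pmf K i" "\<And>j. pmf K j / pmf K i \<le> c j" for K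
            unfolding win_def
          proof (intro CollectI conjI ballI e)
            fix j assume j: "j \<in> I - {i}"
            have "pmf K j / pmf K i * e i \<le> c j * e i"
              using K(2) e(2) by (rule mult_right_mono)
            also have "\<dots> < e j" using e(3) j by auto
            finally show "e i * pmf K j < e j * pmf K i"
              using K(1) by (simp add: field_simps)
          qed
          then have "e \<in> win P i" "e \<in> win R i"
            using pos(1) R c by auto
          then show "\<sigma> e P = i" "\<sigma> e R = i"
            using sel_win PQ(1) R pos(1) by (auto simp: \<sigma>_def set_pmf_iff)
        qed
        have "{e \<in> space ?M. \<sigma> e P = i \<and> \<sigma> e R = i} = {e \<in> space ?M. sel P e = i} \<inter> {e \<in> space ?M. sel R e = i}"
          using PQ(1) R(1) by (auto simp: \<sigma>_def)
        then show "{e \<in> space ?M. \<sigma> e P = i \<and> \<sigma> e R = i} \<in> events"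
          using sel_sets[OF PQ(1)] sel_sets[OF R(1)] by auto
      qed
      also have "\<dots> = measure_pmf.prob \<mu> {s. s P = i \<and> s R = i}"
        by (rule \<mu>[symmetric])
      finally show ?thesis .
    qed
    have "pmf P i = 1 / (1 + (\<Sum>j\<in>I - {i}. pmf P j / pmf P i))"
      unfolding sumI[OF PQ(1) pos(1)] using pos(1) by (simp add: diff_divide_distrib)
    also have "\<dots> \<le> measure_pmf.prob \<mu> {s. s P = i \<and> s P = i}"
      by (rule gen) (use PQ pos in auto)
    finally show "pmf P i \<le> measure_pmf.prob \<mu> {s. s P = i}" by simp
    \<comment> \<open>The maximum is the smallest admissible choice; bounding it by the sum and
      dropping a \<open>- 1\<close> yields the harmonic form
      \<open>1 / (1 / pmf P i + 1 / pmf Q i)\<close>.\<close>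
    let ?c = "\<lambda>j. max (pmf P j / pmf P i) (pmf Q j / pmf Q i)"
    have "(\<Sum>j\<in>I - {i}. ?c j) \<le> (\<Sum>j\<in>I - {i}. pmf P j / pmf P i + pmf Q j / pmf Q i)"
      using pos by (intro sum_mono) (auto simp: max_def)
    also have "\<dots> = (1 - pmf P i) / pmf P i + (1 - pmf Q i) / pmf Q i"
      unfolding sum.distrib sumI[OF PQ(1) pos(1)] sumI[OF PQ(2) pos(2)] ..
    finally have "1 + (\<Sum>j\<in>I - {i}. ?c j) \<le> 1 / pmf P i + 1 / pmf Q i"
      using pos by (simp add: diff_divide_distrib)
    moreover have "0 < 1 + (\<Sum>j\<in>I - {i}. ?c j)"
      by (intro add_pos_nonneg sum_nonneg) (auto simp: le_max_iff_disj)
    ultimately have "1 / (1 / pmf P i + 1 / pmf Q i) \<le> 1 / (1 + (\<Sum>j\<in>I - {i}. ?c j))"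
      by (intro divide_left_mono) (use pos in \<open>auto intro!: mult_pos_pos add_pos_pos\<close>)
    also have "\<dots> \<le> measure_pmf.prob \<mu> {s. s P = i \<and> s Q = i}"
      by (rule gen) (use PQ pos in auto)
    also have "1 / (1 / pmf P i + 1 / pmf Q i) = pmf P i * pmf Q i / (pmf P i + pmf Q i)"
      using pos by (simp add: field_simps)
    finally show "pmf P i * pmf Q i / (pmf P i + pmf Q i) \<le> measure_pmf.prob \<mu> {s. s P = i \<and> s Q = i}" .
  qed
  have law: "map_pmf (\<lambda>s. s P) \<mu> = P" if P: "P \<in> PP" for P
  proof (rule pmf_eq_of_ge[OF fin(2)[OF P] order_refl])
    fix i assume "i \<in> set_pmf P"
    from single[OF P P this this] show "pmf P i \<le> pmf (map_pmf (\<lambda>s. s P) \<mu>) i"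
      by (simp add: pmf_map vimage_def)
  qed
  have "measure_pmf.prob \<mu> {s. s P = i \<and> s Q \<noteq> i} \<le> pmf P i * (pmf P i / (pmf P i + pmf Q i))"
    if P: "P \<in> PP" and Q: "Q \<in> PP" for P Q i
  proof -
    have Pi: "measure_pmf.prob \<mu> {s. s P = i} = pmf P i"
      by (subst (2) law[OF P, symmetric]) (simp add: pmf_map vimage_def)
    show ?thesis
    proof (cases "i \<in> set_pmf P \<and> i \<in> set_pmf Q")
      case True
      then have pos: "0 < pmf P i" "0 < pmf Q i" by (auto simp: pmf_positive)
      have "{s. s P = i \<and> s Q \<noteq> i} = {s. s P = i} - {s. s P = i \<and> s Q = i}" by auto
      then have "measure_pmf.prob \<mu> {s. s P = i \<and> s Q \<noteq> i} =
         pmf P i - measure_pmf.prob \<mu> {s. s P = i \<and> s Q = i}"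
        unfolding Pi[symmetric] by (simp add: measure_pmf.finite_measure_Diff Collect_mono_iff)
      also have "\<dots> \<le> pmf P i - pmf P i * pmf Q i / (pmf P i + pmf Q i)"
        using both[OF P Q] True by simp
      also have "\<dots> = pmf P i * (pmf P i / (pmf P i + pmf Q i))"
        using pos by (simp add: field_simps)
      finally show ?thesis .
    next
      case False
      have "measure_pmf.prob \<mu> {s. s P = i \<and> s Q \<noteq> i} \<le> measure_pmf.prob \<mu> {s. s P = i}"
        by (intro measure_pmf.finite_measure_mono) auto
      also have "\<dots> = pmf P i" by (rule Pi)
      also have "\<dots> = pmf P i * (pmf P i / (pmf P i + pmf Q i))"
        using False by (cases "i \<in> set_pmf P") (auto simp: set_pmf_iff)
      finally show ?thesis .
    qed
  qed
  with law fin\<mu> show ?thesis by blast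
qed

section \<open>One-shot coding\<close>

abbreviation \<E> :: "'a pmf \<Rightarrow> ('a \<Rightarrow> real) \<Rightarrow> real" where
  "\<E> \<equiv> \<lambda>p f. measure_pmf.expectation p f"

lemma expectation_pmf_swap:
  assumes "finite (set_pmf p)" "finite (set_pmf q)"
  shows "\<E> p (\<lambda>x. \<E> q (f x)) = \<E> q (\<lambda>y. \<E> p (\<lambda>x. f x y))"
proof -
  have "\<E> p (\<lambda>x. \<E> q (f x)) = (\<Sum>x\<in>set_pmf p. \<Sum>y\<in>set_pmf q. f x y * pmf q y * pmf p x)"
    using assms by (simp add: integral_measure_pmf_real[where A = "set_pmf p"]
        integral_measure_pmf_real[where A = "set_pmf q"] sum_distrib_right)
  also have "\<dots> = (\<Sum>y\<in>set_pmf q. \<Sum>x\<in>set_pmf p. f x y * pmf q y * pmf p x)"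
    by (rule sum.swap)
  also have "\<dots> = \<E> q (\<lambda>y. \<E> p (\<lambda>x. f x y))"
    using assms by (simp add: integral_measure_pmf_real[where A = "set_pmf p"]
        integral_measure_pmf_real[where A = "set_pmf q"] sum_distrib_left sum_distrib_right mult_ac)
  finally show ?thesis .
qed

lemma exists_le_expectation:
  fixes f :: "'a \<Rightarrow> real"
  assumes "finite (set_pmf p)" "\<E> p f \<le> b"
  shows "\<exists>x\<in>set_pmf p. f x \<le> b"
proof (rule ccontr)
  assume "\<not> ?thesis"
  then have *: "b < f x" if "x \<in> set_pmf p" for x
    using that by force
  let ?m = "Min (f ` set_pmf p)"
  have "b < ?m"
    using assms(1) * set_pmf_not_empty[of p] by (subst Min_gr_iff) auto
  also have "?m = \<E> p (\<lambda>_. ?m)"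
    by simp
  also have "\<dots> \<le> \<E> p f"
    using assms(1) by (intro expectation_pmf_mono_finite) auto
  finally show False using assms(2) by simp
qed

lemma expectation_pair_fst:
  "\<E> (pair_pmf p q) (\<lambda>x. f (fst x)) = \<E> p f"
proof -
  have "\<E> (pair_pmf p q) (\<lambda>x. f (fst x)) = \<E> (map_pmf fst (pair_pmf p q)) f"
    by (subst integral_map_pmf) simp
  then show ?thesis by (simp only: map_fst_pair_pmf)
qed

text \<open>With \<open>t = a / b\<close> this is t / (1 + t): the conditional mismatch bound for a
  sender weight \<open>a\<close> and a receiver weight \<open>b\<close>.\<close>

definition miss :: "real \<Rightarrow> real \<Rightarrow> real" where
  "miss a b = a / (a + b)"

definition matched :: "'i pmf set \<Rightarrow> ('i pmf \<Rightarrow> 'i) pmf \<Rightarrow> bool" where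
  "matched PP \<mu> \<longleftrightarrow> finite (set_pmf \<mu>) \<and> (\<forall>P\<in>PP. map_pmf (\<lambda>s. s P) \<mu> = P) \<and>
    (\<forall>P\<in>PP. \<forall>Q\<in>PP. \<forall>i. measure_pmf.prob \<mu> {s. s P = i \<and> s Q \<noteq> i} \<le> pmf P i * miss (pmf P i) (pmf Q i))"

lemma ex_matched:
  "finite PP \<Longrightarrow> (\<And>P. P \<in> PP \<Longrightarrow> finite (set_pmf P)) \<Longrightarrow> \<exists>\<mu>. matched PP \<mu>"
  unfolding matched_def miss_def by (rule poisson_matching)

lemma matched_expectation:
  assumes "matched PP \<mu>" "P \<in> PP"
  shows "\<E> \<mu> (\<lambda>s. f (s P)) = \<E> P f"
proof -
  have "\<E> \<mu> (\<lambda>s. f (s P)) = \<E> (map_pmf (\<lambda>s. s P) \<mu>) f"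
    by simp
  then show ?thesis
    using assms by (simp only: matched_def)
qed

lemma matched_in:
  assumes "matched PP \<mu>" "P \<in> PP" "s \<in> set_pmf \<mu>"
  shows "s P \<in> set_pmf P"
proof -
  have "set_pmf P = (\<lambda>s. s P) ` set_pmf \<mu>"
    using assms(1,2) unfolding matched_def by (metis set_map_pmf)
  with assms(3) show ?thesis by blast
qed

text \<open>The receiver's distribution may depend on the selected index, as it does when that index
  contains the message. Splitting by the selected value fixes \<open>Q i\<close> in each
  term.\<close>

lemma matched_miss:
  assumes "matched PP \<mu>" "P \<in> PP" "finite (set_pmf P)" "\<And>i. i \<in> set_pmf P \<Longrightarrow> Q i \<in> PP"
  shows "\<E> \<mu> (\<lambda>s. of_bool (s (Q (s P)) \<noteq> s P)) \<le> \<E> P (\<lambda>i. miss (pmf P i) (pmf (Q i) i))"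
proof -
  have "\<E> \<mu> (\<lambda>s. of_bool (s (Q (s P)) \<noteq> s P)) = \<E> \<mu> (\<lambda>s. \<Sum>i\<in>set_pmf P. indicator {s. s P = i \<and> s (Q i) \<noteq> i} s)"
  proof (rule expectation_pmf_cong)
    fix s assume s: "s \<in> set_pmf \<mu>"
    have "(\<Sum>i\<in>set_pmf P. indicator {s. s P = i \<and> s (Q i) \<noteq> i} s) =
      (\<Sum>i\<in>set_pmf P. if s P = i then of_bool (s (Q (s P)) \<noteq> s P) else 0 :: real)"
      by (intro sum.cong) (auto simp: indicator_def)
    also have "\<dots> = of_bool (s (Q (s P)) \<noteq> s P)"
      using matched_in[OF assms(1,2) s] assms(3) by (simp add: sum.delta')
    finally show "of_bool (s (Q (s P)) \<noteq> s P) = (\<Sum>i\<in>set_pmf P. indicator {s. s P = i \<and> s (Q i) \<noteq> i} s :: real)" ..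
  qed
  also have "\<dots> = (\<Sum>i\<in>set_pmf P. measure_pmf.prob \<mu> {s. s P = i \<and> s (Q i) \<noteq> i})"
    using assms(1) by (subst Bochner_Integration.integral_sum)
      (auto intro!: integrable_measure_pmf_finite simp: matched_def)
  also have "\<dots> \<le> (\<Sum>i\<in>set_pmf P. pmf P i * miss (pmf P i) (pmf (Q i) i))"
    using assms unfolding matched_def by (intro sum_mono) blast
  also have "\<dots> = \<E> P (\<lambda>i. miss (pmf P i) (pmf (Q i) i))"
    using assms(3) by (subst integral_measure_pmf_real[where A = "set_pmf P"]) (auto simp: mult_ac)
  finally show ?thesis .
qed

text \<open>One-shot code: the helper's selection \<open>(u, m)\<close> is distributed as \<open>pu y\<close> times the uniform law
  on messages, and it sends \<open>m\<close>; whoever knows \<open>m\<close> repeats the selection with its own posterior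
  for \<open>u\<close> concentrated on message \<open>m\<close>, and the matching lemma bounds the probability of disagreement.\<close>
theorem one_shot_code:
  fixes S :: "('a \<times> 'b \<times> 'c) pmf" and pu :: "'b \<Rightarrow> 'u pmf" and pw :: "'a \<Rightarrow> 'u \<Rightarrow> 'w pmf"
    and qx :: "'a \<Rightarrow> 'u pmf" and qz :: "'c \<Rightarrow> 'u pmf" and qw :: "'u \<Rightarrow> 'c \<Rightarrow> 'w pmf"
    and M1 M2 :: nat and cost :: "'a \<Rightarrow> 'r \<Rightarrow> real" and rec :: "'u \<Rightarrow> 'w \<Rightarrow> 'c \<Rightarrow> 'r"
  assumes fS: "finite (set_pmf S)" and fpu: "\<And>y. finite (set_pmf (pu y))" and fpw: "\<And>x u. finite (set_pmf (pw x u))"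
    and fqx: "\<And>x. finite (set_pmf (qx x))" and fqz: "\<And>z. finite (set_pmf (qz z))"
    and fqw: "\<And>u z. finite (set_pmf (qw u z))"
    and M: "1 \<le> M1" "1 \<le> M2" and cost: "\<And>x r. 0 \<le> cost x r" "\<And>x r. cost x r \<le> K"
  shows "\<exists>f1 f g. (\<forall>y. f1 y \<in> {1..M1}) \<and> (\<forall>x t1. f x t1 \<in> {1..M2}) \<and>
    \<E> S (\<lambda>(x,y,z). cost x (g (f x (f1 y)) (f1 y) z)) \<le>
    \<E> S (\<lambda>(x,y,z). \<E> (pu y) (\<lambda>u. \<E> (pw x u) (\<lambda>w. cost x (rec u w z) + K *
       (miss (pmf (pu y) u / M1) (pmf (qx x) u) + miss (pmf (pu y) u / M1) (pmf (qz z) u)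
        + miss (pmf (pw x u) w / M2) (pmf (qw u z) w)))))"
proof -
  have K: "0 \<le> K"
    using cost order_trans by blast
  define Xs Ys Zs where "Xs = fst ` set_pmf S" and "Ys = (fst \<circ> snd) ` set_pmf S" and "Zs = (snd \<circ> snd) ` set_pmf S"
  define Us where "Us = (\<Union>y\<in>Ys. set_pmf (pu y))"
  have fin: "finite Xs" "finite Ys" "finite Zs" "finite Us"
    using fS fpu by (auto simp: Xs_def Ys_def Zs_def Us_def)
  define un1 un2 where "un1 = pmf_of_set {1..M1}" and "un2 = pmf_of_set {1..M2}"
  have un: "set_pmf un1 = {1..M1}" "set_pmf un2 = {1..M2}"
    "\<And>m. m \<in> {1..M1} \<Longrightarrow> pmf un1 m = 1 / M1" "\<And>m. m \<in> {1..M2} \<Longrightarrow> pmf un2 m = 1 / M2"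
    using M by (auto simp: un1_def un2_def)
  \<comment> \<open>The uniform message spreads the sender's weight by \<open>1 / M1\<close>, while
    a receiver knowing \<open>m\<close> puts its whole posterior on that message. This is where the
    division by the message count comes from.\<close>
  define A where "A y = pair_pmf (pu y) un1" for y
  define Qx where "Qx x m = pair_pmf (qx x) (return_pmf m)" for x and m :: nat
  define Qz where "Qz z m = pair_pmf (qz z) (return_pmf m)" for z and m :: nat
  define C where "C x u = pair_pmf (pw x u) un2" for x u
  define Qw where "Qw u z t = pair_pmf (qw u z) (return_pmf t)" for u z and t :: nat
  define PP1 where "PP1 = A ` Ys \<union> case_prod Qx ` (Xs \<times> {1..M1}) \<union> case_prod Qz ` (Zs \<times> {1..M1})"
  define PP2 where "PP2 = case_prod C ` (Xs \<times> Us) \<union> (\<lambda>(u,z,t). Qw u z t) ` (Us \<times> Zs \<times> {1..M2})"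
  have finA: "finite (set_pmf (A y))" and finC: "finite (set_pmf (C x u))" for y x u
    using fpu fpw un by (auto simp: A_def C_def)
  obtain \<mu>1 where \<mu>1: "matched PP1 \<mu>1"
    using ex_matched[of PP1] fin fpu fqx fqz un by (force simp: PP1_def A_def Qx_def Qz_def)
  obtain \<mu>2 where \<mu>2: "matched PP2 \<mu>2"
    using ex_matched[of PP2] fin fpw fqw un by (force simp: PP2_def C_def Qw_def)
  have f\<mu>: "finite (set_pmf \<mu>1)" "finite (set_pmf \<mu>2)"
    using \<mu>1 \<mu>2 by (auto simp: matched_def)
  \<comment> \<open>Encoders must stay in range on all inputs, even impossible ones; on selections
    that occur, \<open>clamp\<close> is the identity.\<close>
  define clamp where "clamp M m = (if m \<in> {1..M} then m else 1)" for M m :: nat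
  define f1 where "f1 s1 y = clamp M1 (snd (s1 (A y)))" for s1 :: "('u \<times> nat) pmf \<Rightarrow> 'u \<times> nat" and y
  define f where "f s1 s2 x m = clamp M2 (snd (s2 (C x (fst (s1 (Qx x m))))))" for s1 :: "('u \<times> nat) pmf \<Rightarrow> 'u \<times> nat" and s2 :: "('w \<times> nat) pmf \<Rightarrow> 'w \<times> nat" and x m
  define g where "g s1 s2 t m z = (let u = fst (s1 (Qz z m)) in rec u (fst (s2 (Qw u z t))) z)" for s1 :: "('u \<times> nat) pmf \<Rightarrow> 'u \<times> nat" and s2 :: "('w \<times> nat) pmf \<Rightarrow> 'w \<times> nat" and t m z
  define val where "val s1 s2 = (\<lambda>(x,y,z). cost x (g s1 s2 (f s1 s2 x (f1 s1 y)) (f1 s1 y) z))" for s1 s2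
  let ?B = "\<lambda>(x,y,z). \<E> (pu y) (\<lambda>u. \<E> (pw x u) (\<lambda>w. cost x (rec u w z) + K *
       (miss (pmf (pu y) u / M1) (pmf (qx x) u) + miss (pmf (pu y) u / M1) (pmf (qz z) u)
        + miss (pmf (pw x u) w / M2) (pmf (qw u z) w))))"
  have main: "\<E> \<mu>1 (\<lambda>s1. \<E> \<mu>2 (\<lambda>s2. val s1 s2 v)) \<le> ?B v" if v: "v \<in> set_pmf S" for v
  proof -
    obtain x y z where xyz: "v = (x, y, z)" by (cases v)
    have mem: "x \<in> Xs" "y \<in> Ys" "z \<in> Zs"
      using v by (force simp: Xs_def Ys_def Zs_def xyz)+
    have A_in: "A y \<in> PP1" and Qx_in: "\<And>m. m \<in> {1..M1} \<Longrightarrow> Qx x m \<in> PP1"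
      and Qz_in: "\<And>m. m \<in> {1..M1} \<Longrightarrow> Qz z m \<in> PP1"
      using mem by (auto simp: PP1_def)
    have C_in: "\<And>u. u \<in> Us \<Longrightarrow> C x u \<in> PP2"
      using mem by (auto simp: PP2_def)
    have Qw_in: "Qw u z t \<in> PP2" if "u \<in> Us" "t \<in> {1..M2}" for u t
      unfolding PP2_def by (rule UnI2, rule image_eqI[of _ _ "(u, z, t)"]) (use mem that in auto)
    define G where "G u = \<E> (pw x u) (\<lambda>w. cost x (rec u w z) + K * miss (pmf (pw x u) w / M2) (pmf (qw u z) w))" for u
    define e1 where "e1 s1 = (of_bool (s1 (Qx x (snd (s1 (A y)))) \<noteq> s1 (A y)) :: real)" for s1 :: "('u \<times> nat) pmf \<Rightarrow> 'u \<times> nat"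
    define e2 where "e2 s1 = (of_bool (s1 (Qz z (snd (s1 (A y)))) \<noteq> s1 (A y)) :: real)" for s1 :: "('u \<times> nat) pmf \<Rightarrow> 'u \<times> nat"
    define e3 where "e3 u s2 = (of_bool (s2 (Qw u z (snd (s2 (C x u)))) \<noteq> s2 (C x u)) :: real)" for u and s2 :: "('w \<times> nat) pmf \<Rightarrow> 'w \<times> nat"
    have pw_pair: "val s1 s2 v \<le> cost x (rec (fst (s1 (A y))) (fst (s2 (C x (fst (s1 (A y)))))) z)
         + K * e3 (fst (s1 (A y))) s2 + K * (e1 s1 + e2 s1)"
      if s1: "s1 \<in> set_pmf \<mu>1" and s2: "s2 \<in> set_pmf \<mu>2" for s1 s2
    proof -
      obtain u m where um: "s1 (A y) = (u, m)" by (cases "s1 (A y)")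
      have um_in: "u \<in> Us" "m \<in> {1..M1}"
        using matched_in[OF \<mu>1 A_in s1] mem un unfolding um by (auto simp: A_def Us_def)
      obtain w t where wt: "s2 (C x u) = (w, t)" by (cases "s2 (C x u)")
      have t_in: "t \<in> {1..M2}"
        using matched_in[OF \<mu>2 C_in[OF um_in(1)] s2] un unfolding wt by (auto simp: C_def)
      have cl: "clamp M1 m = m" "clamp M2 t = t"
        using um_in(2) t_in by (simp_all add: clamp_def)
      show ?thesis
      \<comment> \<open>If all three receivers' selections agree with the senders', the cost is the
        ideal one; otherwise some error indicator is 1 and \<open>K\<close> covers the cost.\<close>
      proof (cases "s1 (Qx x m) = (u, m) \<and> s1 (Qz z m) = (u, m) \<and> s2 (Qw u z t) = (w, t)")
        case True
        then have "val s1 s2 v = cost x (rec u w z)"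
          by (simp add: val_def xyz f1_def f_def g_def um wt cl)
        moreover have "0 \<le> K * e3 u s2 + K * (e1 s1 + e2 s1)"
          using K by (simp add: e1_def e2_def e3_def)
        ultimately show ?thesis by (simp add: um wt)
      next
        case False
        then have "1 \<le> e3 u s2 + (e1 s1 + e2 s1)"
          by (auto simp: e1_def e2_def e3_def um wt)
        then have "K \<le> K * (e3 u s2 + (e1 s1 + e2 s1))"
          using K by (simp add: mult_le_cancel_left1)
        moreover have "val s1 s2 v \<le> K"
          by (simp add: val_def xyz cost)
        ultimately show ?thesis
          using cost(1)[of x "rec u w z"] by (simp add: um wt algebra_simps)
      qed
    qed
    have inner: "\<E> \<mu>2 (\<lambda>s2. cost x (rec u (fst (s2 (C x u))) z) + K * e3 u s2) \<le> G u" if u: "u \<in> Us" for u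
    proof -
      have "\<E> \<mu>2 (\<lambda>s2. cost x (rec u (fst (s2 (C x u))) z)) = \<E> (C x u) (\<lambda>wt. cost x (rec u (fst wt) z))"
        by (rule matched_expectation[OF \<mu>2 C_in[OF u]])
      also have "\<dots> = \<E> (pw x u) (\<lambda>w. cost x (rec u w z))"
        unfolding C_def by (rule expectation_pair_fst)
      finally have 1: "\<E> \<mu>2 (\<lambda>s2. cost x (rec u (fst (s2 (C x u))) z)) = \<E> (pw x u) (\<lambda>w. cost x (rec u w z))" .
      have "\<E> \<mu>2 (e3 u) \<le> \<E> (C x u) (\<lambda>i. miss (pmf (C x u) i) (pmf (Qw u z (snd i)) i))"
        unfolding e3_def using un
        by (intro matched_miss[OF \<mu>2 C_in[OF u] finC, of "\<lambda>i. Qw u z (snd i)"] Qw_in[OF u]) (auto simp: C_def)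
      also have "\<dots> = \<E> (C x u) (\<lambda>i. miss (pmf (pw x u) (fst i) / M2) (pmf (qw u z) (fst i)))"
        using un by (intro expectation_pmf_cong) (auto simp: C_def Qw_def pmf_pair)
      also have "\<dots> = \<E> (pw x u) (\<lambda>w. miss (pmf (pw x u) w / M2) (pmf (qw u z) w))"
        unfolding C_def by (rule expectation_pair_fst)
      finally have 2: "\<E> \<mu>2 (e3 u) \<le> \<E> (pw x u) (\<lambda>w. miss (pmf (pw x u) w / M2) (pmf (qw u z) w))" .
      have "\<E> \<mu>2 (\<lambda>s2. cost x (rec u (fst (s2 (C x u))) z) + K * e3 u s2) =
          \<E> \<mu>2 (\<lambda>s2. cost x (rec u (fst (s2 (C x u))) z)) + K * \<E> \<mu>2 (e3 u)"
        using f\<mu>(2) by (simp add: integrable_measure_pmf_finite)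
      also have "\<dots> \<le> \<E> (pw x u) (\<lambda>w. cost x (rec u w z)) + K * \<E> (pw x u) (\<lambda>w. miss (pmf (pw x u) w / M2) (pmf (qw u z) w))"
        unfolding 1 using 2 K by (intro add_left_mono mult_left_mono)
      also have "\<dots> = G u"
        unfolding G_def using fpw by (simp add: integrable_measure_pmf_finite)
      finally show ?thesis .
    qed
    have err1: "\<E> \<mu>1 e1 \<le> \<E> (pu y) (\<lambda>u. miss (pmf (pu y) u / M1) (pmf (qx x) u))"
    proof -
      have "\<E> \<mu>1 e1 \<le> \<E> (A y) (\<lambda>i. miss (pmf (A y) i) (pmf (Qx x (snd i)) i))"
        unfolding e1_def using un
        by (intro matched_miss[OF \<mu>1 A_in finA, of "\<lambda>i. Qx x (snd i)"] Qx_in) (auto simp: A_def)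
      also have "\<dots> = \<E> (A y) (\<lambda>i. miss (pmf (pu y) (fst i) / M1) (pmf (qx x) (fst i)))"
        using un by (intro expectation_pmf_cong) (auto simp: A_def Qx_def pmf_pair)
      also have "\<dots> = \<E> (pu y) (\<lambda>u. miss (pmf (pu y) u / M1) (pmf (qx x) u))"
        unfolding A_def by (rule expectation_pair_fst)
      finally show ?thesis .
    qed
    have err2: "\<E> \<mu>1 e2 \<le> \<E> (pu y) (\<lambda>u. miss (pmf (pu y) u / M1) (pmf (qz z) u))"
    proof -
      have "\<E> \<mu>1 e2 \<le> \<E> (A y) (\<lambda>i. miss (pmf (A y) i) (pmf (Qz z (snd i)) i))"
        unfolding e2_def using un
        by (intro matched_miss[OF \<mu>1 A_in finA, of "\<lambda>i. Qz z (snd i)"] Qz_in) (auto simp: A_def)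
      also have "\<dots> = \<E> (A y) (\<lambda>i. miss (pmf (pu y) (fst i) / M1) (pmf (qz z) (fst i)))"
        using un by (intro expectation_pmf_cong) (auto simp: A_def Qz_def pmf_pair)
      also have "\<dots> = \<E> (pu y) (\<lambda>u. miss (pmf (pu y) u / M1) (pmf (qz z) u))"
        unfolding A_def by (rule expectation_pair_fst)
      finally show ?thesis .
    qed
    have "\<E> \<mu>1 (\<lambda>s1. \<E> \<mu>2 (\<lambda>s2. val s1 s2 v)) \<le> \<E> \<mu>1 (\<lambda>s1. G (fst (s1 (A y))) + K * (e1 s1 + e2 s1))"
    proof (rule expectation_pmf_mono_finite[OF f\<mu>(1)])
      fix s1 assume s1: "s1 \<in> set_pmf \<mu>1"
      let ?u = "fst (s1 (A y))"
      have u: "?u \<in> Us"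
        using matched_in[OF \<mu>1 A_in s1] mem by (auto simp: A_def Us_def)
      have "\<E> \<mu>2 (\<lambda>s2. val s1 s2 v) \<le> \<E> \<mu>2 (\<lambda>s2. cost x (rec ?u (fst (s2 (C x ?u))) z) + K * e3 ?u s2 + K * (e1 s1 + e2 s1))"
        by (rule expectation_pmf_mono_finite[OF f\<mu>(2)]) (rule pw_pair[OF s1])
      also have "\<dots> = \<E> \<mu>2 (\<lambda>s2. cost x (rec ?u (fst (s2 (C x ?u))) z) + K * e3 ?u s2) + K * (e1 s1 + e2 s1)"
        using f\<mu>(2) by (subst Bochner_Integration.integral_add) (auto intro!: integrable_measure_pmf_finite)
      also have "\<dots> \<le> G ?u + K * (e1 s1 + e2 s1)"
        using inner[OF u] by simp
      finally show "\<E> \<mu>2 (\<lambda>s2. val s1 s2 v) \<le> G ?u + K * (e1 s1 + e2 s1)" .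
    qed
    also have "\<dots> = \<E> \<mu>1 (\<lambda>s1. G (fst (s1 (A y)))) + K * (\<E> \<mu>1 e1 + \<E> \<mu>1 e2)"
      using f\<mu>(1) by (simp add: integrable_measure_pmf_finite)
    also have "\<E> \<mu>1 (\<lambda>s1. G (fst (s1 (A y)))) = \<E> (pu y) G"
      using matched_expectation[OF \<mu>1 A_in, of "\<lambda>i. G (fst i)"] expectation_pair_fst[of "pu y" un1 G]
      by (simp add: A_def)
    also have "\<E> (pu y) G + K * (\<E> \<mu>1 e1 + \<E> \<mu>1 e2) \<le> \<E> (pu y) G + K *
      (\<E> (pu y) (\<lambda>u. miss (pmf (pu y) u / M1) (pmf (qx x) u)) + \<E> (pu y) (\<lambda>u. miss (pmf (pu y) u / M1) (pmf (qz z) u)))"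
      using err1 err2 K by (intro add_left_mono mult_left_mono add_mono)
    also have "\<dots> = \<E> (pu y) (\<lambda>u. G u + K * (miss (pmf (pu y) u / M1) (pmf (qx x) u) + miss (pmf (pu y) u / M1) (pmf (qz z) u)))"
      using fpu by (simp add: integrable_measure_pmf_finite)
    also have "\<dots> = ?B v"
      unfolding xyz prod.case G_def
    proof (rule expectation_pmf_cong)
      fix u
      let ?c = "K * (miss (pmf (pu y) u / M1) (pmf (qx x) u) + miss (pmf (pu y) u / M1) (pmf (qz z) u))"
      have "\<E> (pw x u) (\<lambda>w. cost x (rec u w z) + K * miss (pmf (pw x u) w / M2) (pmf (qw u z) w)) + ?c =
         \<E> (pw x u) (\<lambda>w. cost x (rec u w z) + K * miss (pmf (pw x u) w / M2) (pmf (qw u z) w) + ?c)"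
        using fpw by (subst Bochner_Integration.integral_add) (auto intro!: integrable_measure_pmf_finite)
      then show "\<E> (pw x u) (\<lambda>w. cost x (rec u w z) + K * miss (pmf (pw x u) w / M2) (pmf (qw u z) w)) + ?c =
        \<E> (pw x u) (\<lambda>w. cost x (rec u w z) + K *
         (miss (pmf (pu y) u / M1) (pmf (qx x) u) + miss (pmf (pu y) u / M1) (pmf (qz z) u)
          + miss (pmf (pw x u) w / M2) (pmf (qw u z) w)))"
        by (simp add: algebra_simps)
    qed
    finally show ?thesis .
  qed
  \<comment> \<open>The selectors are common randomness, independent of the source. Exchanging the
    averages allows a good pair to be fixed, which gives a deterministic code.\<close>
  have "\<E> \<mu>1 (\<lambda>s1. \<E> \<mu>2 (\<lambda>s2. \<E> S (val s1 s2))) = \<E> \<mu>1 (\<lambda>s1. \<E> S (\<lambda>v. \<E> \<mu>2 (\<lambda>s2. val s1 s2 v)))"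
    by (subst expectation_pmf_swap[OF f\<mu>(2) fS]) simp
  also have "\<dots> = \<E> S (\<lambda>v. \<E> \<mu>1 (\<lambda>s1. \<E> \<mu>2 (\<lambda>s2. val s1 s2 v)))"
    by (rule expectation_pmf_swap[OF f\<mu>(1) fS])
  also have "\<dots> \<le> \<E> S ?B"
    by (rule expectation_pmf_mono_finite[OF fS main])
  finally obtain s1 where "\<E> \<mu>2 (\<lambda>s2. \<E> S (val s1 s2)) \<le> \<E> S ?B"
    using exists_le_expectation[OF f\<mu>(1)] by blast
  then obtain s2 where "\<E> S (val s1 s2) \<le> \<E> S ?B"
    using exists_le_expectation[OF f\<mu>(2)] by blast
  moreover have "f1 s1 y \<in> {1..M1}" "f s1 s2 x t \<in> {1..M2}" for x y t
    using M by (auto simp: f1_def f_def clamp_def)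
  ultimately show ?thesis
    unfolding val_def by (intro exI[of _ "f1 s1"] exI[of _ "f s1 s2"] exI[of _ "g s1 s2"]) auto
qed

section \<open>Error exponents for product distributions\<close>

lemma expectation_bind_finite:
  assumes "finite (set_pmf p)" "\<And>x. x \<in> set_pmf p \<Longrightarrow> finite (set_pmf (f x))"
  shows "\<E> (p \<bind> f) h = \<E> p (\<lambda>x. \<E> (f x) h)"
  using assms by (subst pmf_expectation_bind[of "set_pmf p"])
    (auto simp: integral_measure_pmf_real[where A = "set_pmf p"] mult_ac)

definition triple_pmf :: "'v pmf \<Rightarrow> ('v \<Rightarrow> 'u pmf) \<Rightarrow> ('v \<Rightarrow> 'u \<Rightarrow> 'w pmf) \<Rightarrow> ('v \<times> 'u \<times> 'w) pmf" where
  "triple_pmf p k1 k2 = p \<bind> (\<lambda>v. k1 v \<bind> (\<lambda>u. map_pmf (\<lambda>w. (v, u, w)) (k2 v u)))"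

lemma set_triple_pmf:
  "(v, u, w) \<in> set_pmf (triple_pmf p k1 k2) \<longleftrightarrow> v \<in> set_pmf p \<and> u \<in> set_pmf (k1 v) \<and> w \<in> set_pmf (k2 v u)"
  by (auto simp: triple_pmf_def)

lemma finite_triple_pmf:
  assumes "finite (set_pmf p)" "\<And>v. finite (set_pmf (k1 v))" "\<And>v u. finite (set_pmf (k2 v u))"
  shows "finite (set_pmf (triple_pmf p k1 k2))"
  using assms by (auto simp: triple_pmf_def)

lemma expectation_triple_pmf:
  assumes "finite (set_pmf p)" "\<And>v. finite (set_pmf (k1 v))" "\<And>v u. finite (set_pmf (k2 v u))"
  shows "\<E> (triple_pmf p k1 k2) \<Psi> = \<E> p (\<lambda>v. \<E> (k1 v) (\<lambda>u. \<E> (k2 v u) (\<lambda>w. \<Psi> (v, u, w))))"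
  unfolding triple_pmf_def using assms by (simp add: expectation_bind_finite)

text \<open>Nested product kernels: expectations of products factor from the innermost level
  outwards, and each coordinate is distributed as the single-letter triple.\<close>

definition triple_block :: "nat \<Rightarrow> 'v \<Rightarrow> 'u \<Rightarrow> 'w \<Rightarrow> 'v pmf \<Rightarrow> ('v \<Rightarrow> 'u pmf) \<Rightarrow> ('v \<Rightarrow> 'u \<Rightarrow> 'w pmf)
    \<Rightarrow> ((nat \<Rightarrow> 'v) \<times> (nat \<Rightarrow> 'u) \<times> (nat \<Rightarrow> 'w)) pmf" where
  "triple_block n dv du dw p k1 k2 = triple_pmf (Pi_pmf {..<n} dv (\<lambda>_. p))
     (\<lambda>s. Pi_pmf {..<n} du (\<lambda>i. k1 (s i))) (\<lambda>s us. Pi_pmf {..<n} dw (\<lambda>i. k2 (s i) (us i)))"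

lemma expectation_Pi_pmf_coordinate:
  assumes "finite A" "i \<in> A"
  shows "\<E> (Pi_pmf A dflt p) (\<lambda>f. \<phi> (f i)) = \<E> (p i) \<phi>"
proof -
  have "\<E> (Pi_pmf A dflt p) (\<lambda>f. \<phi> (f i)) = \<E> (map_pmf (\<lambda>f. f i) (Pi_pmf A dflt p)) \<phi>"
    by simp
  then show ?thesis
    using assms by (simp only: Pi_pmf_component if_True)
qed

lemma finite_set_Pi_pmf:
  "finite A \<Longrightarrow> (\<And>i. i \<in> A \<Longrightarrow> finite (set_pmf (p i))) \<Longrightarrow> finite (set_pmf (Pi_pmf A dflt p))"
  by (auto simp: set_Pi_pmf)

locale finite_triple =
  fixes p :: "'v pmf" and k1 :: "'v \<Rightarrow> 'u pmf" and k2 :: "'v \<Rightarrow> 'u \<Rightarrow> 'w pmf"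
    and dv :: 'v and du :: 'u and dw :: 'w
  assumes fin_p: "finite (set_pmf p)" and fin_k1: "\<And>v. finite (set_pmf (k1 v))"
    and fin_k2: "\<And>v u. finite (set_pmf (k2 v u))"
begin

abbreviation "T1 \<equiv> triple_pmf p k1 k2"
abbreviation "Tn n \<equiv> triple_block n dv du dw p k1 k2"

lemma finite_block:
  "finite (set_pmf (Pi_pmf {..<n::nat} dv (\<lambda>_. p)))"
  "finite (set_pmf (Pi_pmf {..<n::nat} du (\<lambda>i. k1 (s i))))"
  "finite (set_pmf (Pi_pmf {..<n::nat} dw (\<lambda>i. k2 (s i) (us i))))"
  by (rule finite_set_Pi_pmf; simp add: fin_p fin_k1 fin_k2)+

lemma finite_T1: "finite (set_pmf T1)"
  by (intro finite_triple_pmf fin_p fin_k1 fin_k2)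

lemma finite_Tn: "finite (set_pmf (Tn n))"
  unfolding triple_block_def by (intro finite_triple_pmf finite_block)

lemma expectation_T1: "\<E> T1 \<Psi> = \<E> p (\<lambda>v. \<E> (k1 v) (\<lambda>u. \<E> (k2 v u) (\<lambda>w. \<Psi> (v, u, w))))"
  by (intro expectation_triple_pmf fin_p fin_k1 fin_k2)

lemma expectation_Tn: "\<E> (Tn n) \<Psi> = \<E> (Pi_pmf {..<n} dv (\<lambda>_. p)) (\<lambda>s.
    \<E> (Pi_pmf {..<n} du (\<lambda>i. k1 (s i))) (\<lambda>us. \<E> (Pi_pmf {..<n} dw (\<lambda>i. k2 (s i) (us i))) (\<lambda>ws. \<Psi> (s, us, ws))))"
  unfolding triple_block_def by (intro expectation_triple_pmf finite_block)

lemma Tn_coordinate_in: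
  assumes "(s, us, ws) \<in> set_pmf (Tn n)" "i < n"
  shows "(s i, us i, ws i) \<in> set_pmf T1"
  using assms by (auto simp: triple_block_def set_triple_pmf set_Pi_pmf PiE_dflt_def)

lemma Tn_outside:
  assumes "(s, us, ws) \<in> set_pmf (Tn n)" "\<not> i < n"
  shows "us i = du" "ws i = dw"
  using assms by (auto simp: triple_block_def set_triple_pmf set_Pi_pmf PiE_dflt_def)

lemma expectation_Tn_coordinate:
  assumes "i < n"
  shows "\<E> (Tn n) (\<lambda>(s, us, ws). h (s i, us i, ws i)) = \<E> T1 h"
proof -
  have "\<E> (Pi_pmf {..<n} dw (\<lambda>i. k2 (s i) (us i))) (\<lambda>ws. h (s i, us i, ws i)) =
      \<E> (k2 (s i) (us i)) (\<lambda>w. h (s i, us i, w))" for s us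
    using assms by (intro expectation_Pi_pmf_coordinate) auto
  moreover have "\<E> (Pi_pmf {..<n} du (\<lambda>i. k1 (s i))) (\<lambda>us. \<E> (k2 (s i) (us i)) (\<lambda>w. h (s i, us i, w))) =
      \<E> (k1 (s i)) (\<lambda>u. \<E> (k2 (s i) u) (\<lambda>w. h (s i, u, w)))" for s
    using assms by (intro expectation_Pi_pmf_coordinate) auto
  moreover have "\<E> (Pi_pmf {..<n} dv (\<lambda>_. p)) (\<lambda>s. \<E> (k1 (s i)) (\<lambda>u. \<E> (k2 (s i) u) (\<lambda>w. h (s i, u, w)))) =
      \<E> p (\<lambda>v. \<E> (k1 v) (\<lambda>u. \<E> (k2 v u) (\<lambda>w. h (v, u, w))))"
    using assms by (intro expectation_Pi_pmf_coordinate) auto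
  ultimately show ?thesis
    by (simp add: expectation_Tn expectation_T1)
qed

lemma expectation_Tn_prod:
  assumes h: "\<And>t. 0 \<le> h t"
  shows "\<E> (Tn n) (\<lambda>(s, us, ws). \<Prod>i<n. h (s i, us i, ws i)) = \<E> T1 h ^ n"
proof -
  have "\<E> (Pi_pmf {..<n} dw (\<lambda>i. k2 (s i) (us i))) (\<lambda>ws. \<Prod>i<n. h (s i, us i, ws i)) =
      (\<Prod>i<n. \<E> (k2 (s i) (us i)) (\<lambda>w. h (s i, us i, w)))" for s us
    using h by (intro expectation_prod_Pi_pmf integrable_measure_pmf_finite fin_k2) auto
  moreover have "\<E> (Pi_pmf {..<n} du (\<lambda>i. k1 (s i))) (\<lambda>us. \<Prod>i<n. \<E> (k2 (s i) (us i)) (\<lambda>w. h (s i, us i, w))) =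
      (\<Prod>i<n. \<E> (k1 (s i)) (\<lambda>u. \<E> (k2 (s i) u) (\<lambda>w. h (s i, u, w))))" for s
    using h by (intro expectation_prod_Pi_pmf[where f = "\<lambda>i u. \<E> (k2 (s i) u) (\<lambda>w. h (s i, u, w))"]
      integrable_measure_pmf_finite fin_k1) (auto intro!: Bochner_Integration.integral_nonneg)
  moreover have "\<E> (Pi_pmf {..<n} dv (\<lambda>_. p)) (\<lambda>s. \<Prod>i<n. \<E> (k1 (s i)) (\<lambda>u. \<E> (k2 (s i) u) (\<lambda>w. h (s i, u, w)))) =
      (\<Prod>i<n. \<E> p (\<lambda>v. \<E> (k1 v) (\<lambda>u. \<E> (k2 v u) (\<lambda>w. h (v, u, w)))))"
    using h by (intro expectation_prod_Pi_pmf[where f = "\<lambda>i v. \<E> (k1 v) (\<lambda>u. \<E> (k2 v u) (\<lambda>w. h (v, u, w)))"]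
      integrable_measure_pmf_finite fin_p) (auto intro!: Bochner_Integration.integral_nonneg)
  ultimately show ?thesis
    by (simp add: expectation_Tn expectation_T1)
qed

end

text \<open>As a function of \<open>\<theta>\<close>, the moment equals 1 at 0 and has derivative
  \<open>ln 2\<close> times the mean of \<open>log 2 (r x)\<close> minus \<open>\<rho>\<close>,
  which is negative. So it falls below 1 for small \<open>\<theta>\<close>; the cap at 1 serves
  \<open>miss_le_powr\<close>.\<close>

lemma chernoff_exponent:
  fixes r :: "'a \<Rightarrow> real"
  assumes fin: "finite (set_pmf p)" and r: "\<And>x. x \<in> set_pmf p \<Longrightarrow> 0 < r x"
    and less: "\<E> p (\<lambda>x. log 2 (r x)) < \<rho>"
  shows "\<exists>\<theta>>0. \<theta> \<le> 1 \<and> \<E> p (\<lambda>x. (r x * 2 powr (- \<rho>)) powr \<theta>) < 1"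
proof -
  define c where "c x = ln (r x * 2 powr (- \<rho>))" for x
  define \<phi> where "\<phi> \<theta> = (\<Sum>x\<in>set_pmf p. exp (\<theta> * c x) * pmf p x)" for \<theta>
  have "(\<phi> has_real_derivative (\<Sum>x\<in>set_pmf p. c x * pmf p x)) (at 0)"
    unfolding \<phi>_def by (auto intro!: derivative_eq_intros)
  moreover have "(\<Sum>x\<in>set_pmf p. c x * pmf p x) < 0"
  proof -
    have "(\<Sum>x\<in>set_pmf p. c x * pmf p x) = \<E> p c"
      using fin by (subst integral_measure_pmf_real[where A = "set_pmf p"]) auto
    also have "\<dots> = \<E> p (\<lambda>x. ln 2 * (log 2 (r x) - \<rho>))"
    proof (rule expectation_pmf_cong)
      fix x assume "x \<in> set_pmf p"
      from r[OF this] show "c x = ln 2 * (log 2 (r x) - \<rho>)"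
        by (simp add: c_def ln_mult ln_powr log_def algebra_simps)
    qed
    also have "\<dots> = ln 2 * (\<E> p (\<lambda>x. log 2 (r x)) - \<rho>)"
      using fin by (simp add: integrable_measure_pmf_finite)
    also have "\<dots> < 0"
      using less by (simp add: mult_pos_neg)
    finally show ?thesis .
  qed
  ultimately obtain e where e: "e > 0" "\<And>h. 0 < h \<Longrightarrow> h < e \<Longrightarrow> \<phi> (0 + h) < \<phi> 0"
    using DERIV_neg_dec_right by blast
  define \<theta> where "\<theta> = min (e / 2) 1"
  have \<theta>: "0 < \<theta>" "\<theta> < e" "\<theta> \<le> 1"
    using e(1) by (auto simp: \<theta>_def)
  have "\<E> p (\<lambda>x. (r x * 2 powr (- \<rho>)) powr \<theta>) = \<E> p (\<lambda>x. exp (\<theta> * c x))"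
    using r by (intro expectation_pmf_cong) (force simp: powr_def c_def)
  also have "\<dots> = \<phi> \<theta>"
    unfolding \<phi>_def using fin by (subst integral_measure_pmf_real[where A = "set_pmf p"]) auto
  also have "\<dots> < \<phi> 0"
    using e(2)[OF \<theta>(1,2)] by simp
  also have "\<phi> 0 = 1"
    unfolding \<phi>_def using fin by (simp add: sum_pmf_eq_1)
  finally show ?thesis using \<theta> by blast
qed

text \<open>With \<open>t = a / b\<close>, the left side is at most \<open>min t 1\<close>, and that
  is at most any power of \<open>t\<close> with exponent in (0, 1].\<close>

lemma miss_le_powr:
  assumes "0 < a" "0 < b" "0 < \<theta>" "\<theta> \<le> 1"
  shows "miss a b \<le> (a / b) powr \<theta>"
proof (cases "a / b \<le> 1")
  case True
  have "miss a b \<le> a / b"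
    unfolding miss_def using assms by (intro divide_left_mono) auto
  also have "\<dots> = (a / b) powr 1"
    using assms by simp
  also have "\<dots> \<le> (a / b) powr \<theta>"
    using assms True by (intro powr_mono') auto
  finally show ?thesis .
next
  case False
  have "miss a b \<le> 1"
    unfolding miss_def using assms by simp
  also have "\<dots> \<le> (a / b) powr \<theta>"
    using False assms by (intro ge_one_powr_ge_zero) auto
  finally show ?thesis .
qed

text \<open>The power bound on \<open>miss\<close> factors over the letters, so the mean is an
  \<open>n\<close>-th power of a number below 1. The factor 1/2 in front of the message count
  absorbs the floor in \<open>num_msgs\<close> and costs
  \<open>2 powr \<theta> \<le> 2\<close>.\<close>

lemma (in finite_triple) miss_exponent:
  assumes pos: "\<And>t. t \<in> set_pmf T1 \<Longrightarrow> 0 < a t" "\<And>t. t \<in> set_pmf T1 \<Longrightarrow> 0 < b t"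
    and less: "\<E> T1 (\<lambda>t. log 2 (a t / b t)) < \<rho>"
  shows "\<exists>\<beta>\<ge>0. \<beta> < 1 \<and> (\<forall>n (M::real). 2 powr (real n * \<rho>) / 2 \<le> M \<longrightarrow>
     \<E> (Tn n) (\<lambda>(s, us, ws). miss ((\<Prod>i<n. a (s i, us i, ws i)) / M) (\<Prod>i<n. b (s i, us i, ws i))) \<le> 2 * \<beta> ^ n)"
proof -
  obtain \<theta> where \<theta>: "0 < \<theta>" "\<theta> \<le> 1" "\<E> T1 (\<lambda>t. (a t / b t * 2 powr (- \<rho>)) powr \<theta>) < 1"
    using chernoff_exponent[OF finite_T1, of "\<lambda>t. a t / b t" \<rho>] pos less by auto
  define h where "h t = (a t / b t * 2 powr (- \<rho>)) powr \<theta>" for t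
  have "\<E> (Tn n) (\<lambda>(s, us, ws). miss ((\<Prod>i<n. a (s i, us i, ws i)) / M) (\<Prod>i<n. b (s i, us i, ws i))) \<le> 2 * \<E> T1 h ^ n"
    if M: "2 powr (real n * \<rho>) / 2 \<le> M" for n :: nat and M :: real
  proof -
    have M0: "0 < M"
      by (rule less_le_trans[OF _ M]) simp
    have "\<E> (Tn n) (\<lambda>(s, us, ws). miss ((\<Prod>i<n. a (s i, us i, ws i)) / M) (\<Prod>i<n. b (s i, us i, ws i))) \<le>
      \<E> (Tn n) (\<lambda>(s, us, ws). 2 * (\<Prod>i<n. h (s i, us i, ws i)))"
    proof (rule expectation_pmf_mono_finite[OF finite_Tn], clarify)
      fix s us ws assume mem: "(s, us, ws) \<in> set_pmf (Tn n)"
      let ?a = "\<lambda>i. a (s i, us i, ws i)" and ?b = "\<lambda>i. b (s i, us i, ws i)"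
      have ab: "0 < ?a i" "0 < ?b i" if "i < n" for i
        using Tn_coordinate_in[OF mem that] pos by auto
      have pa: "0 < (\<Prod>i<n. ?a i)" and pb: "0 < (\<Prod>i<n. ?b i)"
        using ab by (auto intro!: prod_pos)
      have "miss ((\<Prod>i<n. ?a i) / M) (\<Prod>i<n. ?b i) \<le> ((\<Prod>i<n. ?a i) / M / (\<Prod>i<n. ?b i)) powr \<theta>"
        using pa pb M0 \<theta> by (intro miss_le_powr) auto
      also have "\<dots> \<le> (2 * (\<Prod>i<n. ?a i / ?b i * 2 powr (- \<rho>))) powr \<theta>"
      proof (rule powr_mono2)
        have "2 powr (real n * \<rho>) = (2 powr \<rho>) ^ n"
          by (simp add: powr_realpow[symmetric] powr_powr mult.commute)
        then have "1 / M \<le> 2 * (2 powr (- \<rho>)) ^ n"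
          using M M0 by (simp add: powr_minus field_simps)
        then have "(\<Prod>i<n. ?a i) / (\<Prod>i<n. ?b i) * (1 / M) \<le> (\<Prod>i<n. ?a i) / (\<Prod>i<n. ?b i) * (2 * (2 powr (- \<rho>)) ^ n)"
          using pa pb by (intro mult_left_mono) auto
        then show "(\<Prod>i<n. ?a i) / M / (\<Prod>i<n. ?b i) \<le> 2 * (\<Prod>i<n. ?a i / ?b i * 2 powr (- \<rho>))"
          by (simp add: prod.distrib prod_dividef field_simps)
      qed (use \<theta> pa pb M0 in auto)
      also have "\<dots> = 2 powr \<theta> * (\<Prod>i<n. h (s i, us i, ws i))"
        unfolding h_def by (simp only: powr_mult prod_powr_distrib)
      also have "\<dots> \<le> 2 * (\<Prod>i<n. h (s i, us i, ws i))"
        using \<theta> powr_mono[of \<theta> 1 "2::real"] by (intro mult_right_mono prod_nonneg) (auto simp: h_def)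
      finally show "miss ((\<Prod>i<n. ?a i) / M) (\<Prod>i<n. ?b i) \<le> 2 * (\<Prod>i<n. h (s i, us i, ws i))" .
    qed
    also have "\<dots> = 2 * \<E> (Tn n) (\<lambda>(s, us, ws). \<Prod>i<n. h (s i, us i, ws i))"
      by (simp add: case_prod_unfold)
    also have "\<dots> = 2 * \<E> T1 h ^ n"
      by (subst expectation_Tn_prod) (auto simp: h_def)
    finally show ?thesis .
  qed
  moreover have "0 \<le> \<E> T1 h"
    by (intro Bochner_Integration.integral_nonneg) (simp add: h_def)
  ultimately show ?thesis
    using \<theta>(3) unfolding h_def[symmetric] by blast
qed

text \<open>For a nonnegative rate the power is at least 1, and rounding such a number down loses at
  most half of it.\<close>

lemma num_msgs_lower:
  assumes "0 \<le> \<rho>"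
  shows "2 powr (real n * \<rho>) / 2 \<le> real (num_msgs n \<rho>)" "1 \<le> num_msgs n \<rho>"
proof -
  let ?x = "2 powr (real n * \<rho>)"
  have x: "1 \<le> ?x"
    using assms by (intro ge_one_powr_ge_zero) auto
  then have f: "1 \<le> \<lfloor>?x\<rfloor>"
    by (simp add: le_floor_iff)
  then show "1 \<le> num_msgs n \<rho>"
    unfolding num_msgs_def by linarith
  have "real (num_msgs n \<rho>) = of_int \<lfloor>?x\<rfloor>"
    unfolding num_msgs_def using f by simp
  moreover have "?x / 2 \<le> of_int \<lfloor>?x\<rfloor>"
    using f floor_correct[of ?x] by linarith
  ultimately show "?x / 2 \<le> real (num_msgs n \<rho>)" by simp
qed

section \<open>Conditional laws of finitely supported variables\<close>

text \<open>Arbitrary where \<open>a\<close> has probability \<open>0\<close>.\<close>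
definition cond_law :: "'o pmf \<Rightarrow> ('o \<Rightarrow> 'a) \<Rightarrow> ('o \<Rightarrow> 'b) \<Rightarrow> 'a \<Rightarrow> 'b pmf" where
  "cond_law J A B a = (SOME q. finite (set_pmf q) \<and>
     (\<forall>b. pmf (map_pmf A J) a * pmf q b = pmf (map_pmf (\<lambda>s. (B s, A s)) J) (b, a)))"

lemma cond_law:
  assumes fin: "finite (set_pmf J)"
  shows "finite (set_pmf (cond_law J A B a))"
    "pmf (map_pmf A J) a * pmf (cond_law J A B a) b = pmf (map_pmf (\<lambda>s. (B s, A s)) J) (b, a)"
proof -
  let ?S = "B ` set_pmf J" and ?f = "\<lambda>b. pmf (map_pmf (\<lambda>s. (B s, A s)) J) (b, a)"
  have sum: "(\<Sum>b\<in>?S. ?f b) = pmf (map_pmf A J) a"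
    using fin by (intro sum_pmf_map_fst) auto
  have out: "?f b = 0" if "b \<notin> ?S" for b
    using that by (intro pmf_map_outside) auto
  have "\<exists>q. finite (set_pmf q) \<and> (\<forall>b. pmf (map_pmf A J) a * pmf q b = ?f b)"
  proof (cases "pmf (map_pmf A J) a = 0")
    case True
    then have "\<forall>b\<in>?S. ?f b = 0"
      using sum fin by (simp add: sum_nonneg_eq_0_iff)
    then have "?f b = 0" for b
      using out by blast
    with True show ?thesis
      by (intro exI[of _ "return_pmf undefined"]) auto
  next
    case False
    then have "\<exists>q. \<forall>b. pmf q b = (if b \<in> ?S then ?f b / pmf (map_pmf A J) a else 0)"
      using fin sum by (intro ex_pmf_weights) (auto simp flip: sum_divide_distrib)
    then obtain q where q: "\<And>b. pmf q b = (if b \<in> ?S then ?f b / pmf (map_pmf A J) a else 0)"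
      by blast
    have "set_pmf q \<subseteq> ?S"
      by (auto simp: set_pmf_iff q split: if_splits)
    then have "finite (set_pmf q)"
      using fin finite_subset by blast
    then show ?thesis
      using False q out by (intro exI[of _ q]) auto
  qed
  from someI_ex[OF this] show "finite (set_pmf (cond_law J A B a))"
    "pmf (map_pmf A J) a * pmf (cond_law J A B a) b = ?f b"
    unfolding cond_law_def[symmetric] by auto
qed

lemma pmf_map_kernel_cong:
  assumes "\<And>t. t \<in> set_pmf J \<Longrightarrow> A t = a \<longleftrightarrow> B t = b"
  shows "pmf (map_pmf A J) a = pmf (map_pmf B J) b"
  unfolding pmf_map using assms
  by (intro measure_pmf.finite_measure_eq_AE) (auto simp: AE_measure_pmf_iff)

section \<open>Achievability\<close>

locale aux_channels = helper_source pxy pzx d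
  for pxy :: "('x::finite \<times> 'y::finite) pmf" and pzx :: "'x \<Rightarrow> 'z::finite pmf"
    and d :: "'x \<Rightarrow> 'xh::finite \<Rightarrow> real" +
  fixes pu :: "'y \<Rightarrow> nat pmf" and pw :: "'x \<Rightarrow> nat \<Rightarrow> nat pmf"
  assumes fin_pu: "finite (\<Union>y. set_pmf (pu y))" and fin_pw: "finite (\<Union>x. \<Union>u. set_pmf (pw x u))"

sublocale aux_channels \<subseteq> helper_joint pxy pzx d
  "\<lambda>x y. pu y \<bind> (\<lambda>u. map_pmf (Pair u) (pw x u))" "\<Union>y. set_pmf (pu y)" "\<Union>x. \<Union>u. set_pmf (pw x u)"
  "\<lambda>y u. pmf (pu y) u"
  by (rule helper_joint_aux[OF fin_pu fin_pw]) auto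

context aux_channels
begin

text \<open>The receivers' posteriors: for \<open>u\<close> at the encoder (\<open>qx\<close>) and
  at the decoder (\<open>qz\<close>), and for \<open>w\<close> at the decoder once it knows
  \<open>u\<close> (\<open>qw\<close>).\<close>

definition qx :: "'x \<Rightarrow> nat pmf" where "qx = cond_law J X U"
definition qz :: "'z \<Rightarrow> nat pmf" where "qz = cond_law J Z U"
definition qw :: "nat \<Rightarrow> 'z \<Rightarrow> nat pmf" where "qw u z = cond_law J (\<lambda>s. (U s, Z s)) W (u, z)"

lemma J_memD:
  assumes "(x, y, z, u, w) \<in> set_pmf J"
  shows "0 < pmf pxy (x, y)" "0 < pY y" "0 < pz x z" "0 < pmf (pu y) u" "0 < pmf (pw x u) w"
    "u \<in> (\<Union>y. set_pmf (pu y))" "w \<in> (\<Union>x. \<Union>u. set_pmf (pw x u))"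
proof -
  have *: "(x, y) \<in> set_pmf pxy" "z \<in> set_pmf (pzx x)" "u \<in> set_pmf (pu y)" "w \<in> set_pmf (pw x u)"
    using assms by (auto simp: joint_def)
  then show "0 < pmf pxy (x, y)" "0 < pz x z" "0 < pmf (pu y) u" "0 < pmf (pw x u) w"
      "u \<in> (\<Union>y. set_pmf (pu y))" "w \<in> (\<Union>x. \<Union>u. set_pmf (pw x u))"
    by (auto simp: pmf_positive pz_def)
  have "y \<in> set_pmf (map_pmf snd pxy)"
    using *(1) by force
  then show "0 < pY y"
    by (simp add: pY_def pmf_positive)
qed

lemma vUW_eq: "vUW u w $ x = pushX (vU u) $ x * pmf (pw x u) w"
  by (simp add: vUW_def pushX_def vU_def pmf_bind_Pair sum_distrib_left sum_distrib_right pY_mult_kxy[symmetric] mult_ac)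

lemma q_pos:
  assumes "(x, y, z, u, w) \<in> set_pmf J"
  shows "0 < pmf (qx x) u" "0 < pmf (qz z) u" "0 < pmf (qw u z) w"
proof -
  have "0 < pmf (map_pmf X J) x * pmf (qx x) u"
    unfolding qx_def cond_law(2)[OF finite_J] using pmf_map_apply_pos[OF assms, of "\<lambda>s. (U s, X s)"] by simp
  moreover have "0 < pmf (map_pmf Z J) z * pmf (qz z) u"
    unfolding qz_def cond_law(2)[OF finite_J] using pmf_map_apply_pos[OF assms, of "\<lambda>s. (U s, Z s)"] by simp
  moreover have "0 < pmf (map_pmf (\<lambda>s. (U s, Z s)) J) (u, z) * pmf (qw u z) w"
    unfolding qw_def cond_law(2)[OF finite_J] using pmf_map_apply_pos[OF assms, of "\<lambda>s. (W s, U s, Z s)"] by simp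
  ultimately show "0 < pmf (qx x) u" "0 < pmf (qz z) u" "0 < pmf (qw u z) w"
    by (simp_all add: zero_less_mult_iff pmf_nonneg not_less[symmetric])
qed

text \<open>Given \<open>y\<close>, the letter \<open>u\<close> is independent of \<open>z\<close>,
  so p(u|y) = p(u|y,z) and the ratio is the information density of \<open>U\<close> and
  \<open>Y\<close> given \<open>Z\<close>.\<close>

lemma log_ratio_z:
  "\<E> J (\<lambda>(x,y,z,u,w). log 2 (pmf (pu y) u / pmf (qz z) u)) = cond_mutual_info J U Y Z"
  unfolding cond_mutual_info_expectation[OF finite_J]
proof (rule expectation_pmf_cong, clarify)
  fix x y z u w assume s: "(x, y, z, u, w) \<in> set_pmf J"
  let ?uyz = "pmf (map_pmf (\<lambda>s. (U s, Y s, Z s)) J) (u, y, z)" and ?uz = "pmf (map_pmf (\<lambda>s. (U s, Z s)) J) (u, z)"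
    and ?yz = "pmf (map_pmf (\<lambda>s. (Y s, Z s)) J) (y, z)" and ?z = "pmf (map_pmf Z J) z"
  have pos: "0 < ?yz" "0 < ?z"
    using pmf_map_apply_pos[OF s, of "\<lambda>s. (Y s, Z s)"] pmf_map_apply_pos[OF s, of Z] by auto
  have "?uyz = pmf (map_pmf (\<lambda>s. (Y s, Z s, U s)) J) (y, z, u)"
    by (rule pmf_map_kernel_cong) auto
  also have "\<dots> = pmf (pu y) u * (pY y * kyz y z)"
    using pmf_YZU[OF J_memD(6)[OF s]] by (simp add: vU_def mult_ac)
  also have "pY y * kyz y z = pmf (map_pmf (\<lambda>s. (Y s, Z s, ())) J) (y, z, ())"
    by (simp add: pmf_YZ PY_def)
  also have "\<dots> = ?yz"
    by (rule pmf_map_kernel_cong) auto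
  finally have 1: "?uyz = pmf (pu y) u * ?yz" .
  have 2: "?uz = ?z * pmf (qz z) u"
    unfolding qz_def by (rule cond_law(2)[OF finite_J, symmetric])
  show "log 2 (pmf (pu y) u / pmf (qz z) u) = log 2 (?uyz * ?z / (?uz * ?yz))"
    using pos by (simp add: 1 2)
qed

text \<open>Given \<open>(x, u)\<close>, the letter \<open>w\<close> is independent of
  \<open>z\<close>, so p(w|x,u) = p(w|x,u,z).\<close>

lemma log_ratio_w:
  "\<E> J (\<lambda>(x,y,z,u,w). log 2 (pmf (pw x u) w / pmf (qw u z) w)) = cond_mutual_info J X W (\<lambda>s. (U s, Z s))"
  unfolding cond_mutual_info_expectation[OF finite_J]
proof (rule expectation_pmf_cong, clarify)
  fix x y z u w assume s: "(x, y, z, u, w) \<in> set_pmf J"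
  let ?xwuz = "pmf (map_pmf (\<lambda>s. (X s, W s, U s, Z s)) J) (x, w, u, z)"
    and ?xuz = "pmf (map_pmf (\<lambda>s. (X s, U s, Z s)) J) (x, u, z)"
    and ?wuz = "pmf (map_pmf (\<lambda>s. (W s, U s, Z s)) J) (w, u, z)" and ?uz = "pmf (map_pmf (\<lambda>s. (U s, Z s)) J) (u, z)"
  have pos: "0 < ?xuz" "0 < ?uz"
    using pmf_map_apply_pos[OF s, of "\<lambda>s. (X s, U s, Z s)"] pmf_map_apply_pos[OF s, of "\<lambda>s. (U s, Z s)"] by auto
  have "?xwuz = pmf (map_pmf (\<lambda>s. (X s, Z s, U s, W s)) J) (x, z, u, w)"
    by (rule pmf_map_kernel_cong) auto
  also have "\<dots> = pmf (pw x u) w * (pushX (vU u) $ x * pz x z)"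
    using pmf_XZUW[OF J_memD(6,7)[OF s]] by (simp add: vUW_eq mult_ac)
  also have "pushX (vU u) $ x * pz x z = pmf (map_pmf (\<lambda>s. (X s, Z s, U s)) J) (x, z, u)"
    by (rule pmf_XZU[OF J_memD(6)[OF s], symmetric])
  also have "\<dots> = ?xuz"
    by (rule pmf_map_kernel_cong) auto
  finally have 1: "?xwuz = pmf (pw x u) w * ?xuz" .
  have 2: "?wuz = ?uz * pmf (qw u z) w"
    unfolding qw_def by (rule cond_law(2)[OF finite_J, symmetric])
  show "log 2 (pmf (pw x u) w / pmf (qw u z) w) = log 2 (?xwuz * ?uz / (?xuz * ?wuz))"
    using pos by (simp add: 1 2)
qed

text \<open>Here the Markov chain \<open>Y - X - Z\<close> enters: the encoder's observation of \<open>X\<close> is at least as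
  informative about \<open>U\<close> as the decoder's observation of \<open>Z\<close>.\<close>
lemma log_ratio_x:
  "\<E> J (\<lambda>(x,y,z,u,w). log 2 (pmf (pu y) u / pmf (qx x) u)) \<le> cond_mutual_info J U Y Z"
proof -
  let ?SU = "\<Union>y. set_pmf (pu y)" and ?PX = "\<lambda>x. pmf (map_pmf X J) x"
  \<comment> \<open>The log ratio against \<open>qx\<close> is the one against \<open>qz\<close>
    plus \<open>log 2\<close> of this ratio. Given \<open>(x, u)\<close>, \<open>z\<close> still
    follows p(z|x), so the mean of the ratio is a sum of p(x) p(z|x) p(u|z), at most 1, and Gibbs
    applies.\<close>
  let ?r = "\<lambda>(x,z,u). pmf (qz z) u / pmf (qx x) u"
  let ?K = "map_pmf (\<lambda>s. (X s, Z s, U s)) J"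
  have K: "?r (x, z, u) * pmf ?K (x, z, u) \<le> ?PX x * pz x z * pmf (qz z) u" if u: "u \<in> ?SU" for x z u
  proof -
    have XZU: "pmf ?K (x, z, u) = pushX (vU u) $ x * pz x z" for z
      by (rule pmf_XZU[OF u])
    have "pmf (map_pmf (\<lambda>s. (U s, X s)) J) (u, x) = (\<Sum>z\<in>UNIV. pmf ?K (x, z, u))"
    proof -
      have "(\<Sum>z\<in>UNIV. pmf ?K (x, z, u)) = (\<Sum>z\<in>UNIV. pmf (map_pmf (\<lambda>s. (Z s, U s, X s)) J) (z, u, x))"
        by (intro sum.cong refl pmf_map_kernel_cong) auto
      then show ?thesis
        using sum_pmf_map_fst[OF finite_J, of UNIV Z "\<lambda>s. (U s, X s)" "(u, x)"] by simp
    qed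
    also have "\<dots> = pushX (vU u) $ x"
      by (simp add: XZU sum_pz flip: sum_distrib_left)
    finally have "?PX x * pmf (qx x) u = pushX (vU u) $ x"
      unfolding qx_def cond_law(2)[OF finite_J] .
    then have "?r (x, z, u) * pmf ?K (x, z, u) = pmf (qz z) u / pmf (qx x) u * (?PX x * pmf (qx x) u * pz x z)"
      by (simp add: XZU)
    also have "\<dots> \<le> ?PX x * pz x z * pmf (qz z) u"
      by (cases "pmf (qx x) u = 0") simp_all
    finally show ?thesis .
  qed
  have "\<E> J (\<lambda>s. ?r (X s, Z s, U s)) = \<E> ?K ?r"
    by simp
  also have "\<dots> = (\<Sum>t\<in>UNIV \<times> UNIV \<times> ?SU. ?r t * pmf ?K t)"
    by (rule integral_measure_pmf_real) (use fin_pu set_J in auto)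
  also have "\<dots> \<le> (\<Sum>(x,z,u)\<in>UNIV \<times> UNIV \<times> ?SU. ?PX x * pz x z * pmf (qz z) u)"
  proof (rule sum_mono)
    fix t :: "'x \<times> 'z \<times> nat" assume "t \<in> UNIV \<times> UNIV \<times> ?SU"
    then obtain x z u where t: "t = (x, z, u)" "u \<in> ?SU" by blast
    from K[OF t(2), of x z] show "?r t * pmf ?K t \<le> (case t of (x, z, u) \<Rightarrow> ?PX x * pz x z * pmf (qz z) u)"
      by (simp only: t(1) prod.case)
  qed
  also have "\<dots> = (\<Sum>x\<in>UNIV. \<Sum>z\<in>UNIV. ?PX x * pz x z * (\<Sum>u\<in>?SU. pmf (qz z) u))"
    by (simp add: sum.cartesian_product sum_distrib_left)
  also have "\<dots> \<le> (\<Sum>x\<in>UNIV. \<Sum>z\<in>UNIV. ?PX x * pz x z * 1)"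
  proof (intro sum_mono mult_left_mono)
    show "(\<Sum>u\<in>?SU. pmf (qz z) u) \<le> 1" for z
      using fin_pu by (subst measure_measure_pmf_finite[symmetric]) auto
  qed simp
  also have "\<dots> = (\<Sum>x\<in>UNIV. ?PX x)"
    by (simp add: sum_pz flip: sum_distrib_left)
  also have "\<dots> = 1"
    by (rule sum_pmf_eq_1) auto
  finally have le: "\<E> J (\<lambda>s. ?r (X s, Z s, U s)) \<le> 1" .
  have "\<E> J (\<lambda>s. log 2 (?r (X s, Z s, U s))) \<le> 0"
  proof (rule gibbs_expectation[OF finite_J _ le])
    fix s assume s: "s \<in> set_pmf J"
    obtain x y z u w where "s = (x, y, z, u, w)" by (cases s)
    then show "0 < ?r (X s, Z s, U s)"
      using q_pos[of x y z u w] s by simp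
  qed
  moreover have "\<E> J (\<lambda>(x,y,z,u,w). log 2 (pmf (pu y) u / pmf (qx x) u)) =
    \<E> J (\<lambda>s. (\<lambda>(x,y,z,u,w). log 2 (pmf (pu y) u / pmf (qz z) u)) s + log 2 (?r (X s, Z s, U s)))"
  proof (rule expectation_pmf_cong)
    fix s assume s: "s \<in> set_pmf J"
    obtain x y z u w where xyzuw: "s = (x, y, z, u, w)" by (cases s)
    have pos: "0 < pmf (qx x) u" "0 < pmf (qz z) u" "0 < pmf (pu y) u"
      using q_pos[of x y z u w] J_memD[of x y z u w] s unfolding xyzuw by auto
    show "(\<lambda>(x,y,z,u,w). log 2 (pmf (pu y) u / pmf (qx x) u)) s =
      (\<lambda>(x,y,z,u,w). log 2 (pmf (pu y) u / pmf (qz z) u)) s + log 2 (?r (X s, Z s, U s))"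
      unfolding xyzuw prod.case using pos by (simp add: log_divide)
  qed
  moreover have "\<dots> = \<E> J (\<lambda>(x,y,z,u,w). log 2 (pmf (pu y) u / pmf (qz z) u)) + \<E> J (\<lambda>s. log 2 (?r (X s, Z s, U s)))"
    by (rule Bochner_Integration.integral_add) (rule integrable_measure_pmf_finite[OF finite_J])+
  ultimately show ?thesis
    by (simp add: log_ratio_z)
qed

text \<open>The default \<open>undefined\<close> agrees with \<open>src_block\<close>, so the source
  part of \<open>letters.Tn n\<close> is the source block itself; the default \<open>0\<close> is
  that of the product posteriors below.\<close>

sublocale letters: finite_triple "src_pmf pxy pzx" "\<lambda>v. pu (fst (snd v))" "\<lambda>v u. pw (fst v) u" undefined 0 0
proof
  show "finite (set_pmf (pu (fst (snd v))))" for v :: "'x \<times> 'y \<times> 'z"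
    by (rule finite_subset[OF _ fin_pu]) auto
  show "finite (set_pmf (pw (fst v) u))" for v :: "'x \<times> 'y \<times> 'z" and u
    by (rule finite_subset[OF _ fin_pw]) auto
qed simp

lemma J_eq_letters: "J = map_pmf (\<lambda>((x,y,z),u,w). (x,y,z,u,w)) letters.T1"
  by (simp add: joint_def triple_pmf_def src_pmf_def map_pmf_def bind_assoc_pmf bind_return_pmf case_prod_unfold)

lemma expectation_letters: "\<E> letters.T1 (\<lambda>((x,y,z),u,w). h (x,y,z,u,w)) = \<E> J h"
  unfolding J_eq_letters by (simp add: case_prod_unfold)

lemma letters_in_J: "((x,y,z),u,w) \<in> set_pmf letters.T1 \<Longrightarrow> (x,y,z,u,w) \<in> set_pmf J"
  unfolding J_eq_letters by force

text \<open>The one-shot code is applied to blocks with product posteriors as the receivers'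
  beliefs. Strict rate inequalities make all three error terms decay exponentially, while the ideal
  distortion stays at its single-letter value.\<close>

theorem achievability:
  fixes xhat :: "nat \<Rightarrow> nat \<Rightarrow> 'z \<Rightarrow> 'xh"
  assumes R1: "cond_mutual_info J U Y Z < R1" and R: "cond_mutual_info J X W (\<lambda>s. (U s, Z s)) < R"
    and D: "\<E> J (\<lambda>(x,y,z,u,w). d x (xhat u w z)) \<le> D"
  shows "achievable pxy pzx d D R R1"
proof -
  have rates: "0 \<le> R1" "0 \<le> R"
    using order_trans[OF cond_mutual_info_nonneg[OF finite_J] less_imp_le[OF R1]]
      order_trans[OF cond_mutual_info_nonneg[OF finite_J] less_imp_le[OF R]] by auto
  \<comment> \<open>A crude bound on every distortion value, hence on the cost of a decoding
    error.\<close>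
  define K where "K = (\<Sum>x\<in>UNIV. \<Sum>xh\<in>UNIV. d x xh)"
  have K: "d x xh \<le> K" for x xh
  proof -
    have "d x xh \<le> (\<Sum>xh\<in>UNIV. d x xh)"
      using d_nonneg by (intro member_le_sum) auto
    also have "\<dots> \<le> K"
      unfolding K_def using d_nonneg by (intro member_le_sum[of x UNIV "\<lambda>x. \<Sum>xh\<in>UNIV. d x xh"]) (auto intro!: sum_nonneg)
    finally show ?thesis .
  qed
  have K0: "0 \<le> K"
    by (rule order_trans[OF d_nonneg K])
  let ?au = "\<lambda>((x,y,z),u,w). pmf (pu y) u" and ?aw = "\<lambda>((x,y,z),u,w). pmf (pw x u) w"
    and ?bx = "\<lambda>((x,y,z),u,w). pmf (qx x) u" and ?bz = "\<lambda>((x,y,z),u,w). pmf (qz z) u"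
    and ?bw = "\<lambda>((x,y,z),u,w). pmf (qw u z) w"
  have pos: "0 < ?au t" "0 < ?aw t" "0 < ?bx t" "0 < ?bz t" "0 < ?bw t" if "t \<in> set_pmf letters.T1" for t
  proof -
    obtain x y z u w where t: "t = ((x, y, z), u, w)" by (metis prod.exhaust)
    have s: "(x, y, z, u, w) \<in> set_pmf J"
      using that unfolding t by (rule letters_in_J)
    show "0 < ?au t" "0 < ?aw t" "0 < ?bx t" "0 < ?bz t" "0 < ?bw t"
      using J_memD[OF s] q_pos[OF s] by (simp_all add: t)
  qed
  have lx: "\<E> letters.T1 (\<lambda>t. log 2 (?au t / ?bx t)) < R1"
    using expectation_letters[of "\<lambda>(x,y,z,u,w). log 2 (pmf (pu y) u / pmf (qx x) u)"] log_ratio_x R1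
    by (simp add: case_prod_unfold)
  have lz: "\<E> letters.T1 (\<lambda>t. log 2 (?au t / ?bz t)) < R1"
    using expectation_letters[of "\<lambda>(x,y,z,u,w). log 2 (pmf (pu y) u / pmf (qz z) u)"] log_ratio_z R1
    by (simp add: case_prod_unfold)
  have lw: "\<E> letters.T1 (\<lambda>t. log 2 (?aw t / ?bw t)) < R"
    using expectation_letters[of "\<lambda>(x,y,z,u,w). log 2 (pmf (pw x u) w / pmf (qw u z) w)"] log_ratio_w R
    by (simp add: case_prod_unfold)
  obtain \<beta>1 where \<beta>1: "0 \<le> \<beta>1" "\<beta>1 < 1" "\<And>n (M::real). 2 powr (real n * R1) / 2 \<le> M \<Longrightarrow>
     \<E> (letters.Tn n) (\<lambda>(s, us, ws). miss ((\<Prod>i<n. ?au (s i, us i, ws i)) / M) (\<Prod>i<n. ?bx (s i, us i, ws i))) \<le> 2 * \<beta>1 ^ n"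
    using letters.miss_exponent[of ?au ?bx R1, OF pos(1) pos(3) lx] by blast
  obtain \<beta>2 where \<beta>2: "0 \<le> \<beta>2" "\<beta>2 < 1" "\<And>n (M::real). 2 powr (real n * R1) / 2 \<le> M \<Longrightarrow>
     \<E> (letters.Tn n) (\<lambda>(s, us, ws). miss ((\<Prod>i<n. ?au (s i, us i, ws i)) / M) (\<Prod>i<n. ?bz (s i, us i, ws i))) \<le> 2 * \<beta>2 ^ n"
    using letters.miss_exponent[of ?au ?bz R1, OF pos(1) pos(4) lz] by blast
  obtain \<beta>3 where \<beta>3: "0 \<le> \<beta>3" "\<beta>3 < 1" "\<And>n (M::real). 2 powr (real n * R) / 2 \<le> M \<Longrightarrow>
     \<E> (letters.Tn n) (\<lambda>(s, us, ws). miss ((\<Prod>i<n. ?aw (s i, us i, ws i)) / M) (\<Prod>i<n. ?bw (s i, us i, ws i))) \<le> 2 * \<beta>3 ^ n"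
    using letters.miss_exponent[of ?aw ?bw R, OF pos(2) pos(5) lw] by blast
  define \<gamma> where "\<gamma> n = K * (2 * \<beta>1 ^ n + 2 * \<beta>2 ^ n + 2 * \<beta>3 ^ n)" for n
  have code: "\<exists>f1 f g. (\<forall>ys. f1 ys \<in> {1..num_msgs n R1}) \<and> (\<forall>xs t1. f xs t1 \<in> {1..num_msgs n R}) \<and>
        code_distortion pxy pzx d n f1 f g \<le> D + \<gamma> n" if n: "0 < n" for n
  proof -
    let ?B = "src_block pxy pzx n"
    let ?xs = "\<lambda>s i. fst (s i :: 'x \<times> 'y \<times> 'z)" and ?ys = "\<lambda>s i. fst (snd (s i :: 'x \<times> 'y \<times> 'z))"
      and ?zs = "\<lambda>s i. snd (snd (s i :: 'x \<times> 'y \<times> 'z))"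
    define S where "S = map_pmf (\<lambda>s. (?xs s, ?ys s, ?zs s)) ?B"
    define PU where "PU y = Pi_pmf {..<n} 0 (\<lambda>i. pu (y i))" for y
    define PW where "PW x u = Pi_pmf {..<n} 0 (\<lambda>i. pw (x i) (u i))" for x u
    define QX where "QX x = Pi_pmf {..<n} 0 (\<lambda>i. qx (x i))" for x
    define QZ where "QZ z = Pi_pmf {..<n} 0 (\<lambda>i. qz (z i))" for z
    define QW where "QW u z = Pi_pmf {..<n} 0 (\<lambda>i. qw (u i) (z i))" for u z
    define cost where "cost x xh = (1 / real n) * (\<Sum>i<n. d (x i) (xh i))" for x :: "nat \<Rightarrow> 'x" and xh :: "nat \<Rightarrow> 'xh"
    define rec where "rec u w z = (\<lambda>i. xhat (u i) (w i) (z i))" for u w :: "nat \<Rightarrow> nat" and z :: "nat \<Rightarrow> 'z"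
    let ?M1 = "num_msgs n R1" and ?M2 = "num_msgs n R"
    have cost: "0 \<le> cost x xh" "cost x xh \<le> K" for x xh
    proof -
      show "0 \<le> cost x xh"
        unfolding cost_def using d_nonneg by (intro mult_nonneg_nonneg sum_nonneg) auto
      have "(\<Sum>i<n. d (x i) (xh i)) \<le> (\<Sum>i<n. K)"
        by (intro sum_mono K)
      then show "cost x xh \<le> K"
        unfolding cost_def using n by (simp add: field_simps)
    qed
    have fpu: "finite (set_pmf (pu y))" and fpw: "finite (set_pmf (pw x u))" for x y u
      using letters.fin_k1[of "(undefined, y, undefined)"] letters.fin_k2[of "(x, undefined, undefined)"] by auto
    have fqx: "finite (set_pmf (qx x))" and fqz: "finite (set_pmf (qz z))" and fqw: "finite (set_pmf (qw u z))" for x z u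
      using cond_law(1)[OF finite_J] by (auto simp: qx_def qz_def qw_def)
    have "\<exists>f1 f g. (\<forall>y. f1 y \<in> {1..?M1}) \<and> (\<forall>x t1. f x t1 \<in> {1..?M2}) \<and>
      \<E> S (\<lambda>(x,y,z). cost x (g (f x (f1 y)) (f1 y) z)) \<le>
      \<E> S (\<lambda>(x,y,z). \<E> (PU y) (\<lambda>u. \<E> (PW x u) (\<lambda>w. cost x (rec u w z) + K *
         (miss (pmf (PU y) u / ?M1) (pmf (QX x) u) + miss (pmf (PU y) u / ?M1) (pmf (QZ z) u)
          + miss (pmf (PW x u) w / ?M2) (pmf (QW u z) w)))))"
      by (rule one_shot_code)
         (use fpu fpw fqx fqz fqw num_msgs_lower(2) rates cost in
           \<open>auto simp: S_def finite_src_block PU_def PW_def QX_def QZ_def QW_def set_Pi_pmf finite_PiE_dflt\<close>)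
    then obtain f1 f g where f1: "\<And>y. f1 y \<in> {1..?M1}" and f: "\<And>x t1. f x t1 \<in> {1..?M2}"
      and le: "\<E> S (\<lambda>(x,y,z). cost x (g (f x (f1 y)) (f1 y) z)) \<le>
      \<E> S (\<lambda>(x,y,z). \<E> (PU y) (\<lambda>u. \<E> (PW x u) (\<lambda>w. cost x (rec u w z) + K *
         (miss (pmf (PU y) u / ?M1) (pmf (QX x) u) + miss (pmf (PU y) u / ?M1) (pmf (QZ z) u)
          + miss (pmf (PW x u) w / ?M2) (pmf (QW u z) w)))))"
      by blast
    let ?mx = "\<lambda>(s, us, ws). miss ((\<Prod>i<n. ?au (s i, us i, ws i)) / ?M1) (\<Prod>i<n. ?bx (s i, us i, ws i))"
      and ?mz = "\<lambda>(s, us, ws). miss ((\<Prod>i<n. ?au (s i, us i, ws i)) / ?M1) (\<Prod>i<n. ?bz (s i, us i, ws i))"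
      and ?mw = "\<lambda>(s, us, ws). miss ((\<Prod>i<n. ?aw (s i, us i, ws i)) / ?M2) (\<Prod>i<n. ?bw (s i, us i, ws i))"
      and ?c = "\<lambda>(s, us, ws). cost (?xs s) (rec us ws (?zs s))"
      and ?L = "\<lambda>(s,u,w). cost (?xs s) (rec u w (?zs s)) + K *
         (miss (pmf (PU (?ys s)) u / ?M1) (pmf (QX (?xs s)) u) + miss (pmf (PU (?ys s)) u / ?M1) (pmf (QZ (?zs s)) u)
          + miss (pmf (PW (?xs s) u) w / ?M2) (pmf (QW u (?zs s)) w))"
    have "code_distortion pxy pzx d n f1 f g = \<E> S (\<lambda>(x,y,z). cost x (g (f x (f1 y)) (f1 y) z))"
      by (simp add: code_distortion_def S_def cost_def Let_def)
    also note le
    also have "\<E> S (\<lambda>(x,y,z). \<E> (PU y) (\<lambda>u. \<E> (PW x u) (\<lambda>w. cost x (rec u w z) + K *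
         (miss (pmf (PU y) u / ?M1) (pmf (QX x) u) + miss (pmf (PU y) u / ?M1) (pmf (QZ z) u)
          + miss (pmf (PW x u) w / ?M2) (pmf (QW u z) w))))) =
      \<E> (letters.Tn n) ?L"
      unfolding letters.expectation_Tn by (simp add: S_def src_block_def PU_def PW_def)
    also have "\<dots> = \<E> (letters.Tn n) (\<lambda>t. ?c t + K * (?mx t + ?mz t + ?mw t))"
    proof (rule expectation_pmf_cong)
      fix t assume mem: "t \<in> set_pmf (letters.Tn n)"
      obtain s us ws where t: "t = (s, us, ws)" by (cases t)
      note out = letters.Tn_outside[OF mem[unfolded t]]
      \<comment> \<open>Outside the block both sequences carry the default, so the product formula
        applies, also under the receivers' posteriors.\<close>
      have "pmf (Pi_pmf {..<n} 0 q) us = (\<Prod>i<n. pmf (q i) (us i))" "pmf (Pi_pmf {..<n} 0 q) ws = (\<Prod>i<n. pmf (q i) (ws i))" for q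
        by (rule pmf_Pi'; use out in simp)+
      then show "?L t = ?c t + K * (?mx t + ?mz t + ?mw t)"
        by (simp add: t PU_def QX_def QZ_def PW_def QW_def case_prod_unfold)
    qed
    also have "\<dots> = \<E> (letters.Tn n) ?c + K * (\<E> (letters.Tn n) ?mx + \<E> (letters.Tn n) ?mz + \<E> (letters.Tn n) ?mw)"
    proof -
      have lin: "\<E> (letters.Tn n) (\<lambda>t. c t + K * (a t + b t + e t)) =
         \<E> (letters.Tn n) c + K * (\<E> (letters.Tn n) a + \<E> (letters.Tn n) b + \<E> (letters.Tn n) e)" for c a b e
        by (simp add: integrable_measure_pmf_finite[OF letters.finite_Tn])
      show ?thesis by (rule lin)
    qed
    also have "\<E> (letters.Tn n) ?c = \<E> J (\<lambda>(x,y,z,u,w). d x (xhat u w z))"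
    proof -
      have "\<E> (letters.Tn n) ?c = \<E> (letters.Tn n) (\<lambda>t. (1 / real n) * (\<Sum>i<n.
         (\<lambda>(s, us, ws). (\<lambda>((x,y,z),u,w). d x (xhat u w z)) (s i, us i, ws i)) t))"
        by (simp add: cost_def rec_def case_prod_unfold)
      also have "\<dots> = (1 / real n) * (\<Sum>i<n. \<E> (letters.Tn n)
         (\<lambda>(s, us, ws). (\<lambda>((x,y,z),u,w). d x (xhat u w z)) (s i, us i, ws i)))"
        by (subst Bochner_Integration.integral_mult_right_zero, subst Bochner_Integration.integral_sum)
           (auto intro!: integrable_measure_pmf_finite[OF letters.finite_Tn])
      also have "\<dots> = (1 / real n) * (\<Sum>i<n. \<E> letters.T1 (\<lambda>((x,y,z),u,w). d x (xhat u w z)))"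
        by (intro arg_cong2[where f = "(*)"] refl sum.cong
            letters.expectation_Tn_coordinate[where h = "\<lambda>((x,y,z),u,w). d x (xhat u w z)"]) simp
      also have "\<dots> = \<E> letters.T1 (\<lambda>((x,y,z),u,w). d x (xhat u w z))"
        using n by simp
      also have "\<dots> = \<E> J (\<lambda>(x,y,z,u,w). d x (xhat u w z))"
        using expectation_letters[of "\<lambda>(x,y,z,u,w). d x (xhat u w z)"] by (simp add: case_prod_unfold)
      finally show ?thesis .
    qed
    also have "\<E> J (\<lambda>(x,y,z,u,w). d x (xhat u w z)) + K * (\<E> (letters.Tn n) ?mx + \<E> (letters.Tn n) ?mz + \<E> (letters.Tn n) ?mw)
      \<le> D + \<gamma> n"
      unfolding \<gamma>_def using D K0 \<beta>1(3)[OF num_msgs_lower(1)[OF rates(1)]] \<beta>2(3)[OF num_msgs_lower(1)[OF rates(1)]]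
        \<beta>3(3)[OF num_msgs_lower(1)[OF rates(2)]]
      by (intro add_mono mult_left_mono)
    finally have "code_distortion pxy pzx d n f1 f g \<le> D + \<gamma> n" .
    with f1 f show ?thesis by blast
  qed
  have "\<gamma> \<longlonglongrightarrow> K * (2 * 0 + 2 * 0 + 2 * 0)"
    unfolding \<gamma>_def using \<beta>1 \<beta>2 \<beta>3 by (intro tendsto_intros LIMSEQ_realpow_zero) auto
  then have \<gamma>: "\<gamma> \<longlonglongrightarrow> 0"
    by simp
  show ?thesis
    unfolding achievable_def
  proof (intro allI impI)
    fix \<epsilon> :: real assume "\<epsilon> > 0"
    then have "eventually (\<lambda>n. \<gamma> n < \<epsilon>) sequentially"
      using \<gamma> by (intro order_tendstoD(2)) auto
    then obtain N where N: "\<And>n. n \<ge> N \<Longrightarrow> \<gamma> n < \<epsilon>"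
      by (auto simp: eventually_sequentially)
    show "\<exists>N. \<forall>n\<ge>N. \<exists>f1 f g. (\<forall>ys. f1 ys \<in> {1..num_msgs n R1}) \<and>
        (\<forall>xs t1. f xs t1 \<in> {1..num_msgs n R}) \<and> code_distortion pxy pzx d n f1 f g \<le> D + \<epsilon>"
    \<comment> \<open>The successor keeps block length 0 out, where the averaged cost is
      degenerate.\<close>
    proof (intro exI[of _ "Suc N"] allI impI)
      fix n assume n: "Suc N \<le> n"
      then have "0 < n" "\<gamma> n < \<epsilon>"
        using N[of n] by auto
      then show "\<exists>f1 f g. (\<forall>ys. f1 ys \<in> {1..num_msgs n R1}) \<and>
        (\<forall>xs t1. f xs t1 \<in> {1..num_msgs n R}) \<and> code_distortion pxy pzx d n f1 f g \<le> D + \<epsilon>"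
        using code[OF \<open>0 < n\<close>] by (meson add_left_mono less_imp_le order_trans)
    qed
  qed
qed

end

text \<open>Boundary rates need not satisfy the strict inequalities of \<open>achievability\<close>.
  Adding \<open>1 / Suc k\<close> to both rates makes them strict, and the closure recovers the
  limit.\<close>

lemma (in helper_source) single_letter_region_subset:
  "single_letter_region pxy pzx d D \<subseteq> operational_region pxy pzx d D"
proof clarify
  fix R R1 assume "(R, R1) \<in> single_letter_region pxy pzx d D"
  then obtain pu :: "'y \<Rightarrow> nat pmf" and pw :: "'x \<Rightarrow> nat \<Rightarrow> nat pmf" and xhat where
    fin: "finite (\<Union>y. set_pmf (pu y))" "finite (\<Union>x. \<Union>u. set_pmf (pw x u))" and
    I1: "cond_mutual_info (aux_joint pxy pzx pu pw) (\<lambda>(x,y,z,u,w). u) (\<lambda>(x,y,z,u,w). y) (\<lambda>(x,y,z,u,w). z) \<le> R1" and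
    I2: "cond_mutual_info (aux_joint pxy pzx pu pw) (\<lambda>(x,y,z,u,w). x) (\<lambda>(x,y,z,u,w). w)
        (\<lambda>v. ((\<lambda>(x,y,z,u,w). u) v, (\<lambda>(x,y,z,u,w). z) v)) \<le> R" and
    D: "measure_pmf.expectation (aux_joint pxy pzx pu pw) (\<lambda>(x,y,z,u,w). d x (xhat u w z)) \<le> D"
    unfolding single_letter_region_def Let_def mem_Collect_eq prod.case by (elim exE conjE) (rule that)
  interpret aux_channels pxy pzx d pu pw
    by unfold_locales (use fin in auto)
  have "(R + 1 / real (Suc k), R1 + 1 / real (Suc k)) \<in> {(R, R1). achievable pxy pzx d D R R1}" for k
  proof -
    have e: "0 < 1 / real (Suc k)" by simp
    have "cond_mutual_info J U Y Z < R1 + 1 / real (Suc k)"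
      using I1 e unfolding aux_joint_eq_joint by linarith
    moreover have "cond_mutual_info J X W (\<lambda>s. (U s, Z s)) < R + 1 / real (Suc k)"
      using I2 e unfolding aux_joint_eq_joint by linarith
    ultimately show ?thesis
      unfolding mem_Collect_eq prod.case by (rule achievability) (rule D[unfolded aux_joint_eq_joint])
  qed
  moreover have "(\<lambda>k. (R + 1 / real (Suc k), R1 + 1 / real (Suc k))) \<longlonglongrightarrow> (R + 0, R1 + 0)"
    by (intro tendsto_intros LIMSEQ_inverse_real_of_nat[unfolded inverse_eq_divide])
  ultimately show "(R, R1) \<in> operational_region pxy pzx d D"
    unfolding operational_region_def closure_sequential
    by (intro exI[of _ "\<lambda>k. (R + 1 / real (Suc k), R1 + 1 / real (Suc k))"]) simp
qed

theorem theorem2: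
  fixes pxy :: "('x::finite \<times> 'y::finite) pmf"
    and pzx :: "'x \<Rightarrow> 'z::finite pmf"
    and d :: "'x \<Rightarrow> 'xh::finite \<Rightarrow> real"
    and D :: real
  assumes "\<And>x xh. d x xh \<ge> 0"
  shows "operational_region pxy pzx d D = single_letter_region pxy pzx d D"
proof -
  interpret helper_source pxy pzx d
    by unfold_locales (rule assms)
  show ?thesis
    using operational_region_subset single_letter_region_subset by (rule equalityI)
qed

end
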